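(* There exists an algorithm that, given a connected simple graph $G$ and a path decomposition $\mathcal{P}=(X_1,\ldots,X_d)$ of $G$ of width $k$, returns a connected path decomposition $\mathcal{C}=(Z_1,\ldots,Z_m)$ of $G$ such that $\mathrm{width}(\mathcal{C})\leq 2k+1$ and $m\leq kd$. The running time of the algorithm is $O(dk^2)$.
   Context: A path decomposition of a simple graph $G$ is a sequence $(X_1,\ldots,X_d)$ of subsets of $V(G)$ ("bags") such that $\bigcup_i X_i=V(G)$; every edge $\{u,v\}\in E(G)$ has both endpoints in some bag $X_i$; and $X_i\cap X_k\subseteq X_j$ whenever $1\leq i\leq j\leq k\leq d$. Its width is $\max_i |X_i|-1$. A path decomposition $(X_1,\ldots,X_d)$ is connected if the induced subgraph $G[X_1\cup\cdots\cup X_i]$ is connected for every $i=1,\ldots,d$.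
   Formalization: The width k is assumed to be at least 1: for k = 0 the graph is a single vertex, and m ≤ kd = 0 would force an empty sequence of bags, which is not a path decomposition of it. *)

theory Defs
  imports "Graph_Theory.Graph_Theory"
begin

text \<open>
  A finite simple graph is a \<open>pair_graph\<close>: a finite loop-free digraph whose arc set is symmetric,
  each undirected edge being represented by its two orientations. The library notion \<open>connected\<close>
  includes nonemptiness of the vertex set. Bags are indexed from 0.
\<close>

definition path_decomposition :: "'a pair_pre_digraph \<Rightarrow> 'a set list \<Rightarrow> bool" where
  "path_decomposition G Xs \<longleftrightarrow>
     \<Union>(set Xs) = pverts G \<and>
     (\<forall>(u, v) \<in> parcs G. \<exists>X \<in> set Xs. u \<in> X \<and> v \<in> X) \<and>
     (\<forall>i j k. i \<le> j \<and> j \<le> k \<and> k < length Xs \<longrightarrow> Xs ! i \<inter> Xs ! k \<subseteq> Xs ! j)"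

text \<open>Only meaningful for nonempty sequences of finite bags.\<close>

definition width :: "'a set list \<Rightarrow> int" where
  "width Xs = int (Max (card ` set Xs)) - 1"

definition connected_path_decomposition :: "'a pair_pre_digraph \<Rightarrow> 'a set list \<Rightarrow> bool" where
  "connected_path_decomposition G Xs \<longleftrightarrow>
     path_decomposition G Xs \<and>
     (\<forall>i \<in> {1..length Xs}. connected (with_proj G \<restriction> \<Union>(set (take i Xs))))"

text \<open>
  Algorithms are finite programs for a unit-cost random access machine over the natural numbers with
  addition and truncated subtraction as its only arithmetic (no multiplication, division or bit
  operations). The memory consists of registers and arrays, both addressed by name; a program
  mentions only finitely many of them, so the arrays could be interleaved in one memory at the cost
  of a constant factor. Each constructor of an expression is charged one step per evaluation, and
  so is each assignment and each branching decision.
\<close>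

datatype aexp =
    Const nat
  | Reg string
  | Read string aexp
  | Add aexp aexp
  | Sub aexp aexp

datatype bexp =
    Less aexp aexp
  | Not bexp
  | And bexp bexp

datatype com =
    Skip
  | Assign string aexp
  | Write string aexp aexp
  | Seq com com
  | If bexp com com
  | While bexp com

record state =
  regs :: "string \<Rightarrow> nat"
  arrs :: "string \<Rightarrow> nat \<Rightarrow> nat"

fun aval :: "aexp \<Rightarrow> state \<Rightarrow> nat" where
  "aval (Const n) s = n"
| "aval (Reg x) s = regs s x"
| "aval (Read a e) s = arrs s a (aval e s)"
| "aval (Add e f) s = aval e s + aval f s"
| "aval (Sub e f) s = aval e s - aval f s"

fun acost :: "aexp \<Rightarrow> nat" where
  "acost (Const n) = 1"
| "acost (Reg x) = 1"
| "acost (Read a e) = acost e + 1"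
| "acost (Add e f) = acost e + acost f + 1"
| "acost (Sub e f) = acost e + acost f + 1"

fun bval :: "bexp \<Rightarrow> state \<Rightarrow> bool" where
  "bval (Less e f) s \<longleftrightarrow> aval e s < aval f s"
| "bval (Not b) s \<longleftrightarrow> \<not> bval b s"
| "bval (And b b') s \<longleftrightarrow> bval b s \<and> bval b' s"

fun bcost :: "bexp \<Rightarrow> nat" where
  "bcost (Less e f) = acost e + acost f + 1"
| "bcost (Not b) = bcost b + 1"
| "bcost (And b b') = bcost b + bcost b' + 1"

text \<open>\<open>exec p s t s'\<close>: started in \<open>s\<close>, program \<open>p\<close> halts in \<open>s'\<close> after exactly \<open>t\<close> steps.\<close>

inductive exec :: "com \<Rightarrow> state \<Rightarrow> nat \<Rightarrow> state \<Rightarrow> bool" where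
  Skip: "exec Skip s 1 s"
| Assign: "exec (Assign x e) s (acost e + 1) (s\<lparr>regs := (regs s)(x := aval e s)\<rparr>)"
| Write: "exec (Write a e f) s (acost e + acost f + 1)
     (s\<lparr>arrs := (arrs s)(a := (arrs s a)(aval e s := aval f s))\<rparr>)"
| Seq: "exec p s t s' \<Longrightarrow> exec q s' t' s'' \<Longrightarrow> exec (Seq p q) s (t + t') s''"
| IfTrue: "bval b s \<Longrightarrow> exec p s t s' \<Longrightarrow> exec (If b p q) s (bcost b + 1 + t) s'"
| IfFalse: "\<not> bval b s \<Longrightarrow> exec q s t s' \<Longrightarrow> exec (If b p q) s (bcost b + 1 + t) s'"
| WhileFalse: "\<not> bval b s \<Longrightarrow> exec (While b p) s (bcost b + 1) s"
| WhileTrue: "bval b s \<Longrightarrow> exec p s t s' \<Longrightarrow> exec (While b p) s' t' s'' \<Longrightarrow>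
     exec (While b p) s (bcost b + 1 + t + t') s''"

inductive_cases exec_SkipE: "exec Skip s t s'"
  and exec_AssignE: "exec (Assign x e) s t s'"
  and exec_WriteE: "exec (Write a e f) s t s'"
  and exec_SeqE: "exec (Seq p q) s t s'"
  and exec_IfE: "exec (If b p q) s t s'"
  and exec_WhileE: "exec (While b p) s t s'"

lemma exec_deterministic:
  assumes "exec p s t s'" and "exec p s u r"
  shows "u = t \<and> r = s'"
  using assms
proof (induction arbitrary: u r rule: exec.induct)
  case (Skip s)
  then show ?case by (auto elim: exec_SkipE)
next
  case (Assign x e s)
  then show ?case by (auto elim: exec_AssignE)
next
  case (Write a e f s)
  then show ?case by (auto elim: exec_WriteE)
next
  case (Seq p s t s' q t' s'')
  from Seq.prems obtain t1 s1 t2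
    where u: "u = t1 + t2" and p: "exec p s t1 s1" and q: "exec q s1 t2 r"
    by (rule exec_SeqE)
  from Seq.IH(1)[OF p] have "t1 = t" and "s1 = s'" by blast+
  with u q Seq.IH(2)[of t2 r] show ?case by blast
next
  case (IfTrue b s p t s' q)
  from IfTrue.prems IfTrue.hyps(1) obtain t1 where u: "u = bcost b + 1 + t1" and p: "exec p s t1 r"
    by (auto elim: exec_IfE)
  from IfTrue.IH[OF p] u show ?case by blast
next
  case (IfFalse b s q t s' p)
  from IfFalse.prems IfFalse.hyps(1) obtain t1 where u: "u = bcost b + 1 + t1" and q: "exec q s t1 r"
    by (auto elim: exec_IfE)
  from IfFalse.IH[OF q] u show ?case by blast
next
  case (WhileFalse b s p)
  from WhileFalse.prems show ?case
    by (rule exec_WhileE) (use WhileFalse.hyps in auto)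
next
  case (WhileTrue b s p t s' t' s'')
  from WhileTrue.prems WhileTrue.hyps(1) obtain t1 s1 t2
    where u: "u = bcost b + 1 + t1 + t2" and p: "exec p s t1 s1" and w: "exec (While b p) s1 t2 r"
    by (auto elim: exec_WhileE)
  from WhileTrue.IH(1)[OF p] have "t1 = t" and "s1 = s'" by blast+
  with u w WhileTrue.IH(2)[of t2 r] show ?case by blast
qed

text \<open>
  The input is stored in the array \<open>in\<close>, everything else is initially zero. The output is a
  prefix of the array \<open>out\<close>; the encoding of bag sequences below is self-delimiting, so its length
  need not be reported.
\<close>

definition initial_state :: "nat list \<Rightarrow> state" where
  "initial_state xs =
     \<lparr>regs = (\<lambda>_. 0),
      arrs = (\<lambda>_ _. 0)(''in'' := (\<lambda>i. if i < length xs then xs ! i else 0))\<rparr>"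

definition computes_in :: "com \<Rightarrow> nat list \<Rightarrow> nat list \<Rightarrow> nat \<Rightarrow> bool" where
  "computes_in p xs ys t \<longleftrightarrow>
     (\<exists>s. exec p (initial_state xs) t s \<and> (\<forall>i < length ys. arrs s ''out'' i = ys ! i))"

text \<open>
  Graphs on \<open>{..<n}\<close> are given by \<open>n\<close> and a list containing each undirected edge once, in an
  arbitrary orientation; bags are given by arbitrary duplicate-free enumerations.
\<close>

definition lists_edges :: "('a \<times> 'a) list \<Rightarrow> 'a pair_pre_digraph \<Rightarrow> bool" where
  "lists_edges es G \<longleftrightarrow>
     distinct es \<and> set es \<inter> (set es)\<inverse> = {} \<and> parcs G = set es \<union> (set es)\<inverse>"

definition lists_bags :: "'a list list \<Rightarrow> 'a set list \<Rightarrow> bool" where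
  "lists_bags bs Xs \<longleftrightarrow> (\<forall>b \<in> set bs. distinct b) \<and> map set bs = Xs"

definition encode_graph :: "nat \<Rightarrow> (nat \<times> nat) list \<Rightarrow> nat list" where
  "encode_graph n es = n # length es # concat (map (\<lambda>(u, v). [u, v]) es)"

definition encode_bags :: "nat list list \<Rightarrow> nat list" where
  "encode_bags bs = length bs # concat (map (\<lambda>b. length b # b) bs)"

end

theory Submission
  imports Defs
begin

text \<open>
  Let \<open>X t\<close> be the bags and \<open>V t \<subseteq> X t\<close> visited sets that are closed under adjacency inside
  \<open>X t\<close>. Between \<open>t\<close> and \<open>t + 1\<close> lie \<open>L t\<close> vertices of \<open>X t\<close> that are visited in \<open>X (t + 1)\<close> only,
  \<open>R t\<close> vertices of \<open>X (t + 1)\<close> that are visited in \<open>X t\<close> only, and \<open>F t\<close> vertices visited in both;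
  the vertices counted by \<open>L\<close> and \<open>R\<close> cover the boundary of the set of all visited vertices. The search
  always advances the heavier of the two borders at its innermost piece, the rightmost positive \<open>L t\<close>
  or the leftmost positive \<open>R t\<close>, and completes the components of the induced graph on the bag that it
  enters. This keeps every \<open>L\<close> piece to the left of every \<open>R\<close> piece, and \<open>F e\<close> at least the \<open>L\<close> weight
  to the left of \<open>e\<close> as long as some \<open>L\<close> piece lies at \<open>e\<close> or to its right (symmetrically for \<open>R\<close>), and at
  least one of the two weights for all \<open>e\<close>. Since \<open>F\<close> and \<open>L\<close> at one place count disjoint parts of
  one bag, each border has weight at most \<open>k + 1\<close>, and the boundary together with the vertices that
  one step adds has at most \<open>2k + 2\<close> elements.

  In the order of first visits every vertex but the first has an earlier neighbour, so prefixes are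
  connected. The \<open>i\<close>-th new bag consists of the \<open>i\<close>-th vertex and the boundary of its predecessors.
  There are \<open>n - 1 \<le> k d\<close> of them, because a given bag that adds vertices to the
  preceding ones also meets them.

  Each vertex is queued at most once per bag and then costs one scan of that bag, which is \<open>O(d k\<^sup>2)\<close>
  in total. The incidence matrices are affordable because memory is initially zero and only their
  nonzero entries are ever written.
\<close>

section \<open>Program logic\<close>

text \<open>A border is scattered over many bags, so no single bag bounds it directly;
  \<open>F e\<close> acts as a deposit at \<open>e\<close> that certifies its size. Advancing the
  piece at \<open>i\<close> turns its \<open>L i\<close> vertices into additional deposit, after
  which \<open>F i\<close> covers the entire former \<open>L\<close> weight. The bag entered may at
  the same time give rise to a new \<open>R\<close> piece at \<open>i\<close>, and the
  \<open>R\<close> weight to its right must then be covered by \<open>F i\<close>. It is, exactly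
  because \<open>R\<close> was the lighter border: this is why the heavier one moves. The clause
  that asks for only one of the two weights concerns places beyond the innermost \<open>L\<close>
  piece: all \<open>L\<close> weight lies to their left, so the comparison of the totals again turns
  cover for \<open>L\<close> into cover for \<open>R\<close>.

  The bound \<open>2k + 2\<close> is twice the size of a bag. One bag size pays for the lighter
  border. The other is split inside the bag that is entered: its already visited vertices pay for
  the rest of the heavier border, its new ones for themselves.\<close>

definition wp :: "com \<Rightarrow> (nat \<Rightarrow> state \<Rightarrow> bool) \<Rightarrow> state \<Rightarrow> bool" where
  "wp c Q s \<longleftrightarrow> (\<exists>t s'. exec c s t s' \<and> Q t s')"

lemma wp_Skip [simp]: "wp Skip Q s \<longleftrightarrow> Q 1 s"
  unfolding wp_def by (metis exec_SkipE exec.Skip)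

lemma wp_Assign [simp]:
  "wp (Assign x e) Q s \<longleftrightarrow> Q (acost e + 1) (s\<lparr>regs := (regs s)(x := aval e s)\<rparr>)"
  unfolding wp_def by (metis exec_AssignE exec.Assign)

lemma wp_Write [simp]:
  "wp (Write a e f) Q s \<longleftrightarrow> Q (acost e + acost f + 1)
     (s\<lparr>arrs := (arrs s)(a := (arrs s a)(aval e s := aval f s))\<rparr>)"
  unfolding wp_def by (metis exec_WriteE exec.Write)

lemma wp_Seq: "wp (Seq p q) Q s \<longleftrightarrow> wp p (\<lambda>t. wp q (\<lambda>t'. Q (t + t'))) s"
  unfolding wp_def by (blast elim: exec_SeqE intro: exec.Seq)

lemma wp_If: "wp (If b p q) Q s \<longleftrightarrow>
    (if bval b s then wp p (\<lambda>t. Q (bcost b + 1 + t)) s else wp q (\<lambda>t. Q (bcost b + 1 + t)) s)"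
proof -
  have "exec (If b p q) s t s' \<longleftrightarrow>
      (\<exists>t'. t = bcost b + 1 + t' \<and> exec (if bval b s then p else q) s t' s')" for t s'
    by (auto intro: exec.IfTrue[simplified] exec.IfFalse[simplified] elim!: exec_IfE)
  then show ?thesis unfolding wp_def by (cases "bval b s") auto
qed

lemma wp_mono: "wp c P s \<Longrightarrow> (\<And>t s'. P t s' \<Longrightarrow> Q t s') \<Longrightarrow> wp c Q s"
  unfolding wp_def by blast

primrec wregs :: "com \<Rightarrow> string set" where
  "wregs Skip = {}"
| "wregs (Assign x e) = {x}"
| "wregs (Write a e f) = {}"
| "wregs (Seq p q) = wregs p \<union> wregs q"
| "wregs (If b p q) = wregs p \<union> wregs q"
| "wregs (While b p) = wregs p"

primrec warrs :: "com \<Rightarrow> string set" where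
  "warrs Skip = {}"
| "warrs (Assign x e) = {}"
| "warrs (Write a e f) = {a}"
| "warrs (Seq p q) = warrs p \<union> warrs q"
| "warrs (If b p q) = warrs p \<union> warrs q"
| "warrs (While b p) = warrs p"

text \<open>The write sets are computed syntactically, so a loop invariant has to mention only what
  the loop body changes.\<close>

definition frame :: "com \<Rightarrow> state \<Rightarrow> state \<Rightarrow> bool" where
  "frame c s s' \<longleftrightarrow> (\<forall>x. x \<notin> wregs c \<longrightarrow> regs s' x = regs s x) \<and>
     (\<forall>a. a \<notin> warrs c \<longrightarrow> arrs s' a = arrs s a)"

lemma exec_frame: "exec c s t s' \<Longrightarrow> frame c s s'"
  by (induction rule: exec.induct) (auto simp: frame_def)

lemma frameD:
  assumes "frame c s s'"
  shows "x \<notin> wregs c \<Longrightarrow> regs s' x = regs s x" "a \<notin> warrs c \<Longrightarrow> arrs s' a = arrs s a"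
  using assms unfolding frame_def by auto

lemma wp_frame: "wp c P s \<Longrightarrow> (\<And>t s'. P t s' \<Longrightarrow> frame c s s' \<Longrightarrow> Q t s') \<Longrightarrow> wp c Q s"
  unfolding wp_def by (blast intro: exec_frame)

text \<open>The frame of the first program is handed on, so its postcondition need not list what
  stays unchanged.\<close>

lemma wp_SeqI:
  assumes "wp p P s"
    and "\<And>t s'. P t s' \<Longrightarrow> frame p s s' \<Longrightarrow> wp q (\<lambda>t'. Q (t + t')) s'"
  shows "wp (Seq p q) Q s"
  unfolding wp_Seq using assms by (rule wp_frame)

text \<open>The potential \<open>\<phi>\<close> of the ghost state \<open>g\<close> pays for the remaining iterations.\<close>

lemma wp_While:
  fixes \<phi> :: "'g \<Rightarrow> nat"
  assumes init: "Inv g s"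
    and step: "\<And>g s'. Inv g s' \<Longrightarrow> bval b s' \<Longrightarrow> frame p s s' \<Longrightarrow>
      wp p (\<lambda>t s''. \<exists>g'. Inv g' s'' \<and> bcost b + 1 + t + \<phi> g' \<le> \<phi> g) s'"
    and exit: "\<And>t g' s'. Inv g' s' \<Longrightarrow> \<not> bval b s' \<Longrightarrow> frame p s s' \<Longrightarrow>
      t + \<phi> g' \<le> \<phi> g + bcost b + 1 \<Longrightarrow> Q t s'"
  shows "wp (While b p) Q s"
proof -
  have "\<exists>t g'' s''. exec (While b p) s' t s'' \<and> frame p s s'' \<and> \<not> bval b s'' \<and>
      Inv g'' s'' \<and> t + \<phi> g'' \<le> \<phi> g' + bcost b + 1" if "Inv g' s'" "frame p s s'" for g' s'
    using that
  proof (induction "\<phi> g'" arbitrary: g' s' rule: less_induct)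
    case less
    show ?case
    proof (cases "bval b s'")
      case False
      then have "exec (While b p) s' (bcost b + 1) s'" by (rule exec.WhileFalse)
      moreover have "bcost b + 1 + \<phi> g' \<le> \<phi> g' + bcost b + 1" by simp
      ultimately show ?thesis using less.prems False by blast
    next
      case True
      from step[OF less.prems(1) True less.prems(2)] obtain t s1 g1
        where 1: "exec p s' t s1" "Inv g1 s1" "bcost b + 1 + t + \<phi> g1 \<le> \<phi> g'"
        unfolding wp_def by blast
      have fr: "frame p s s1"
        using exec_frame[OF 1(1)] less.prems(2) unfolding frame_def by auto
      have "\<phi> g1 < \<phi> g'" using 1(3) by linarith
      from less.hyps[OF this 1(2) fr] obtain t2 g2 s2
        where 2: "exec (While b p) s1 t2 s2" "frame p s s2" "\<not> bval b s2" "Inv g2 s2"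
          "t2 + \<phi> g2 \<le> \<phi> g1 + bcost b + 1" by blast
      have "exec (While b p) s' (bcost b + 1 + t + t2) s2"
        using exec.WhileTrue[OF True 1(1) 2(1)] .
      moreover have "bcost b + 1 + t + t2 + \<phi> g2 \<le> \<phi> g' + bcost b + 1" using 1(3) 2(5) by linarith
      ultimately show ?thesis using 2(2-4) by blast
    qed
  qed
  moreover have "frame p s s" unfolding frame_def by simp
  ultimately obtain t g' s' where "exec (While b p) s t s'" "frame p s s'" "\<not> bval b s'"
    "Inv g' s'" "t + \<phi> g' \<le> \<phi> g + bcost b + 1" using init by blast
  then show ?thesis unfolding wp_def using exit by blast
qed

notation Seq (infixr ";;" 60)
notation Assign (infix "::=" 61)

abbreviation cell :: "string \<Rightarrow> aexp \<Rightarrow> aexp \<Rightarrow> aexp" where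
  "cell a i v \<equiv> Read a (Add (Read ''row'' i) v)"

abbreviation incr :: "string \<Rightarrow> com" where
  "incr x \<equiv> x ::= Add (Reg x) (Const 1)"

abbreviation mark :: "string \<Rightarrow> aexp \<Rightarrow> aexp \<Rightarrow> com" where
  "mark a i v \<equiv> Write a (Add (Read ''row'' i) v) (Const 1)"

text \<open>
  Matrices are addressed through a table \<open>row\<close> of the multiples of \<open>n\<close>, as there is no multiplication.
\<close>

definition matrix :: "nat \<Rightarrow> (nat \<Rightarrow> nat) \<Rightarrow> (nat \<Rightarrow> nat \<Rightarrow> bool) \<Rightarrow> bool" where
  "matrix n a f \<longleftrightarrow> (\<forall>i. \<forall>v < n. a (i * n + v) = (if f i v then 1 else 0))"

lemma matrix_index:
  assumes "v < n" "w < (n :: nat)"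
  shows "i * n + v = j * n + w \<longleftrightarrow> i = j \<and> v = w"
proof
  assume eq: "i * n + v = j * n + w"
  have "(i * n + v) div n = i" "(j * n + w) div n = j" using assms by auto
  then show "i = j \<and> v = w" using eq by auto
qed simp

lemma matrix_mark:
  assumes "matrix n a f" "v < n" "\<And>j w. w < n \<Longrightarrow> g j w \<longleftrightarrow> f j w \<or> j = i \<and> w = v"
  shows "matrix n (a(i * n + v := Suc 0)) g"
  using assms unfolding matrix_def by (auto simp: matrix_index)

lemma matrixD: "matrix n a f \<Longrightarrow> v < n \<Longrightarrow> a (i * n + v) = (if f i v then 1 else 0)"
  unfolding matrix_def by blast

definition holds :: "state \<Rightarrow> string \<Rightarrow> string \<Rightarrow> nat list \<Rightarrow> bool" where
  "holds s x a xs \<longleftrightarrow> regs s x = length xs \<and> (\<forall>i < length xs. arrs s a i = xs ! i)"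

lemma holds_cong: "regs s' x = regs s x \<Longrightarrow> arrs s' a = arrs s a \<Longrightarrow> holds s' x a xs = holds s x a xs"
  unfolding holds_def by simp

lemma holds_push:
  "holds s x a xs \<Longrightarrow> regs s' x = Suc (regs s x) \<Longrightarrow> arrs s' a = (arrs s a)(regs s x := v) \<Longrightarrow>
    holds s' x a (xs @ [v])"
  unfolding holds_def by (auto simp: nth_append less_Suc_eq)

lemma holds_nth: "holds s x a xs \<Longrightarrow> i < length xs \<Longrightarrow> arrs s a i = xs ! i"
  and holds_length: "holds s x a xs \<Longrightarrow> regs s x = length xs"
  unfolding holds_def by auto

section \<open>Reading the input\<close>

definition bag_offset :: "nat list list \<Rightarrow> nat \<Rightarrow> nat" where
  "bag_offset bs i = sum_list (map (\<lambda>b. Suc (length b)) (take i bs))"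

text \<open>The list encoding restated cell by cell. The offsets 2, 3 and 4 arise from the two
  header cells of the graph, the cell with the number of bags and the length cell of a bag.\<close>

definition encoded :: "(nat \<Rightarrow> nat) \<Rightarrow> nat \<Rightarrow> (nat \<times> nat) list \<Rightarrow> nat list list \<Rightarrow> bool" where
  "encoded a n es bs \<longleftrightarrow>
     a 0 = n \<and> a 1 = length es \<and>
     (\<forall>j < length es. a (2 + 2 * j) = fst (es ! j) \<and> a (3 + 2 * j) = snd (es ! j)) \<and>
     a (2 + 2 * length es) = length bs \<and>
     (\<forall>i < length bs. a (3 + 2 * length es + bag_offset bs i) = length (bs ! i) \<and>
       (\<forall>j < length (bs ! i). a (4 + 2 * length es + bag_offset bs i + j) = bs ! i ! j))"

lemma bag_offset_Suc: "i < length bs \<Longrightarrow> bag_offset bs (Suc i) = bag_offset bs i + Suc (length (bs ! i))"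
  unfolding bag_offset_def by (simp add: take_Suc_conv_app_nth)

lemma nth_concat_edges:
  "j < length es \<Longrightarrow> (concat (map (\<lambda>(u, v). [u, v]) es) @ ys) ! (2 * j) = fst (es ! j) \<and>
     (concat (map (\<lambda>(u, v). [u, v]) es) @ ys) ! Suc (2 * j) = snd (es ! j)"
proof (induction es arbitrary: j)
  case (Cons e es)
  then show ?case by (cases j) (auto split: prod.splits)
qed simp

lemma length_concat_edges: "length (concat (map (\<lambda>(u, v). [u, v]) es)) = 2 * length es"
  by (induction es) auto

lemma nth_concat_bags:
  assumes "i < length bs"
  shows "bag_offset bs i + length (bs ! i) < length (concat (map (\<lambda>b. length b # b) bs)) \<and>
     concat (map (\<lambda>b. length b # b) bs) ! bag_offset bs i = length (bs ! i) \<and>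
     (\<forall>j < length (bs ! i). concat (map (\<lambda>b. length b # b) bs) ! (Suc (bag_offset bs i + j)) = bs ! i ! j)"
  using assms
proof (induction bs arbitrary: i)
  case (Cons b bs)
  show ?case
  proof (cases i)
    case 0
    then show ?thesis by (auto simp: bag_offset_def nth_append)
  next
    case (Suc i')
    have "bag_offset (b # bs) i = Suc (length b) + bag_offset bs i'"
      by (simp add: Suc bag_offset_def)
    then show ?thesis using Cons Suc by (auto simp: nth_append)
  qed
qed simp

lemma encoded_input:
  assumes "xs = encode_graph n es @ encode_bags bs"
  shows "encoded (\<lambda>i. if i < length xs then xs ! i else 0) n es bs"
proof -
  let ?B = "concat (map (\<lambda>b. length b # b) bs)" and ?E = "concat (map (\<lambda>(u, v). [u, v]) es)"
  have xs: "xs = n # length es # ?E @ length bs # ?B"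
    unfolding assms encode_graph_def encode_bags_def by simp
  have len: "length xs = 3 + 2 * length es + length ?B"
    unfolding xs by (simp add: length_concat_edges)
  have B: "xs ! (3 + 2 * length es + j) = ?B ! j" for j
    unfolding xs by (simp add: numeral_3_eq_3 nth_append length_concat_edges)
  have B': "xs ! (4 + 2 * length es + j) = ?B ! Suc j" for j
    using B[of "Suc j"] by (simp add: eval_nat_numeral)
  have d: "xs ! (2 + 2 * length es) = length bs"
    unfolding xs by (simp add: nth_append length_concat_edges)
  have e: "xs ! (2 + 2 * j) = fst (es ! j) \<and> xs ! (3 + 2 * j) = snd (es ! j)" if "j < length es" for j
    using nth_concat_edges[OF that] unfolding xs by (simp add: numeral_3_eq_3)
  show ?thesis
    unfolding encoded_def
  proof (intro conjI allI impI)
    fix i assume i: "i < length bs"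
    note nb = nth_concat_bags[OF i]
    show "(if 3 + 2 * length es + bag_offset bs i < length xs
        then xs ! (3 + 2 * length es + bag_offset bs i) else 0) = length (bs ! i)"
      using nb B[of "bag_offset bs i"] unfolding len by auto
    fix j assume "j < length (bs ! i)"
    then show "(if 4 + 2 * length es + bag_offset bs i + j < length xs
        then xs ! (4 + 2 * length es + bag_offset bs i + j) else 0) = bs ! i ! j"
      using nb B'[of "bag_offset bs i + j"] unfolding len by (auto simp: add.assoc)
  next
    show "(if 0 < length xs then xs ! 0 else 0) = n" "(if 1 < length xs then xs ! 1 else 0) = length es"
      unfolding xs by auto
    show "(if 2 + 2 * length es < length xs then xs ! (2 + 2 * length es) else 0) = length bs"
      using d len by auto
    fix j assume "j < length es"
    then show "(if 2 + 2 * j < length xs then xs ! (2 + 2 * j) else 0) = fst (es ! j)"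
      "(if 3 + 2 * j < length xs then xs ! (3 + 2 * j) else 0) = snd (es ! j)"
      using e len by auto
  qed
qed

text \<open>\<open>row\<close> will be indexed by vertices (for \<open>adj\<close>) and by the bags
  \<open>0\<close> to \<open>d + 1\<close> (for \<open>mem\<close> and \<open>vis\<close>); the
  bound \<open>n + d + 2\<close> covers both. Register \<open>e\<close> is the end of the edge list
  and the address of the number of bags.\<close>

definition read_header :: com where
  "read_header =
     ''n'' ::= Read ''in'' (Const 0) ;;
     ''e'' ::= Add (Const 2) (Add (Read ''in'' (Const 1)) (Read ''in'' (Const 1))) ;;
     ''d'' ::= Read ''in'' (Reg ''e'') ;;
     ''i'' ::= Const 0 ;;
     ''x'' ::= Const 0 ;;
     While (Less (Reg ''i'') (Add (Reg ''n'') (Add (Reg ''d'') (Const 2))))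
       (Write ''row'' (Reg ''i'') (Reg ''x'') ;;
        ''x'' ::= Add (Reg ''x'') (Reg ''n'') ;;
        incr ''i'')"

definition read_edges :: com where
  "read_edges =
     ''p'' ::= Const 2 ;;
     While (Less (Reg ''p'') (Reg ''e''))
       (''u'' ::= Read ''in'' (Reg ''p'') ;;
        ''v'' ::= Read ''in'' (Add (Reg ''p'') (Const 1)) ;;
        mark ''adj'' (Reg ''u'') (Reg ''v'') ;;
        mark ''adj'' (Reg ''v'') (Reg ''u'') ;;
        ''p'' ::= Add (Reg ''p'') (Const 2))"

text \<open>The search will start at vertex \<open>0\<close>; register \<open>c\<close> remembers a
  bag that contains it.\<close>

definition read_bag :: com where
  "read_bag =
     While (Less (Reg ''p'') (Read ''end'' (Reg ''i'')))
       (''v'' ::= Read ''in'' (Reg ''p'') ;;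
        mark ''mem'' (Reg ''i'') (Reg ''v'') ;;
        If (Less (Reg ''v'') (Const 1)) (''c'' ::= Reg ''i'') Skip ;;
        incr ''p'')"

definition read_bags :: com where
  "read_bags =
     ''p'' ::= Add (Reg ''e'') (Const 1) ;;
     ''i'' ::= Const 0 ;;
     While (Less (Reg ''i'') (Reg ''d''))
       (incr ''i'' ;;
        Write ''end'' (Reg ''i'') (Add (Reg ''p'') (Add (Const 1) (Read ''in'' (Reg ''p'')))) ;;
        incr ''p'' ;;
        Write ''beg'' (Reg ''i'') (Reg ''p'') ;;
        read_bag)"

definition adjacent :: "(nat \<times> nat) list \<Rightarrow> nat \<Rightarrow> nat \<Rightarrow> bool" where
  "adjacent es u v \<longleftrightarrow> (u, v) \<in> set es \<or> (v, u) \<in> set es"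

text \<open>Shifted by one and extended by empty bags, so that both neighbours of a given bag exist
  and the ends need no case distinction.\<close>

definition layer :: "nat list list \<Rightarrow> nat \<Rightarrow> nat list" where
  "layer bs t = (if t \<in> {1..length bs} then bs ! (t - 1) else [])"

definition rows :: "nat \<Rightarrow> nat \<Rightarrow> state \<Rightarrow> bool" where
  "rows N n s \<longleftrightarrow> (\<forall>i < N. arrs s ''row'' i = i * n)"

lemma wp_read_header:
  assumes "encoded (arrs s ''in'') n es bs"
  shows "wp read_header (\<lambda>t s'. t \<le> 40 * (n + length bs + 3) \<and> regs s' ''n'' = n \<and>
    regs s' ''e'' = 2 + 2 * length es \<and> regs s' ''d'' = length bs \<and> rows (n + length bs + 2) n s') s"
proof -
  have enc: "arrs s ''in'' 0 = n" "arrs s ''in'' (Suc 0) = length es"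
    "arrs s ''in'' (Suc (Suc (length es + length es))) = length bs"
  proof -
    have "arrs s ''in'' 0 = n" "arrs s ''in'' 1 = length es" "arrs s ''in'' (2 + 2 * length es) = length bs"
      using assms unfolding encoded_def by simp_all
    then show "arrs s ''in'' 0 = n" "arrs s ''in'' (Suc 0) = length es"
      "arrs s ''in'' (Suc (Suc (length es + length es))) = length bs" by (simp_all add: mult_2)
  qed
  show ?thesis
    unfolding read_header_def
    apply (simp add: wp_Seq enc)
  proof (rule wp_While[where g = 0 and \<phi> = "\<lambda>i. 40 * (n + length bs + 2 - i)" and
      Inv = "\<lambda>i s. regs s ''i'' = i \<and> regs s ''x'' = i * n \<and> i \<le> n + length bs + 2 \<and> rows i n s"],
      goal_cases init step exit)
    case init
    show ?case by (simp add: rows_def)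
  next
    case (step i s')
    note fr = frameD(1)[OF step(3)]
    have "i < n + length bs + 2" using step(1,2) by (simp add: fr)
    then show ?case
      using step(1) by (simp add: wp_Seq fr) (simp add: rows_def less_Suc_eq, linarith)
  next
    case (exit t i s')
    note fr = frameD(1)[OF exit(3)]
    have "i = n + length bs + 2" using exit(1,2) by (simp add: fr)
    then show ?case using exit(1,4) by (simp add: fr)
  qed
qed

lemma wp_read_edges:
  assumes enc: "encoded (arrs s ''in'') n es bs" and rows: "rows N n s" "n \<le> N"
    and es: "\<And>u v. (u, v) \<in> set es \<Longrightarrow> u < n \<and> v < n"
    and e: "regs s ''e'' = 2 + 2 * length es" and adj: "arrs s ''adj'' = (\<lambda>_. 0)"
  shows "wp read_edges (\<lambda>t s'. t \<le> 40 * (length es + 1) \<and> matrix n (arrs s' ''adj'') (adjacent es)) s"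
  unfolding read_edges_def
  apply (simp add: wp_Seq)
proof (rule wp_While[where g = 0 and \<phi> = "\<lambda>j. 40 * (length es - j)" and Inv = "\<lambda>j s. j \<le> length es \<and>
      regs s ''p'' = 2 + 2 * j \<and> matrix n (arrs s ''adj'') (adjacent (take j es))"],
    goal_cases init step exit)
  case init
  show ?case by (simp add: matrix_def adj adjacent_def)
next
  case (step j s')
  note fr = frameD[OF step(3)]
  from step(1) have j: "j \<le> length es" "regs s' ''p'' = 2 + 2 * j"
      "matrix n (arrs s' ''adj'') (adjacent (take j es))" by blast+
  have jl: "j < length es" using step(2) j(2) by (simp add: fr e)
  obtain u v where uv: "es ! j = (u, v)" by fastforce
  then have lt: "u < n" "v < n" using es nth_mem[OF jl] by metis+
  have "in": "arrs s ''in'' (Suc (Suc (2 * j))) = u" "arrs s ''in'' (Suc (Suc (Suc (2 * j)))) = v"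
    using enc jl uv unfolding encoded_def by (auto simp: numeral_eq_Suc)
  have row: "arrs s ''row'' u = u * n" "arrs s ''row'' v = v * n"
    using rows lt by (auto simp: rows_def)
  have 1: "matrix n ((arrs s' ''adj'')(u * n + v := Suc 0))
      (\<lambda>a b. adjacent (take j es) a b \<or> a = u \<and> b = v)"
    by (rule matrix_mark[OF j(3) lt(2)]) simp
  have 2: "matrix n ((arrs s' ''adj'')(u * n + v := Suc 0, v * n + u := Suc 0)) (adjacent (take (Suc j) es))"
    by (rule matrix_mark[OF 1 lt(1)]) (auto simp: take_Suc_conv_app_nth[OF jl] adjacent_def uv)
  show ?case
    apply (simp add: wp_Seq fr j(2) "in" row)
    apply (rule exI[of _ "Suc j"])
    using 2 jl by simp
next
  case (exit t j s')
  note fr = frameD[OF exit(3)]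
  from exit(1) have j: "j \<le> length es" "regs s' ''p'' = 2 + 2 * j"
      "matrix n (arrs s' ''adj'') (adjacent (take j es))" by blast+
  have "j = length es" using exit(2) j by (simp add: fr e)
  then show ?case using j exit(4) by simp
qed

lemma wp_read_bag:
  assumes enc: "encoded (arrs s ''in'') n es bs" and rows: "rows N n s" "t < N"
    and b: "t \<in> {1..length bs}" and n: "\<And>v. v \<in> set (layer bs t) \<Longrightarrow> v < n"
    and i: "regs s ''i'' = t" and p: "regs s ''p'' = 4 + 2 * length es + bag_offset bs (t - 1)"
    and "end": "arrs s ''end'' t = regs s ''p'' + length (layer bs t)"
    and mem: "matrix n (arrs s ''mem'') (\<lambda>i v. i < t \<and> v \<in> set (layer bs i))"
    and c: "(\<exists>i < t. 0 \<in> set (layer bs i)) \<Longrightarrow> 0 \<in> set (layer bs (regs s ''c''))"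
  shows "wp read_bag (\<lambda>tm s'. tm \<le> 40 * (length (layer bs t) + 1) \<and>
    matrix n (arrs s' ''mem'') (\<lambda>i v. i < Suc t \<and> v \<in> set (layer bs i)) \<and>
    ((\<exists>i < Suc t. 0 \<in> set (layer bs i)) \<longrightarrow> 0 \<in> set (layer bs (regs s' ''c''))) \<and>
    regs s' ''p'' = regs s ''p'' + length (layer bs t)) s"
proof -
  let ?b = "layer bs t"
  have lay: "?b = bs ! (t - 1)" using b by (simp add: layer_def)
  have "in": "arrs s ''in'' (regs s ''p'' + j) = ?b ! j" if "j < length ?b" for j
    using enc b that unfolding encoded_def p lay by fastforce
  show ?thesis
    unfolding read_bag_def
  proof (rule wp_While[where g = 0 and \<phi> = "\<lambda>j. 40 * (length ?b - j)" and Inv = "\<lambda>j s'. j \<le> length ?b \<and>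
      regs s' ''p'' = regs s ''p'' + j \<and>
      matrix n (arrs s' ''mem'') (\<lambda>i v. i < t \<and> v \<in> set (layer bs i) \<or> i = t \<and> v \<in> set (take j ?b)) \<and>
      ((\<exists>i < t. 0 \<in> set (layer bs i)) \<or> 0 \<in> set (take j ?b) \<longrightarrow> 0 \<in> set (layer bs (regs s' ''c'')))"],
      goal_cases init step exit)
    case init
    show ?case using mem c by auto
  next
    case (step j s')
    from step(1) have j: "j \<le> length ?b" "j \<le> length ?b" "regs s' ''p'' = regs s ''p'' + j"
      "matrix n (arrs s' ''mem'') (\<lambda>i v. i < t \<and> v \<in> set (layer bs i) \<or> i = t \<and> v \<in> set (take j ?b))"
      "(\<exists>i < t. 0 \<in> set (layer bs i)) \<or> 0 \<in> set (take j ?b) \<longrightarrow> 0 \<in> set (layer bs (regs s' ''c''))"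
      by blast+
    have jl: "j < length ?b" using step(2) j i "end" by (simp add: frameD[OF step(3)])
    let ?v = "?b ! j"
    have v: "?v < n" "?v \<in> set ?b" using n jl by auto
    have row: "arrs s ''row'' t = t * n" using rows by (simp add: rows_def)
    have mat: "matrix n ((arrs s' ''mem'')(t * n + ?v := Suc 0))
       (\<lambda>i v. i < t \<and> v \<in> set (layer bs i) \<or> i = t \<and> v \<in> set (take (Suc j) ?b))"
      using j(4) v(1) by (rule matrix_mark) (use jl in \<open>auto simp: take_Suc_conv_app_nth\<close>)
    let ?c = "0 \<in> set (layer bs (if ?v = 0 then t else regs s' ''c''))"
    have c': "((\<exists>i < t. 0 \<in> set (layer bs i)) \<longrightarrow> ?c) \<and> (0 \<in> set (take (Suc j) ?b) \<longrightarrow> ?c)"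
      using j(5) v(2) jl by (cases "?v = 0") (auto simp: take_Suc_conv_app_nth)
    show ?case
    proof (cases "?v = 0")
      case True
      show ?thesis
        apply (simp add: wp_Seq wp_If frameD[OF step(3)] i j(3) row "in"[OF jl] True)
        using mat c' jl True by simp
    next
      case False
      show ?thesis
        apply (simp add: wp_Seq wp_If frameD[OF step(3)] i j(3) row "in"[OF jl] False)
        using mat c' jl False by simp
    qed
  next
    case (exit t' j s')
    from exit(1) have j: "j \<le> length ?b" "regs s' ''p'' = regs s ''p'' + j"
      "matrix n (arrs s' ''mem'') (\<lambda>i v. i < t \<and> v \<in> set (layer bs i) \<or> i = t \<and> v \<in> set (take j ?b))"
      "(\<exists>i < t. 0 \<in> set (layer bs i)) \<or> 0 \<in> set (take j ?b) \<longrightarrow> 0 \<in> set (layer bs (regs s' ''c''))"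
      by blast+
    have "j = length ?b" using exit(2) j i "end" by (simp add: frameD[OF exit(3)])
    moreover have "i < Suc t \<and> v \<in> set (layer bs i) \<longleftrightarrow> i < t \<and> v \<in> set (layer bs i) \<or> i = t \<and> v \<in> set (layer bs t)" for i v
      by (auto simp: less_Suc_eq)
    ultimately show ?case using j exit(4) by simp (metis less_Suc_eq)
  qed
qed

lemma bag_offset_mono: "i \<le> j \<Longrightarrow> bag_offset bs i \<le> bag_offset bs j"
proof -
  assume "i \<le> j"
  then have "take j bs = take i bs @ take (j - i) (drop i bs)"
    by (metis le_add_diff_inverse take_add)
  then show ?thesis unfolding bag_offset_def by simp
qed

definition bag_table :: "nat list list \<Rightarrow> nat \<Rightarrow> state \<Rightarrow> bool" where
  "bag_table bs d s \<longleftrightarrow> (\<forall>t \<in> {1..d}. arrs s ''end'' t = arrs s ''beg'' t + length (layer bs t) \<and>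
     (\<forall>j < length (layer bs t). arrs s ''in'' (arrs s ''beg'' t + j) = layer bs t ! j))"

lemma wp_read_bags:
  assumes enc: "encoded (arrs s ''in'') n es bs" and rows: "rows (n + length bs + 2) n s"
    and n: "\<And>t v. v \<in> set (layer bs t) \<Longrightarrow> v < n"
    and e: "regs s ''e'' = 2 + 2 * length es" and d: "regs s ''d'' = length bs"
    and mem: "arrs s ''mem'' = (\<lambda>_. 0)"
  shows "wp read_bags (\<lambda>t s'. t \<le> 80 * (bag_offset bs (length bs) + 1) \<and>
    matrix n (arrs s' ''mem'') (\<lambda>i v. v \<in> set (layer bs i)) \<and>
    ((\<exists>i. 0 \<in> set (layer bs i)) \<longrightarrow> 0 \<in> set (layer bs (regs s' ''c''))) \<and>
    bag_table bs (length bs) s') s"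
  unfolding read_bags_def
  apply (simp add: wp_Seq)
\<comment> \<open>The potential counts the input cells still to be read. Bag \<open>i\<close>
  occupies \<open>Suc (length (bs ! i))\<close> of them, and the constant work per bag is paid by
  its length cell.\<close>
proof (rule wp_While[where g = 0 and \<phi> = "\<lambda>i. 80 * (bag_offset bs (length bs) - bag_offset bs i)" and
    Inv = "\<lambda>i s. i \<le> length bs \<and> regs s ''i'' = i \<and> regs s ''p'' = 3 + 2 * length es + bag_offset bs i \<and>
      matrix n (arrs s ''mem'') (\<lambda>j v. j < Suc i \<and> v \<in> set (layer bs j)) \<and>
      ((\<exists>j < Suc i. 0 \<in> set (layer bs j)) \<longrightarrow> 0 \<in> set (layer bs (regs s ''c''))) \<and>
      bag_table bs i s"], goal_cases init step exit)
  case init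
  show ?case by (simp add: e mem matrix_def bag_offset_def layer_def bag_table_def)
next
  case (step i s')
  note fr = frameD[OF step(3)]
  have [simp]: "wregs read_bag = {''v'', ''c'', ''p''}" "warrs read_bag = {''mem''}"
    by (auto simp: read_bag_def)
  have fr': "arrs s' ''in'' = arrs s ''in''" "arrs s' ''row'' = arrs s ''row''" "regs s' ''d'' = regs s ''d''"
    using fr(2)[of "''in''"] fr(2)[of "''row''"] fr(1)[of "''d''"] by simp_all
  from step(1) have I: "regs s' ''i'' = i" "regs s' ''p'' = 3 + 2 * length es + bag_offset bs i"
      "matrix n (arrs s' ''mem'') (\<lambda>j v. j < Suc i \<and> v \<in> set (layer bs j))"
      "(\<exists>j < Suc i. 0 \<in> set (layer bs j)) \<Longrightarrow> 0 \<in> set (layer bs (regs s' ''c''))"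
      "bag_table bs i s'" by blast+
  have i: "i < length bs" using step(2) I(1) by (simp add: fr' d)
  have lay: "layer bs (Suc i) = bs ! i" using i by (simp add: layer_def)
  have inlen: "arrs s ''in'' (3 + 2 * length es + bag_offset bs i) = length (bs ! i)"
    and "in": "j < length (bs ! i) \<Longrightarrow> arrs s ''in'' (4 + 2 * length es + bag_offset bs i + j) = bs ! i ! j" for j
    using enc i unfolding encoded_def by simp_all
  have off: "bag_offset bs (Suc i) = bag_offset bs i + Suc (length (bs ! i))"
    using i by (rule bag_offset_Suc)
  have off_le: "bag_offset bs (Suc i) \<le> bag_offset bs (length bs)"
    using i by (intro bag_offset_mono) simp
  show ?case
    apply (simp add: wp_Seq I(1,2) fr')
  proof (rule wp_frame, rule wp_read_bag[where t = "Suc i" and n = n and es = es and bs = bs and N = "n + length bs + 2"],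
      goal_cases 1 2 N b n i p "end" mem c post)
    case 1
    then show ?case using enc by (simp add: fr')
  next
    case 2
    then show ?case using rows by (simp add: rows_def fr')
  next
    case (post t s'')
    note fr1 = frameD[OF post(2)]
    have f: "regs s'' ''i'' = Suc i" "arrs s'' ''in'' = arrs s ''in''"
        "arrs s'' ''beg'' = (arrs s' ''beg'')(Suc i := 4 + 2 * length es + bag_offset bs i)"
        "arrs s'' ''end'' = (arrs s' ''end'')(Suc i := 4 + 2 * length es + bag_offset bs i + length (bs ! i))"
      by (simp_all add: fr1 fr' inlen[simplified add.assoc] inlen add.assoc)
    have table: "bag_table bs (Suc i) s''"
      using I(5) "in" unfolding bag_table_def f
      by (auto simp: lay fr' le_Suc_eq)
    have p: "regs s'' ''p'' = 3 + 2 * length es + bag_offset bs (Suc i)"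
      using post(1) off lay by simp
    show ?case
      using post(1) i table p f(1) off off_le lay by (simp, linarith)
  qed (use i n[of _ "Suc i"] I inlen in \<open>simp_all add: lay\<close>)
next
  case (exit t i s')
  note fr = frameD[OF exit(3)]
  have fr': "regs s' ''d'' = regs s ''d''" using fr(1)[of "''d''"] by (simp add: read_bag_def)
  from exit(1) have I: "i \<le> length bs" "regs s' ''i'' = i"
      "matrix n (arrs s' ''mem'') (\<lambda>j v. j < Suc i \<and> v \<in> set (layer bs j))"
      "(\<exists>j < Suc i. 0 \<in> set (layer bs j)) \<Longrightarrow> 0 \<in> set (layer bs (regs s' ''c''))"
      "bag_table bs i s'" by blast+
  have i: "i = length bs" using exit(2) I(1,2) by (simp add: fr' d)
  have "v \<in> set (layer bs j) \<longleftrightarrow> j < Suc i \<and> v \<in> set (layer bs j)" for j v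
    using i by (auto simp: layer_def)
  then show ?case using I exit(4) i by (auto simp: bag_offset_def)
qed

section \<open>Layers\<close>

text \<open>Stated for an arbitrary order \<open>lt\<close>: \<open>(>)\<close> with \<open>L\<close> and \<open>R\<close> exchanged gives the mirror image.\<close>

definition balanced ::
    "(nat \<Rightarrow> nat \<Rightarrow> bool) \<Rightarrow> nat set \<Rightarrow> (nat \<Rightarrow> nat) \<Rightarrow> (nat \<Rightarrow> nat) \<Rightarrow> (nat \<Rightarrow> nat) \<Rightarrow> bool" where
  "balanced lt I F L R \<longleftrightarrow>
     (\<forall>a b. 0 < L a \<longrightarrow> 0 < R b \<longrightarrow> lt a b) \<and>
     (\<forall>a. \<forall>e \<in> I. 0 < L a \<longrightarrow> \<not> lt a e \<longrightarrow> sum L {t \<in> I. lt t e} \<le> F e) \<and>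
     (\<forall>b. \<forall>e \<in> I. 0 < R b \<longrightarrow> \<not> lt e b \<longrightarrow> sum R {t \<in> I. lt e t} \<le> F e) \<and>
     (\<forall>e \<in> I. sum L {t \<in> I. lt t e} \<le> F e \<or> sum R {t \<in> I. lt e t} \<le> F e)"

lemma balanced_swap: "balanced lt I F L R \<longleftrightarrow> balanced (\<lambda>a b. lt b a) I F R L"
  unfolding balanced_def by (intro iffI conjI; elim conjE) (assumption | blast)+

text \<open>Only the pieces at \<open>i\<close> and \<open>p\<close> change, and neither lies to the
  left of an \<open>e\<close> before \<open>i\<close>, so there the \<open>L\<close> clause
  survives. For every other \<open>e\<close> the \<open>R\<close> clause is established instead.
  After the step all \<open>L\<close> pieces lie before \<open>i\<close> and all \<open>R\<close>
  pieces at \<open>i\<close> or beyond, so each clause is demanded only where it has been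
  shown.\<close>

lemma balanced_step:
  assumes bal: "balanced lt I F L R"
    and irrefl: "\<And>a. \<not> lt a a"
    and trans: "\<And>a b c. lt a b \<Longrightarrow> lt b c \<Longrightarrow> lt a c"
    and total: "\<And>a b. a = b \<or> lt a b \<or> lt b a"
    and fin: "finite I" and supp: "\<And>a. 0 < L a \<Longrightarrow> a \<in> I"
    and i: "0 < L i" and maxi: "\<And>a. 0 < L a \<Longrightarrow> a = i \<or> lt a i"
    and heavy: "sum R I \<le> sum L I"
    and p: "lt p i" and pred: "\<And>e. lt e i \<Longrightarrow> e = p \<or> lt e p"
    and F': "\<And>e. F e \<le> F' e" "F' i = F i + L i"
    and L': "L' i = 0" "\<And>e. e \<noteq> i \<Longrightarrow> e \<noteq> p \<Longrightarrow> L' e = L e"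
    and R': "\<And>e. e \<noteq> i \<Longrightarrow> R' e = R e"
  shows "balanced lt I F' L' R'"
proof -
  have asym: "\<not> lt b a" if "lt a b" for a b
    using irrefl trans that by metis
  have N: "lt a b" if "0 < L a" "0 < R b" for a b
    using bal that unfolding balanced_def by (elim conjE) simp
  have II: "sum L {t \<in> I. lt t e} \<le> F e" if "e \<in> I" "\<not> lt i e" for e
    using bal that i unfolding balanced_def by (elim conjE) simp
  have L'pos: "lt a i" if "0 < L' a" for a
    using that L'(1) L'(2)[of a] maxi[of a] p by (cases "a = i"; cases "a = p") auto
  have R'pos: "b = i \<or> lt i b" if "0 < R' b" for b
    using that R'[of b] N[OF i, of b] by (cases "b = i") auto
  have iI: "i \<in> I" using supp i by blast
  have below: "sum L' {t \<in> I. lt t e} \<le> F' e" if e: "e \<in> I" "lt e i" for e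
  proof -
    have "sum L' {t \<in> I. lt t e} = sum L {t \<in> I. lt t e}"
    proof (rule sum.cong)
      fix t assume "t \<in> {t \<in> I. lt t e}"
      then have "t \<noteq> i" "t \<noteq> p"
        using e pred[OF e(2)] irrefl asym by auto
      then show "L' t = L t" using L' by blast
    qed simp
    also have "\<dots> \<le> F e" using II[OF e(1) asym[OF e(2)]] .
    finally show ?thesis using F'(1)[of e] by linarith
  qed
  have above: "sum R' {t \<in> I. lt e t} \<le> F' e" if e: "e \<in> I" "\<not> lt e i" for e
  proof -
    have "sum R' {t \<in> I. lt e t} = sum R {t \<in> I. lt e t}"
    proof (rule sum.cong)
      fix t assume "t \<in> {t \<in> I. lt e t}"
      then have "t \<noteq> i" using e by blast
      then show "R' t = R t" using R' by blast
    qed simp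
    also have le: "\<dots> \<le> sum R I" using fin by (intro sum_mono2) auto
    finally have R: "sum R' {t \<in> I. lt e t} \<le> sum R I" .
    have sumL: "sum L I = sum L {t \<in> I. lt t i} + L i"
    proof -
      have "sum L I = sum L (insert i {t \<in> I. lt t i})"
        using fin iI maxi by (intro sum.mono_neutral_right) auto
      also have "\<dots> = L i + sum L {t \<in> I. lt t i}"
        using fin irrefl by (subst sum.insert) auto
      finally show ?thesis by simp
    qed
    show ?thesis
    proof (cases "e = i")
      case True
      \<comment> \<open>At \<open>i\<close> the increment of \<open>F\<close> is just what is
        missing: the whole \<open>L\<close> weight is at most \<open>F i + L i = F' i\<close>, and
        \<open>R\<close> is the lighter border.\<close>
      then show ?thesis using R heavy sumL II[OF iI] irrefl F'(2) by fastforce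
    next
      case False
      then have lt: "lt i e" using total[of i e] e by auto
      \<comment> \<open>Beyond \<open>i\<close> there is no \<open>L\<close> piece, so the
        \<open>L\<close> alternative of the last clause speaks of the whole \<open>L\<close> weight
        and thereby dominates \<open>R\<close>; the other alternative is the claim itself.\<close>
      have "sum L {t \<in> I. lt t e} = sum L I"
      proof (rule sum.mono_neutral_left)
        have "lt t e" if "0 < L t" for t using maxi[OF that] lt trans[OF _ lt] by auto
        then show "\<forall>t \<in> I - {t \<in> I. lt t e}. L t = 0" by auto
      qed (use fin in auto)
      then have "sum R {t \<in> I. lt e t} \<le> F e"
        using bal e heavy le unfolding balanced_def by fastforce
      then show ?thesis
        using \<open>sum R' {t \<in> I. lt e t} = sum R {t \<in> I. lt e t}\<close> F'(1)[of e] by linarith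
    qed
  qed
  show ?thesis
    unfolding balanced_def
  proof (intro conjI allI ballI impI)
    fix a b assume "0 < L' a" "0 < R' b"
    then show "lt a b" using L'pos[of a] R'pos[of b] trans[of a i b] by auto
  next
    fix a e assume "e \<in> I" "0 < L' a" "\<not> lt a e"
    then have "lt e i" using L'pos[of a] total[of a e] trans[of e a i] by auto
    then show "sum L' {t \<in> I. lt t e} \<le> F' e" using below \<open>e \<in> I\<close> by blast
  next
    fix b e assume "e \<in> I" "0 < R' b" "\<not> lt e b"
    then have "\<not> lt e i" using R'pos[of b] trans[of e i b] by auto
    then show "sum R' {t \<in> I. lt e t} \<le> F' e" using above \<open>e \<in> I\<close> by blast
  next
    fix e assume "e \<in> I"
    then show "sum L' {t \<in> I. lt t e} \<le> F' e \<or> sum R' {t \<in> I. lt e t} \<le> F' e"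
      using below above by blast
  qed
qed

text \<open>The innermost piece turns the second clause, taken at \<open>a = e = i\<close>, into a
  bound for an entire border.\<close>

lemma balanced_sum:
  assumes bal: "balanced lt I F L R"
    and fin: "finite I" and supp: "\<And>a. 0 < L a \<Longrightarrow> a \<in> I"
    and irrefl: "\<And>a. \<not> lt a a"
    and i: "0 < L i" and maxi: "\<And>a. 0 < L a \<Longrightarrow> a = i \<or> lt a i"
  shows "sum L I \<le> F i + L i"
proof -
  have iI: "i \<in> I" using supp i by blast
  have "sum L I = sum L (insert i {t \<in> I. lt t i})"
    using fin iI maxi by (intro sum.mono_neutral_right) auto
  also have "\<dots> = L i + sum L {t \<in> I. lt t i}"
    using fin irrefl by (subst sum.insert) auto
  moreover have "sum L {t \<in> I. lt t i} \<le> F i"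
    using bal i irrefl iI unfolding balanced_def by (elim conjE) simp
  ultimately show ?thesis by simp
qed

text \<open>The second clause taken at \<open>p\<close>, with the piece at \<open>i\<close> as the
  one that does not lie before \<open>p\<close>. The sum is the old part of the heavier border that
  an advance at \<open>i\<close> leaves behind.\<close>

lemma balanced_sum_below:
  assumes bal: "balanced lt I F L R"
    and trans: "\<And>a b c. lt a b \<Longrightarrow> lt b c \<Longrightarrow> lt a c"
    and fin: "finite I" and irrefl: "\<And>a. \<not> lt a a"
    and i: "0 < L i" and p: "lt p i" "p \<in> I" and pred: "\<And>e. lt e i \<Longrightarrow> e = p \<or> lt e p"
  shows "sum L {t \<in> I. lt t i} \<le> F p + L p"
proof -
  have "{t \<in> I. lt t i} = insert p {t \<in> I. lt t p}"
    using p pred trans[OF _ p(1)] by auto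
  then have "sum L {t \<in> I. lt t i} = L p + sum L {t \<in> I. lt t p}"
    using fin irrefl by simp
  moreover have "sum L {t \<in> I. lt t p} \<le> F p"
    using bal i p irrefl trans[of i p i] unfolding balanced_def by (elim conjE) metis
  ultimately show ?thesis by simp
qed

section \<open>Borders of visited sets in a sequence of convex bags\<close>

locale layers =
  fixes d :: nat and X :: "nat \<Rightarrow> nat set" and E :: "nat \<Rightarrow> nat \<Rightarrow> bool" and K :: nat
  assumes fin_X [simp]: "finite (X t)" and card_X: "card (X t) \<le> K"
    and X_empty: "t < 1 \<or> d < t \<Longrightarrow> X t = {}"
    and X_convex: "a \<le> b \<Longrightarrow> b \<le> c \<Longrightarrow> v \<in> X a \<Longrightarrow> v \<in> X c \<Longrightarrow> v \<in> X b"
    and E_sym: "E u v \<Longrightarrow> E v u"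
    and E_X: "E u v \<Longrightarrow> \<exists>t. u \<in> X t \<and> v \<in> X t"
begin

text \<open>The vertices that a move from bag \<open>a\<close> into the adjacent bag
  \<open>b\<close> carries over. Keeping both bags as arguments makes the \<open>L\<close> and the
  \<open>R\<close> pieces mirror images of one notion.\<close>

definition cut :: "(nat \<Rightarrow> nat set) \<Rightarrow> nat \<Rightarrow> nat \<Rightarrow> nat set" where
  "cut V a b = X b \<inter> V a - V b"

abbreviation "Lc V t \<equiv> card (cut V (Suc t) t)"
abbreviation "Rc V t \<equiv> card (cut V t (Suc t))"
abbreviation "Fc V t \<equiv> card (V t \<inter> V (Suc t))"

definition valid :: "(nat \<Rightarrow> nat set) \<Rightarrow> bool" where
  "valid V \<longleftrightarrow> (\<forall>t. V t \<subseteq> X t) \<and> (\<forall>t u v. u \<in> V t \<longrightarrow> v \<in> X t \<longrightarrow> E u v \<longrightarrow> v \<in> V t) \<and>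
     balanced (<) {..d} (Fc V) (Lc V) (Rc V)"

definition border :: "nat set \<Rightarrow> nat set" where
  "border S = {v \<in> S. \<exists>u. E v u \<and> u \<notin> S}"

lemma fin_cut [simp]: "finite (cut V a b)"
  unfolding cut_def by auto

text \<open>An \<open>L\<close> piece at \<open>t\<close> lies in \<open>X t\<close> by definition.
  An \<open>R\<close> piece lies in \<open>X (Suc t)\<close>, and only
  \<open>V t \<subseteq> X t\<close> places it in \<open>X t\<close> as well, whence the premise in
  the second part.\<close>

lemma cut_pos: "0 < Lc V t \<Longrightarrow> t \<in> {1..d}" "valid V \<Longrightarrow> 0 < Rc V t \<Longrightarrow> t \<in> {1..<d}"
proof -
  assume "0 < Lc V t"
  then have "X t \<noteq> {}" unfolding cut_def by auto
  then show "t \<in> {1..d}" using X_empty[of t] by fastforce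
next
  assume "valid V" "0 < Rc V t"
  then have "V t \<subseteq> X t" "cut V t (Suc t) \<noteq> {}" unfolding valid_def by auto
  then have "X t \<noteq> {}" "X (Suc t) \<noteq> {}" unfolding cut_def by auto
  then show "t \<in> {1..<d}" using X_empty[of t] X_empty[of "Suc t"] by fastforce
qed

text \<open>A boundary vertex \<open>v\<close>, visited in \<open>a\<close>, shares some bag
  \<open>b\<close> with an unvisited neighbour. As visited sets are closed inside a bag,
  \<open>v\<close> is not visited in \<open>b\<close>. By convexity \<open>v\<close> lies in all
  bags between \<open>a\<close> and \<open>b\<close>, so somewhere between them it passes from
  visited to unvisited, and there it belongs to a piece.\<close>

lemma border_cut:
  assumes "valid V"
  shows "border (\<Union>t. V t) \<subseteq> (\<Union>t\<le>d. cut V (Suc t) t \<union> cut V t (Suc t))"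
proof
  fix v assume "v \<in> border (\<Union>t. V t)"
  then obtain a u where a: "v \<in> V a" and u: "E v u" "\<And>t. u \<notin> V t"
    unfolding border_def by auto
  obtain b where b: "v \<in> X b" "u \<in> X b" using E_X[OF u(1)] by blast
  have VX: "V t \<subseteq> X t" for t using assms unfolding valid_def by blast
  have nb: "v \<notin> V b" using assms u b unfolding valid_def by blast
  have in_X: "v \<in> X t" if "min a b \<le> t" "t \<le> max a b" for t
    using that X_convex[of a t b v] X_convex[of b t a v] a b VX
    by (cases "a \<le> b") (auto simp: min_def max_def)
  have bd: "t \<le> d" if "v \<in> X t" for t using X_empty[of t] that by fastforce
  show "v \<in> (\<Union>t\<le>d. cut V (Suc t) t \<union> cut V t (Suc t))"
  proof (cases "a \<le> b")
    case True
    then have "\<exists>t. a \<le> t \<and> t < b \<and> v \<in> V t \<and> v \<notin> V (Suc t)"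
      using a nb
    proof (induction rule: dec_induct)
      case base
      then show ?case by blast
    next
      case (step m)
      then show ?case
        by (metis lessI less_SucI)
    qed
    then obtain t where "a \<le> t" "t < b" "v \<in> V t" "v \<notin> V (Suc t)" by blast
    then show ?thesis
      using in_X[of "Suc t"] VX[of t] bd[of t] unfolding cut_def by fastforce
  next
    case False
    then have "b \<le> a" by simp
    then have "\<exists>t. b \<le> t \<and> t < a \<and> v \<in> V (Suc t) \<and> v \<notin> V t"
      using a nb
    proof (induction rule: dec_induct)
      case base
      then show ?case by blast
    next
      case (step m)
      then show ?case
        by (metis lessI less_SucI)
    qed
    then obtain t where "b \<le> t" "t < a" "v \<in> V (Suc t)" "v \<notin> V t" by blast
    then show ?thesis
      using in_X[of t] bd[of t] unfolding cut_def by fastforce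
  qed
qed

lemma card_split: "finite S \<Longrightarrow> card (S \<inter> T) + card (S - T) = card S"
  by (metis Int_Diff_disjoint Un_Diff_Int card_Un_disjoint finite_Diff finite_Int inf_commute sup_commute)

text \<open>Stated with sums instead of differences to avoid truncated subtraction; \<open>b\<close>
  will be either neighbour of \<open>t\<close>.\<close>

lemma card_update:
  assumes A: "A \<subseteq> X t - V t" and VX: "\<And>t. V t \<subseteq> X t" and b: "b \<noteq> t"
    and V': "V' = V(t := V t \<union> A)"
  shows "card (cut V' t b) = card (cut V t b) + card (A \<inter> X b - V b)"
    and "card (cut V b t) = card (cut V' b t) + card (A \<inter> V b)"
    and "card (V' t \<inter> V' b) = card (V t \<inter> V b) + card (A \<inter> V b)"
proof -
  have [simp]: "finite A" "finite (V t)" "finite (V b)" for t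
    using A VX by (meson fin_X finite_Diff finite_subset)+
  have "cut V' t b = cut V t b \<union> (A \<inter> X b - V b)" "cut V t b \<inter> (A \<inter> X b - V b) = {}"
    using A b unfolding cut_def V' by auto
  then show "card (cut V' t b) = card (cut V t b) + card (A \<inter> X b - V b)"
    by (simp add: card_Un_disjoint)
  have "cut V b t = cut V' b t \<union> (A \<inter> V b)" "cut V' b t \<inter> (A \<inter> V b) = {}"
    using A b unfolding cut_def V' by auto
  then show "card (cut V b t) = card (cut V' b t) + card (A \<inter> V b)"
    by (simp add: card_Un_disjoint)
  have "V' t \<inter> V' b = (V t \<inter> V b) \<union> (A \<inter> V b)" "(V t \<inter> V b) \<inter> (A \<inter> V b) = {}"
    using A b unfolding V' by auto
  then show "card (V' t \<inter> V' b) = card (V t \<inter> V b) + card (A \<inter> V b)"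
    by (simp add: card_Un_disjoint)
qed

text \<open>\<open>dir\<close> treats both directions at once. Gap \<open>e\<close> lies between the
  bags \<open>e\<close> and \<open>Suc e\<close>: the search enters \<open>t\<close> from
  \<open>s\<close> through gap \<open>i\<close>, and \<open>w\<close> is the bag on the far side of
  \<open>t\<close>, behind gap \<open>p\<close>. The two halves of \<open>2 * K\<close> are
  independent: the lighter border is at most the heavier one, which fits into
  \<open>X t \<inter> V s\<close>; the pieces of the heavier border other than the one at
  \<open>i\<close> are charged to \<open>V t\<close>, which together with the disjoint set
  \<open>A\<close> fits into \<open>X t\<close>.\<close>

lemma advance:
  assumes val: "valid V"
    and dir: "lt = (<) \<and> P = Lc \<and> Q = Rc \<and> s = Suc t \<and> i = t \<and> t = Suc p \<and> w = p \<or>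
      lt = (>) \<and> P = Rc \<and> Q = Lc \<and> w = Suc t \<and> p = t \<and> t = Suc i \<and> s = i"
    and heavy: "sum (Q V) {..d} \<le> sum (P V) {..d}"
    and i: "0 < P V i" and maxi: "\<And>a. 0 < P V a \<Longrightarrow> a = i \<or> lt a i"
    and A: "A \<subseteq> X t - V t" and D: "cut V s t \<subseteq> A"
    and closed: "\<forall>u \<in> A. \<forall>v \<in> X t. E u v \<longrightarrow> v \<in> V t \<union> A"
    and V': "V' = V(t := V t \<union> A)"
  shows "valid V'"
    and "sum (P V') {..d} + card (cut V s t) = sum (P V) {..d} + card (A \<inter> X w - V w)"
    and "sum (Q V') {..d} = sum (Q V) {..d} + card (A \<inter> X s - V s)"
    and "card (border (\<Union>t. V t) - A) + card A \<le> 2 * K"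
    and "P V' = (P V)(i := 0, p := P V p + card (A \<inter> X w - V w))"
    and "Q V' = (Q V)(i := Q V i + card (A \<inter> X s - V s))"
proof -
  have VX: "V t \<subseteq> X t" for t using val unfolding valid_def by blast
  have [simp]: "finite A" "finite (V t)" for t
    using A VX by (meson fin_X finite_Diff finite_subset)+
  have "balanced (<) {..d} (Fc V) (Lc V) (Rc V)" using val unfolding valid_def by blast
  then have bal: "balanced lt {..d} (Fc V) (P V) (Q V)"
    using dir by (elim disjE conjE) (auto simp: balanced_swap[of "(<)"])
  have irrefl: "\<not> lt a a" and trans: "lt a b \<Longrightarrow> lt b c \<Longrightarrow> lt a c" and total: "a = b \<or> lt a b \<or> lt b a"
    for a b c using dir by auto
  have supp: "a \<in> {..d}" if "0 < P V a" for a
    using that dir cut_pos(1)[of V a] cut_pos(2)[OF val, of a] by auto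
  have lt: "lt p i" and pred: "lt e i \<Longrightarrow> e = p \<or> lt e p" for e using dir by auto
  have P: "P V i = card (cut V s t)" "P V p = card (cut V t w)"
      "Q V i = card (cut V t s)" "Q V p = card (cut V w t)"
      "Fc V i = card (V t \<inter> V s)" "Fc V p = card (V t \<inter> V w)" for V
    using dir by (auto simp: Int_commute)
  have ne: "s \<noteq> t" "w \<noteq> t" "p \<noteq> i" using dir by auto
  have other: "P V' e = P V e" "Q V' e = Q V e" "Fc V' e = Fc V e" if "e \<noteq> i" "e \<noteq> p" for e
    using that dir unfolding V' cut_def by auto
  have pd: "p \<in> {..d}" and id: "i \<in> {..d}"
  proof -
    show "i \<in> {..d}" using supp i by blast
    show "p \<in> {..d}" using dir i cut_pos(1)[of V i] cut_pos(2)[OF val, of i] by auto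
  qed
  \<comment> \<open>Pieces of the two borders never interleave, so an opposite piece at
    \<open>p\<close> would have to lie beyond \<open>i\<close>. Hence no vertex of \<open>A\<close>
    is already visited in \<open>w\<close>, and \<open>F p\<close> and \<open>Q p\<close> keep their
    values.\<close>
  have Qp: "Q V p = 0"
  proof (rule ccontr)
    assume "Q V p \<noteq> 0"
    then have "lt i p" using bal i unfolding balanced_def by blast
    then show False using lt trans irrefl by blast
  qed
  then have Aw: "A \<inter> V w = {}"
    using A unfolding P(4) by (auto simp: cut_def)
  have As: "A \<inter> V s = cut V s t"
    using A D unfolding cut_def by auto
  note upd = card_update[OF A VX _ V']
  have P': "P V' i = 0" "P V' p = P V p + card (A \<inter> X w - V w)"
    "Q V' i = Q V i + card (A \<inter> X s - V s)" "Q V' p = Q V p"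
    "Fc V' i = Fc V i + P V i" "Fc V' p = Fc V p"
    using upd[OF ne(1)] upd[OF ne(2)] unfolding P Aw As by simp_all
  show "P V' = (P V)(i := 0, p := P V p + card (A \<inter> X w - V w))"
    using P'(1,2) other(1) ne(3) by (intro ext) (metis fun_upd_apply)
  show "Q V' = (Q V)(i := Q V i + card (A \<inter> X s - V s))"
    using P'(3,4) other(2) by (intro ext) (metis fun_upd_apply)
  have "balanced lt {..d} (Fc V') (P V') (Q V')"
  proof (rule balanced_step[where F = "Fc V" and L = "P V" and R = "Q V" and i = i and p = p])
    show "Fc V e \<le> Fc V' e" for e
      using other(3)[of e] P'(5,6) by (cases "e = i"; cases "e = p") auto
    show "Q V' e = Q V e" if "e \<noteq> i" for e
      using other(2)[of e] P'(4) that by (cases "e = p") auto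
    show "finite {..d}" by simp
  qed (fact bal irrefl total supp i maxi heavy lt pred P'(5) P'(1) | erule (1) trans | erule (1) other)+
  then have "balanced (<) {..d} (Fc V') (Lc V') (Rc V')"
    using dir by (elim disjE conjE) (auto simp: balanced_swap[of "(<)"])
  moreover have "V' a \<subseteq> X a" for a using VX A unfolding V' by auto
  moreover have "v \<in> V' a" if "u \<in> V' a" "v \<in> X a" "E u v" for u v a
    using that closed val unfolding V' valid_def by (cases "a = t") auto
  ultimately show "valid V'" unfolding valid_def by blast
  have sum_rest: "sum f {..d} = f i + f p + sum f ({..d} - {i, p})" for f :: "nat \<Rightarrow> nat"
  proof -
    have "sum f {..d} = f i + sum f ({..d} - {i})"
      using id by (intro sum.remove) auto
    also have "sum f ({..d} - {i}) = f p + sum f ({..d} - {i} - {p})"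
      using pd ne by (intro sum.remove) auto
    also have "{..d} - {i} - {p} = {..d} - {i, p}" by auto
    finally show ?thesis by simp
  qed
  have rest: "sum (P V') ({..d} - {i, p}) = sum (P V) ({..d} - {i, p})"
    "sum (Q V') ({..d} - {i, p}) = sum (Q V) ({..d} - {i, p})"
    using other by (auto intro!: sum.cong)
  show "sum (P V') {..d} + card (cut V s t) = sum (P V) {..d} + card (A \<inter> X w - V w)"
    using P' rest P(1)[of V] unfolding sum_rest[of "P V"] sum_rest[of "P V'"] by linarith
  show "sum (Q V') {..d} = sum (Q V) {..d} + card (A \<inter> X s - V s)"
    using P' rest unfolding sum_rest[of "Q V"] sum_rest[of "Q V'"] by linarith
  \<comment> \<open>\<open>dir\<close> fixes \<open>P\<close> and \<open>Q\<close> only as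
    cardinalities; the underlying sets are recovered by testing which order \<open>lt\<close>
    is.\<close>
  let ?p = "\<lambda>a. if lt = (<) then cut V (Suc a) a else cut V a (Suc a)"
  let ?q = "\<lambda>a. if lt = (<) then cut V a (Suc a) else cut V (Suc a) a"
  have lne: "(>) \<noteq> ((<) :: nat \<Rightarrow> nat \<Rightarrow> bool)"
    by (metis less_irrefl lessI less_trans)
  have pq: "card (?p a) = P V a" "card (?q a) = Q V a" for a using dir lne by auto
  have pi: "?p i = cut V s t" using dir lne by auto
  \<comment> \<open>The piece at \<open>i\<close> is contained in \<open>A\<close>, so of the
    heavier border only the gaps before \<open>i\<close> contribute.\<close>
  have "border (\<Union>t. V t) - A \<subseteq> (\<Union>a \<in> {a \<in> {..d}. lt a i}. ?p a) \<union> (\<Union>a \<in> {..d}. ?q a)"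
  proof
    fix v assume v: "v \<in> border (\<Union>t. V t) - A"
    then obtain a where a: "a \<le> d" "v \<in> ?p a \<or> v \<in> ?q a"
      using border_cut[OF val] by (cases "lt = (<)") auto
    have "lt a i" if "v \<in> ?p a"
    proof -
      have "0 < card (?p a)" using that by (auto simp: card_gt_0_iff)
      then have "a = i \<or> lt a i" using maxi pq by simp
      moreover have "a \<noteq> i" using that v D pi by auto
      ultimately show ?thesis by blast
    qed
    then show "v \<in> (\<Union>a \<in> {a \<in> {..d}. lt a i}. ?p a) \<union> (\<Union>a \<in> {..d}. ?q a)"
      using a by auto
  qed
  then have "card (border (\<Union>t. V t) - A) \<le>
      card ((\<Union>a \<in> {a \<in> {..d}. lt a i}. ?p a) \<union> (\<Union>a \<in> {..d}. ?q a))"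
    by (intro card_mono) auto
  also have "\<dots> \<le> card (\<Union>a \<in> {a \<in> {..d}. lt a i}. ?p a) + card (\<Union>a \<in> {..d}. ?q a)"
    by (rule card_Un_le)
  also have "\<dots> \<le> sum (P V) {a \<in> {..d}. lt a i} + sum (Q V) {..d}"
    using card_UN_le[of "{a \<in> {..d}. lt a i}" ?p] card_UN_le[of "{..d}" ?q] unfolding pq by simp
  also have "sum (Q V) {..d} \<le> K"
  proof -
    have "sum (P V) {..d} \<le> Fc V i + P V i"
      by (rule balanced_sum[OF bal _ supp irrefl i maxi]) auto
    also have "\<dots> = card ((X t \<inter> V s) \<inter> V t) + card ((X t \<inter> V s) - V t)"
    proof -
      have "V t \<inter> V s = (X t \<inter> V s) \<inter> V t" using VX[of t] by auto
      then show ?thesis by (simp only: P cut_def)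
    qed
    also have "\<dots> = card (X t \<inter> V s)" by (rule card_split) simp
    also have "\<dots> \<le> card (X t)" by (intro card_mono) auto
    finally show ?thesis using heavy card_X[of t] by linarith
  qed
  also have "sum (P V) {a \<in> {..d}. lt a i} \<le> card (V t)"
  proof -
    have "sum (P V) {a \<in> {..d}. lt a i} \<le> Fc V p + P V p"
      by (rule balanced_sum_below[OF bal trans _ irrefl i lt pd pred]) auto
    also have "\<dots> = card ((X w \<inter> V t) \<inter> V w) + card ((X w \<inter> V t) - V w)"
    proof -
      have "V t \<inter> V w = (X w \<inter> V t) \<inter> V w" using VX[of w] by auto
      then show ?thesis by (simp only: P cut_def)
    qed
    also have "\<dots> = card (X w \<inter> V t)" by (rule card_split) simp
    also have "\<dots> \<le> card (V t)" by (intro card_mono) auto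
    finally show ?thesis .
  qed
  finally have "card (border (\<Union>t. V t) - A) + card A \<le> card (V t) + card A + K" by simp
  also have "card (V t) + card A = card (V t \<union> A)"
    using A by (subst card_Un_disjoint) auto
  also have "\<dots> \<le> card (X t)" using A VX by (intro card_mono) auto
  finally show "card (border (\<Union>t. V t) - A) + card A \<le> 2 * K"
    using card_X[of t] by linarith
qed

text \<open>With a single nonempty visited set the only possible pieces are an \<open>L\<close>
  piece at \<open>p\<close> and an \<open>R\<close> piece at \<open>t\<close>. The clauses hold
  because the sums in them vanish: the \<open>L\<close> sum for \<open>e \<le> p\<close>, the
  \<open>R\<close> sum for \<open>e \<ge> t\<close>.\<close>

lemma valid_start:
  assumes A: "A \<subseteq> X t" and closed: "\<forall>u \<in> A. \<forall>v \<in> X t. E u v \<longrightarrow> v \<in> A"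
    and t: "t = Suc p" "t \<le> d" and V: "V = (\<lambda>_. {})(t := A)"
  shows "valid V" "sum (Lc V) {..d} = card (A \<inter> X p)" "sum (Rc V) {..d} = card (A \<inter> X (Suc t))"
    and "Lc V = (\<lambda>_. 0)(p := card (A \<inter> X p))" "Rc V = (\<lambda>_. 0)(t := card (A \<inter> X (Suc t)))"
proof -
  have L: "Lc V a = (if a = p then card (A \<inter> X p) else 0)" and R: "Rc V a = (if a = t then card (A \<inter> X (Suc t)) else 0)" for a
    using t unfolding V cut_def by (auto simp: Int_commute)
  show "Lc V = (\<lambda>_. 0)(p := card (A \<inter> X p))" "Rc V = (\<lambda>_. 0)(t := card (A \<inter> X (Suc t)))"
    using L R by auto
  show "sum (Lc V) {..d} = card (A \<inter> X p)" "sum (Rc V) {..d} = card (A \<inter> X (Suc t))"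
    unfolding L R using t by auto
  have "balanced (<) {..d} (Fc V) (Lc V) (Rc V)"
  proof -
    have 1: "sum (Lc V) {a \<in> {..d}. a < e} = 0" if "e \<le> p" for e
      unfolding L using that by auto
    have 2: "sum (Rc V) {a \<in> {..d}. e < a} = 0" if "t \<le> e" for e
      unfolding R using that by auto
    have 3: "a = p" if "0 < Lc V a" for a using that unfolding L by (auto split: if_splits)
    have 4: "a = t" if "0 < Rc V a" for a using that unfolding R by (auto split: if_splits)
    show ?thesis
      unfolding balanced_def
    proof (intro conjI allI ballI impI)
      fix a b assume "0 < Lc V a" "0 < Rc V b"
      then show "a < b" using 3[of a] 4[of b] t by linarith
    next
      fix a e assume "0 < Lc V a" "\<not> a < e"
      then show "sum (Lc V) {a \<in> {..d}. a < e} \<le> Fc V e" using 3[of a] 1[of e] by linarith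
    next
      fix b e assume "0 < Rc V b" "\<not> e < b"
      then show "sum (Rc V) {a \<in> {..d}. e < a} \<le> Fc V e" using 4[of b] 2[of e] by linarith
    next
      fix e
      show "sum (Lc V) {a \<in> {..d}. a < e} \<le> Fc V e \<or> sum (Rc V) {a \<in> {..d}. e < a} \<le> Fc V e"
        using 1[of e] 2[of e] t by linarith
    qed
  qed
  then show "valid V" using A closed unfolding valid_def V by auto
qed

text \<open>Lets the two weight registers serve as the termination test of the search.\<close>

lemma border_empty:
  assumes val: "valid V" and "sum (Lc V) {..d} + sum (Rc V) {..d} = 0"
  shows "border (\<Union>t. V t) = {}"
proof -
  have "cut V (Suc t) t \<union> cut V t (Suc t) = {}" if "t \<le> d" for t
    using assms(2) that by auto
  then show ?thesis using border_cut[OF val] by auto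
qed

end

section \<open>Visiting a bag\<close>

text \<open>
  \<open>L\<close> and \<open>R\<close> hold the weights of the borders, \<open>ls\<close> and \<open>rs\<close> are the stacks of their pieces with heights
  \<open>lp\<close> and \<open>rp\<close>. The bottom elements \<open>0\<close> and \<open>d + 1\<close> of the stacks are sentinels. \<open>q\<close> is the queue with
  head \<open>h\<close> and end \<open>g\<close>, and \<open>w\<close> is the length of the order \<open>ord\<close> of first visits.
\<close>

definition scan :: com where
  "scan =
     ''p'' ::= Read ''beg'' (Reg ''t'') ;;
     While (Less (Reg ''p'') (Read ''end'' (Reg ''t'')))
       (''v'' ::= Read ''in'' (Reg ''p'') ;;
        If (And (Less (cell ''vis'' (Reg ''t'') (Reg ''v'')) (Const 1))
            (Less (Const 0) (cell ''adj'' (Reg ''u'') (Reg ''v''))))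
          (mark ''vis'' (Reg ''t'') (Reg ''v'') ;;
           Write ''q'' (Reg ''g'') (Reg ''v'') ;;
           incr ''g'' ;;
           If (Less (Read ''seen'' (Reg ''v'')) (Const 1))
             (Write ''seen'' (Reg ''v'') (Const 1) ;;
              Write ''ord'' (Reg ''w'') (Reg ''v'') ;;
              Write ''pos'' (Reg ''v'') (Reg ''w'') ;;
              incr ''w'')
             Skip)
          Skip ;;
        incr ''p'')"

definition bfs :: com where
  "bfs =
     While (Less (Reg ''h'') (Reg ''g''))
       (''u'' ::= Read ''q'' (Reg ''h'') ;;
        incr ''h'' ;;
        scan)"

text \<open>New vertices that occur unvisited in a neighbouring bag enlarge the pieces at
  \<open>t - 1\<close> and \<open>t\<close>. Only the queue is inspected, so the cost is charged to
  vertices just marked.\<close>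

definition count :: com where
  "count =
     ''h'' ::= Const 0 ;;
     ''x'' ::= Const 0 ;;
     ''y'' ::= Const 0 ;;
     While (Less (Reg ''h'') (Reg ''g''))
       (''u'' ::= Read ''q'' (Reg ''h'') ;;
        If (And (Less (Const 0) (cell ''mem'' (Sub (Reg ''t'') (Const 1)) (Reg ''u'')))
            (Less (cell ''vis'' (Sub (Reg ''t'') (Const 1)) (Reg ''u'')) (Const 1)))
          (incr ''x'') Skip ;;
        If (And (Less (Const 0) (cell ''mem'' (Add (Reg ''t'') (Const 1)) (Reg ''u'')))
            (Less (cell ''vis'' (Add (Reg ''t'') (Const 1)) (Reg ''u'')) (Const 1)))
          (incr ''y'') Skip ;;
        incr ''h'')"

text \<open>The strict comparison with the top of a stack prevents a second entry for a piece that
  is already there; by the order of the pieces it could only be on top.\<close>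

definition update :: com where
  "update =
     ''L'' ::= Add (Reg ''L'') (Reg ''x'') ;;
     ''R'' ::= Add (Reg ''R'') (Reg ''y'') ;;
     If (And (Less (Const 0) (Reg ''x''))
         (Less (Read ''ls'' (Sub (Reg ''lp'') (Const 1))) (Sub (Reg ''t'') (Const 1))))
       (Write ''ls'' (Reg ''lp'') (Sub (Reg ''t'') (Const 1)) ;; incr ''lp'') Skip ;;
     If (And (Less (Const 0) (Reg ''y''))
         (Less (Reg ''t'') (Read ''rs'' (Sub (Reg ''rp'') (Const 1)))))
       (Write ''rs'' (Reg ''rp'') (Reg ''t'') ;; incr ''rp'') Skip"

definition visit :: com where
  "visit = bfs ;; count ;; update"

text \<open>
  The bags are numbered from \<open>1\<close>, with empty bags \<open>0\<close> and \<open>d + 1\<close> at the ends; \<open>K\<close> is \<open>k + 1\<close>.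
\<close>

locale decomposed =
  fixes n K :: nat and es :: "(nat \<times> nat) list" and bs :: "nat list list"
  assumes distinct_layer: "distinct (layer bs t)"
    and layer_less: "v \<in> set (layer bs t) \<Longrightarrow> v < n"
    and length_layer: "length (layer bs t) \<le> K"
    and layer_convex: "a \<le> b \<Longrightarrow> b \<le> c \<Longrightarrow> v \<in> set (layer bs a) \<Longrightarrow> v \<in> set (layer bs c) \<Longrightarrow>
      v \<in> set (layer bs b)"
    and layer_edge: "adjacent es u v \<Longrightarrow> \<exists>t. u \<in> set (layer bs t) \<and> v \<in> set (layer bs t)"
    and layer_cover: "v < n \<Longrightarrow> \<exists>t. v \<in> set (layer bs t)"
    and n_pos: "0 < n"
    and connected: "S \<subseteq> {..<n} \<Longrightarrow> S \<noteq> {} \<Longrightarrow> (\<And>u v. u \<in> S \<Longrightarrow> adjacent es u v \<Longrightarrow> v \<in> S) \<Longrightarrow>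
      S = {..<n}"
begin

abbreviation "d \<equiv> length bs"
abbreviation "X t \<equiv> set (layer bs t)"
abbreviation "E \<equiv> adjacent es"

sublocale layers d X E K
proof
  show "card (X t) \<le> K" for t using card_length[of "layer bs t"] length_layer[of t] by linarith
  show "E v u" if "E u v" for u v using that unfolding adjacent_def by blast
  show "X t = {}" if "t < 1 \<or> d < t" for t using that by (auto simp: layer_def)
qed (fact List.finite_set layer_convex layer_edge)+

lemma E_less: "E u v \<Longrightarrow> u < n \<and> v < n"
  using layer_edge layer_less by blast

text \<open>The part of the memory that stays constant once the input has been read.\<close>

definition env :: "state \<Rightarrow> bool" where
  "env s \<longleftrightarrow> rows (n + d + 2) n s \<and> matrix n (arrs s ''adj'') E \<and>
     matrix n (arrs s ''mem'') (\<lambda>t v. v \<in> X t) \<and> bag_table bs d s"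

lemma env_cong:
  "(\<And>a. a \<in> {''row'', ''adj'', ''mem'', ''beg'', ''end'', ''in''} \<Longrightarrow> arrs s' a = arrs s a) \<Longrightarrow>
    env s' \<longleftrightarrow> env s"
  unfolding env_def rows_def bag_table_def by simp

definition core :: "state \<Rightarrow> (nat \<Rightarrow> nat set) \<Rightarrow> nat list \<Rightarrow> bool" where
  "core s V ord \<longleftrightarrow> matrix n (arrs s ''vis'') (\<lambda>t v. v \<in> V t) \<and> holds s ''w'' ''ord'' ord \<and>
     (\<forall>v < n. arrs s ''seen'' v = (if v \<in> set ord then 1 else 0)) \<and>
     (\<forall>i < length ord. arrs s ''pos'' (ord ! i) = i) \<and> distinct ord \<and> set ord \<subseteq> {..<n}"

lemma core_cong:
  "regs s' ''w'' = regs s ''w'' \<Longrightarrow>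
    (\<And>a. a \<in> {''vis'', ''ord'', ''seen'', ''pos''} \<Longrightarrow> arrs s' a = arrs s a) \<Longrightarrow>
    core s' V ord \<longleftrightarrow> core s V ord"
  unfolding core_def holds_def by simp

definition linked :: "nat list \<Rightarrow> bool" where
  "linked ord \<longleftrightarrow> (\<forall>i < length ord. 0 < i \<longrightarrow> (\<exists>j < i. E (ord ! j) (ord ! i)))"

lemma linked_snoc:
  assumes "linked ord" "u \<in> set ord" "E u v"
  shows "linked (ord @ [v])"
  unfolding linked_def
proof (intro allI impI)
  fix i assume i: "i < length (ord @ [v])" "0 < i"
  obtain k where k: "k < length ord" "ord ! k = u" using assms(2) unfolding in_set_conv_nth by blast
  show "\<exists>j < i. E ((ord @ [v]) ! j) ((ord @ [v]) ! i)"
  proof (cases "i < length ord")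
    case True
    then obtain j where "j < i" "E (ord ! j) (ord ! i)" using assms(1) i unfolding linked_def by blast
    then show ?thesis using True by (intro exI[of _ j]) (simp add: nth_append)
  next
    case False
    then have "i = length ord" using i by simp
    then show ?thesis using k assms(3) by (intro exI[of _ k]) (simp add: nth_append)
  qed
qed

text \<open>\<open>V\<close> stays the state before bag \<open>t\<close> is entered;
  \<open>q\<close> lists what has been marked in \<open>t\<close> since, including the seeds
  \<open>D\<close>, and \<open>nw\<close> is the part of \<open>q\<close> that is not in
  \<open>ord\<close>.\<close>

definition bfs_inv where
  "bfs_inv V t D ord s q nw \<longleftrightarrow> core s (V(t := V t \<union> set q)) (ord @ nw) \<and> holds s ''g'' ''q'' q \<and>
     distinct q \<and> set D \<subseteq> set q \<and> set q \<subseteq> X t - V t \<and> set ord \<union> set nw = set ord \<union> set q \<and>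
     linked (ord @ nw)"

lemma bfs_inv_cong:
  "regs s' ''w'' = regs s ''w'' \<Longrightarrow> regs s' ''g'' = regs s ''g'' \<Longrightarrow>
    (\<And>a. a \<in> {''vis'', ''ord'', ''seen'', ''pos'', ''q''} \<Longrightarrow> arrs s' a = arrs s a) \<Longrightarrow>
    bfs_inv V t D ord s' q nw \<longleftrightarrow> bfs_inv V t D ord s q nw"
  unfolding bfs_inv_def core_def holds_def by simp

lemma bfs_inv_old:
  assumes inv: "bfs_inv V t D ord s q nw" and v: "v \<in> X t" "v \<notin> V t \<union> set q" "v \<in> set ord \<union> set nw"
    and s': "regs s' ''w'' = regs s ''w''" "regs s' ''g'' = Suc (regs s ''g'')"
      "arrs s' ''vis'' = (arrs s ''vis'')(t * n + v := Suc 0)"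
      "arrs s' ''q'' = (arrs s ''q'')(regs s ''g'' := v)"
      "arrs s' ''ord'' = arrs s ''ord''" "arrs s' ''seen'' = arrs s ''seen''" "arrs s' ''pos'' = arrs s ''pos''"
  shows "bfs_inv V t D ord s' (q @ [v]) nw"
proof -
  have core: "core s (V(t := V t \<union> set q)) (ord @ nw)" and hold: "holds s ''g'' ''q'' q"
    and q: "distinct q" "set D \<subseteq> set q" "set q \<subseteq> X t - V t" "set ord \<union> set nw = set ord \<union> set q"
      "linked (ord @ nw)"
    using inv unfolding bfs_inv_def by blast+
  have "matrix n (arrs s' ''vis'') (\<lambda>j w. w \<in> (V(t := V t \<union> set (q @ [v]))) j)"
    unfolding s'(3)
    by (rule matrix_mark[where f = "\<lambda>j w. w \<in> (V(t := V t \<union> set q)) j"])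
      (use core layer_less[OF v(1)] in \<open>auto simp: core_def\<close>)
  moreover have "holds s' ''w'' ''ord'' (ord @ nw)"
    using core s' holds_cong[of s' "''w''" s "''ord''"] unfolding core_def by simp
  ultimately have "core s' (V(t := V t \<union> set (q @ [v]))) (ord @ nw)"
    using core s' unfolding core_def by (elim conjE) (intro conjI; simp)
  moreover have "holds s' ''g'' ''q'' (q @ [v])" using hold s' by (intro holds_push) auto
  moreover have "set ord \<union> set nw = set ord \<union> set (q @ [v])" using q(4) v(3) by auto
  ultimately show ?thesis using q v unfolding bfs_inv_def by auto
qed

text \<open>\<open>u\<close> is the queue element being scanned; its presence in the order supplies
  the earlier neighbour that \<open>linked\<close> demands of \<open>v\<close>.\<close>

lemma bfs_inv_new:
  assumes inv: "bfs_inv V t D ord s q nw" and v: "v \<in> X t" "v \<notin> V t \<union> set q" "v \<notin> set ord \<union> set nw"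
    and u: "u \<in> set ord \<union> set nw" "E u v"
    and s': "regs s' ''w'' = Suc (regs s ''w'')" "regs s' ''g'' = Suc (regs s ''g'')"
      "arrs s' ''vis'' = (arrs s ''vis'')(t * n + v := Suc 0)"
      "arrs s' ''q'' = (arrs s ''q'')(regs s ''g'' := v)"
      "arrs s' ''ord'' = (arrs s ''ord'')(regs s ''w'' := v)" "arrs s' ''seen'' = (arrs s ''seen'')(v := Suc 0)"
      "arrs s' ''pos'' = (arrs s ''pos'')(v := regs s ''w'')"
  shows "bfs_inv V t D ord s' (q @ [v]) (nw @ [v])"
proof -
  have core: "core s (V(t := V t \<union> set q)) (ord @ nw)" and hold: "holds s ''g'' ''q'' q"
    and q: "distinct q" "set D \<subseteq> set q" "set q \<subseteq> X t - V t" "set ord \<union> set nw = set ord \<union> set q"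
      "linked (ord @ nw)"
    using inv unfolding bfs_inv_def by blast+
  have vn: "v < n" using layer_less[OF v(1)] .
  have "matrix n (arrs s' ''vis'') (\<lambda>j w. w \<in> (V(t := V t \<union> set (q @ [v]))) j)"
    unfolding s'(3)
    by (rule matrix_mark[where f = "\<lambda>j w. w \<in> (V(t := V t \<union> set q)) j"])
      (use core vn in \<open>auto simp: core_def\<close>)
  moreover have "holds s' ''w'' ''ord'' ((ord @ nw) @ [v])"
    using core s' by (intro holds_push) (auto simp: core_def)
  moreover have "\<forall>x < n. arrs s' ''seen'' x = (if x \<in> set ((ord @ nw) @ [v]) then 1 else 0)"
    using core unfolding core_def s' by auto
  moreover have "\<forall>i < length ((ord @ nw) @ [v]). arrs s' ''pos'' (((ord @ nw) @ [v]) ! i) = i"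
  proof (intro allI impI)
    fix i assume i: "i < length ((ord @ nw) @ [v])"
    have w: "regs s ''w'' = length (ord @ nw)" using core unfolding core_def holds_def by blast
    show "arrs s' ''pos'' (((ord @ nw) @ [v]) ! i) = i"
    proof (cases "i < length (ord @ nw)")
      case True
      then have "(ord @ nw) ! i \<noteq> v" using v(3) nth_mem[OF True] by auto
      moreover have "arrs s ''pos'' ((ord @ nw) ! i) = i" using core True unfolding core_def by blast
      ultimately show ?thesis by (simp only: nth_append_left[OF True] s'(7) fun_upd_other not_False_eq_True)
    next
      case False
      then have "i = length (ord @ nw)" using i by simp
      then show ?thesis unfolding s'(7) w by simp
    qed
  qed
  moreover have "distinct ((ord @ nw) @ [v])" "set ((ord @ nw) @ [v]) \<subseteq> {..<n}"
    using core v vn unfolding core_def by auto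
  ultimately have "core s' (V(t := V t \<union> set (q @ [v]))) (ord @ nw @ [v])"
    unfolding core_def append_assoc by blast
  moreover have "holds s' ''g'' ''q'' (q @ [v])" using hold s' by (intro holds_push) auto
  moreover have "set ord \<union> set (nw @ [v]) = set ord \<union> set (q @ [v])" using q(4) by auto
  moreover have "linked (ord @ nw @ [v])"
    using linked_snoc[OF q(5) _ u(2)] u(1) by simp
  ultimately show ?thesis using q v unfolding bfs_inv_def by auto
qed

lemma cellD:
  assumes "rows N n s" "i < N" "matrix n (arrs s a) f" "v < n"
  shows "arrs s a (arrs s ''row'' i + v) = (if f i v then 1 else 0)"
  using assms matrixD unfolding rows_def by simp

lemma wp_scan:
  assumes env: "env s" and t: "t \<in> {1..d}" "regs s ''t'' = t" and u: "regs s ''u'' = u" "u \<in> set q"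
    and inv: "bfs_inv V t D ord s q nw" and D: "set D \<subseteq> set ord"
  shows "wp scan (\<lambda>tm s'. \<exists>q' nw'. bfs_inv V t D ord s' (q @ q') (nw @ nw') \<and>
    (\<forall>v \<in> X t. E u v \<longrightarrow> v \<in> V t \<union> set (q @ q')) \<and> tm \<le> 80 * (K + 1)) s"
proof -
  let ?b = "layer bs t"
  have tab: "arrs s ''end'' t = arrs s ''beg'' t + length ?b"
    "j < length ?b \<Longrightarrow> arrs s ''in'' (arrs s ''beg'' t + j) = ?b ! j" for j
    using env t unfolding env_def bag_table_def by auto
  have un: "u < n" using inv u unfolding bfs_inv_def by (auto intro: layer_less)
  have row: "arrs s ''row'' t = t * n" "arrs s ''row'' u = u * n"
    using env t un unfolding env_def rows_def by auto
  show ?thesis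
    unfolding scan_def
    apply (simp add: wp_Seq t)
  proof (rule wp_While[where g = "(0, [], [])" and \<phi> = "\<lambda>(j, q', nw'). 80 * (length ?b - j)" and
      Inv = "\<lambda>(j, q', nw') s'. j \<le> length ?b \<and> regs s' ''p'' = arrs s ''beg'' t + j \<and>
        bfs_inv V t D ord s' (q @ q') (nw @ nw') \<and>
        (\<forall>v \<in> set (take j ?b). E u v \<longrightarrow> v \<in> V t \<union> set (q @ q'))"], goal_cases init step exit)
    case init
    have "bfs_inv V t D ord (s\<lparr>regs := (regs s)(''p'' := arrs s ''beg'' t)\<rparr>) q nw"
      using inv by (subst bfs_inv_cong) auto
    then show ?case by simp
  next
    case (step g s')
    obtain j q' nw' where g: "g = (j, q', nw')" by (cases g)
    note fr = frameD[OF step(3), simplified]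
    have I: "j \<le> length ?b" "regs s' ''p'' = arrs s ''beg'' t + j"
        "bfs_inv V t D ord s' (q @ q') (nw @ nw')"
        "\<forall>v \<in> set (take j ?b). E u v \<longrightarrow> v \<in> V t \<union> set (q @ q')"
      using step(1) unfolding g by auto
    have fr': "regs s' ''t'' = t" "regs s' ''u'' = u" "arrs s' ''end'' = arrs s ''end''"
        "arrs s' ''in'' = arrs s ''in''" "arrs s' ''row'' = arrs s ''row''" "arrs s' ''adj'' = arrs s ''adj''"
      using t u by (simp_all add: fr)
    have j: "j < length ?b" using step(2) I(2) by (simp add: fr' tab)
    define v Q W where "v = ?b ! j" and "Q = q @ q'" and "W = nw @ nw'"
    note I = I[folded Q_def W_def]
    have v: "v < n" "v \<in> X t" using nth_mem[OF j] layer_less unfolding v_def by blast+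
    have core: "core s' (V(t := V t \<union> set Q)) (ord @ W)" and q: "set ord \<union> set W = set ord \<union> set Q"
      using I(3) unfolding bfs_inv_def by blast+
    have vis: "arrs s' ''vis'' (t * n + v) = (if v \<in> V t \<union> set Q then 1 else 0)"
      using core v unfolding core_def matrix_def by auto
    have adj: "arrs s ''adj'' (u * n + v) = (if E u v then 1 else 0)"
      using env v unfolding env_def matrix_def by auto
    have seen: "arrs s' ''seen'' v = (if v \<in> set ord \<union> set W then 1 else 0)"
      using core v unfolding core_def by simp
    note ev = fr' I(2) tab(2)[OF j, folded v_def] row
    have uo: "u \<in> set ord \<union> set W" using u(2) q by (auto simp: Q_def)
    have takeS: "set (take (Suc j) ?b) = insert v (set (take j ?b))"
      using j by (simp add: take_Suc_conv_app_nth v_def)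
    show ?case (is "wp ?body _ _")
    proof -
      \<comment> \<open>\<open>e\<close> and \<open>f\<close> are the extensions of queue and order
        by one iteration, each either empty or \<open>[v]\<close>.\<close>
      have "\<exists>e f. (\<forall>v \<in> set (take (Suc j) ?b). E u v \<longrightarrow> v \<in> V t \<union> set (Q @ e)) \<and>
        wp ?body (\<lambda>tm s''. tm \<le> 70 \<and> regs s'' ''p'' = arrs s ''beg'' t + Suc j \<and>
          bfs_inv V t D ord s'' (Q @ e) (W @ f)) s'"
      proof (cases "v \<in> V t \<union> set Q \<or> \<not> E u v")
        case True
        then have all: "\<forall>v \<in> set (take (Suc j) ?b). E u v \<longrightarrow> v \<in> V t \<union> set Q"
          using I(4) by (auto simp: takeS)
        have "wp ?body (\<lambda>tm s''. tm \<le> 70 \<and> regs s'' ''p'' = arrs s ''beg'' t + Suc j \<and>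
          bfs_inv V t D ord s'' Q W) s'"
        proof (cases "v \<in> V t \<union> set Q")
          case True
          then have "arrs s' ''vis'' (t * n + v) = Suc 0" using vis by simp
          then show ?thesis
            by (simp add: wp_Seq wp_If ev) (rule bfs_inv_cong[THEN iffD2, OF _ _ _ I(3)]; auto)
        next
          case False
          then have "arrs s ''adj'' (u * n + v) = 0" using adj True by simp
          then show ?thesis
            by (simp add: wp_Seq wp_If ev) (rule bfs_inv_cong[THEN iffD2, OF _ _ _ I(3)]; auto)
        qed
        with all show ?thesis by (intro exI[of _ "[]"]) simp
      next
        case False
        then have all: "\<forall>x \<in> set (take (Suc j) ?b). E u x \<longrightarrow> x \<in> V t \<union> set (Q @ [v])"
          using I(4) by (auto simp: takeS)
        have cond: "arrs s' ''vis'' (t * n + v) = 0" "arrs s ''adj'' (u * n + v) = Suc 0"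
          "v \<notin> V t \<union> set Q" "E u v" using vis adj False by auto
        show ?thesis
        proof (cases "v \<in> set ord \<union> set W")
          case True
          then have "arrs s' ''seen'' v = Suc 0" using seen by simp
          then have "wp ?body (\<lambda>tm s''. tm \<le> 70 \<and> regs s'' ''p'' = arrs s ''beg'' t + Suc j \<and>
            bfs_inv V t D ord s'' (Q @ [v]) (W @ [])) s'"
            by (simp add: wp_Seq wp_If ev cond(1,2)) (rule bfs_inv_old[OF I(3) v(2) cond(3) True]; simp)
          with all show ?thesis by blast
        next
          case False
          then have "arrs s' ''seen'' v = 0" using seen by simp
          then have "wp ?body (\<lambda>tm s''. tm \<le> 70 \<and> regs s'' ''p'' = arrs s ''beg'' t + Suc j \<and>
            bfs_inv V t D ord s'' (Q @ [v]) (W @ [v])) s'"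
            by (simp add: wp_Seq wp_If ev cond(1,2))
              (rule bfs_inv_new[OF I(3) v(2) cond(3) False uo cond(4)]; simp)
          with all show ?thesis by blast
        qed
      qed
      then obtain e f where new: "\<forall>v \<in> set (take (Suc j) ?b). E u v \<longrightarrow> v \<in> V t \<union> set (Q @ e)"
        "wp ?body (\<lambda>tm s''. tm \<le> 70 \<and> regs s'' ''p'' = arrs s ''beg'' t + Suc j \<and>
          bfs_inv V t D ord s'' (Q @ e) (W @ f)) s'" by blast
      show ?thesis
        by (rule wp_mono[OF new(2)], rule exI[of _ "(Suc j, q' @ e, nw' @ f)"])
          (use new(1) j g in \<open>simp add: Q_def W_def, linarith\<close>)
    qed
  next
    case (exit tm g s')
    obtain j q' nw' where g: "g = (j, q', nw')" by (cases g)
    note fr = frameD[OF exit(3), simplified]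
    have I: "j \<le> length ?b" "regs s' ''p'' = arrs s ''beg'' t + j"
        "bfs_inv V t D ord s' (q @ q') (nw @ nw')"
        "\<forall>v \<in> set (take j ?b). E u v \<longrightarrow> v \<in> V t \<union> set (q @ q')"
      using exit(1) unfolding g by auto
    have "j = length ?b" using exit(2) I(1,2) t(2) by (simp add: fr tab)
    moreover have "length ?b \<le> K" by (rule length_layer)
    ultimately show ?case using I(3,4) exit(4) g by auto
  qed
qed

lemma scan_writes [simp]:
  "wregs scan = {''p'', ''v'', ''g'', ''w''}" "warrs scan = {''vis'', ''q'', ''seen'', ''ord'', ''pos''}"
  unfolding scan_def by auto

lemma bfs_writes [simp]:
  "wregs bfs = {''u'', ''h'', ''p'', ''v'', ''g'', ''w''}" "warrs bfs = {''vis'', ''q'', ''seen'', ''ord'', ''pos''}"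
  unfolding bfs_def by auto

lemma wp_bfs:
  assumes env: "env s" and t: "t \<in> {1..d}" "regs s ''t'' = t" and h: "regs s ''h'' = 0"
    and inv: "bfs_inv V t D ord s D []" and D: "set D \<subseteq> set ord"
  shows "wp bfs (\<lambda>tm s'. \<exists>q nw. bfs_inv V t D ord s' q nw \<and>
    (\<forall>u \<in> set q. \<forall>v \<in> X t. E u v \<longrightarrow> v \<in> V t \<union> set q) \<and> tm \<le> 120 * (K + 1) * (length q + 1)) s"
  unfolding bfs_def
\<comment> \<open>The queue grows while it is processed, so its length cannot bound the remaining
  work. The fixed number \<open>card (X t - V t)\<close> can, as the queue is a duplicate-free list
  inside \<open>X t - V t\<close>.\<close>
proof (rule wp_While[where g = "(0, D, [])" and
    \<phi> = "\<lambda>(h, q, nw). 120 * (K + 1) * (card (X t - V t) - h)" and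
    Inv = "\<lambda>(h, q, nw) s'. h \<le> length q \<and> regs s' ''h'' = h \<and> bfs_inv V t D ord s' q nw \<and>
      (\<forall>i < h. \<forall>v \<in> X t. E (q ! i) v \<longrightarrow> v \<in> V t \<union> set q)"], goal_cases init step exit)
  case init
  show ?case using h inv by simp
next
  case (step g s')
  obtain h q nw where g: "g = (h, q, nw)" by (cases g)
  note fr = frameD[OF step(3), simplified]
  have I: "h \<le> length q" "regs s' ''h'' = h" "bfs_inv V t D ord s' q nw"
      "\<forall>i < h. \<forall>v \<in> X t. E (q ! i) v \<longrightarrow> v \<in> V t \<union> set q"
    using step(1) unfolding g by auto
  have q: "holds s' ''g'' ''q'' q" "distinct q" "set q \<subseteq> X t - V t"
    using I(3) unfolding bfs_inv_def by blast+
  have hl: "h < length q" using step(2) I(2) holds_length[OF q(1)] by simp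
  have "length q = card (set q)" using q(2) by (simp add: distinct_card)
  also have "\<dots> \<le> card (X t - V t)" using q(3) by (intro card_mono) auto
  finally have lq: "length q \<le> card (X t - V t)" .
  then have "card (X t - V t) - h = Suc (card (X t - V t) - Suc h)" using hl by simp
  then have cost: "120 * (K + 1) * (card (X t - V t) - h) = 120 * (K + 1) + 120 * (K + 1) * (card (X t - V t) - Suc h)"
    by simp
  have run: "wp (''u'' ::= Read ''q'' (Reg ''h'') ;; incr ''h'' ;; scan) (\<lambda>tm s''. regs s'' ''h'' = Suc h \<and> tm \<le> 80 * (K + 1) + 10 \<and>
      (\<exists>q' nw'. bfs_inv V t D ord s'' (q @ q') (nw @ nw') \<and>
        (\<forall>v \<in> X t. E (q ! h) v \<longrightarrow> v \<in> V t \<union> set (q @ q')))) s'"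
    apply (simp only: wp_Seq wp_Assign)
  proof (rule wp_frame, rule wp_scan[where t = t and u = "q ! h" and V = V and D = D and ord = ord and q = q and nw = nw],
      goal_cases)
    case 1
    have "env s'" using env by (subst env_cong[where s = s]) (auto simp: fr)
    then show ?case by (subst env_cong[where s = s']) auto
  next
    case 6
    show ?case using I(3) by (subst bfs_inv_cong[where s = s']) auto
  next
    case (8 tm s'')
    then show ?case using frameD(1)[OF 8(2), of "''h''"] I(2) by auto
  qed (use t hl D holds_nth[OF q(1) hl] I(2) in \<open>auto simp: fr\<close>)
  show ?case
  proof (rule wp_mono[OF run], elim conjE exE)
    fix tm s'' q' nw'
    assume new: "regs s'' ''h'' = Suc h" "tm \<le> 80 * (K + 1) + 10" "bfs_inv V t D ord s'' (q @ q') (nw @ nw')"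
      "\<forall>v \<in> X t. E (q ! h) v \<longrightarrow> v \<in> V t \<union> set (q @ q')"
    have "\<forall>i < Suc h. \<forall>v \<in> X t. E ((q @ q') ! i) v \<longrightarrow> v \<in> V t \<union> set (q @ q')"
      using I(4) new(4) hl by (auto simp: less_Suc_eq nth_append)
    then show "\<exists>g'. (case g' of (h, q, nw) \<Rightarrow> \<lambda>s'. h \<le> length q \<and> regs s' ''h'' = h \<and> bfs_inv V t D ord s' q nw \<and>
          (\<forall>i < h. \<forall>v \<in> X t. E (q ! i) v \<longrightarrow> v \<in> V t \<union> set q)) s'' \<and>
        bcost (Less (Reg ''h'') (Reg ''g'')) + 1 + tm +
          (case g' of (h, q, nw) \<Rightarrow> 120 * (K + 1) * (card (X t - V t) - h))
        \<le> (case g of (h, q, nw) \<Rightarrow> 120 * (K + 1) * (card (X t - V t) - h))"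
      using new hl cost unfolding g by (intro exI[of _ "(Suc h, q @ q', nw @ nw')"]) simp
  qed
next
  case (exit tm g s')
  obtain h q nw where g: "g = (h, q, nw)" by (cases g)
  have I: "h \<le> length q" "regs s' ''h'' = h" "bfs_inv V t D ord s' q nw"
      "\<forall>i < h. \<forall>v \<in> X t. E (q ! i) v \<longrightarrow> v \<in> V t \<union> set q"
    using exit(1) unfolding g by auto
  have q: "holds s' ''g'' ''q'' q" "distinct q" "set q \<subseteq> X t - V t"
    using I(3) unfolding bfs_inv_def by blast+
  have h: "h = length q" using exit(2) I(1,2) holds_length[OF q(1)] by simp
  have "length q = card (set q)" using q(2) by (simp add: distinct_card)
  also have "\<dots> \<le> card (X t - V t)" using q(3) by (intro card_mono) auto
  \<comment> \<open>Subtracting the potential left at the exit turns the bound by the unvisited part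
    of the bag into one by the final queue, as the amortisation over marks requires.\<close>
  finally have "120 * (K + 1) * card (X t - V t) =
      120 * (K + 1) * (card (X t - V t) - length q) + 120 * (K + 1) * length q"
    by (metis add_mult_distrib2 le_add_diff_inverse2)
  then have "tm \<le> 120 * (K + 1) * length q + 4"
    using exit(4) unfolding g h by simp
  then have "tm \<le> 120 * (K + 1) * (length q + 1)" by simp
  moreover have "v \<in> V t \<union> set q" if "u \<in> set q" "v \<in> X t" "E u v" for u v
    using that I(4) h unfolding in_set_conv_nth[of u] by blast
  ultimately show ?case using I(3) by blast
qed

lemma wp_count:
  assumes env: "env s" and t: "t \<in> {1..d}" "regs s ''t'' = t" and core: "core s V ord"
    and q: "holds s ''g'' ''q'' q" "set q \<subseteq> {..<n}"
  shows "wp count (\<lambda>tm s'. tm \<le> 90 * (length q + 1) \<and>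
    regs s' ''x'' = length (filter (\<lambda>u. u \<in> X (t - 1) \<and> u \<notin> V (t - 1)) q) \<and>
    regs s' ''y'' = length (filter (\<lambda>u. u \<in> X (Suc t) \<and> u \<notin> V (Suc t)) q)) s"
  unfolding count_def
  apply (simp add: wp_Seq)
proof (rule wp_While[where g = 0 and \<phi> = "\<lambda>h. 90 * (length q - h)" and
    Inv = "\<lambda>h s'. h \<le> length q \<and> regs s' ''h'' = h \<and>
      regs s' ''x'' = length (filter (\<lambda>u. u \<in> X (t - 1) \<and> u \<notin> V (t - 1)) (take h q)) \<and>
      regs s' ''y'' = length (filter (\<lambda>u. u \<in> X (Suc t) \<and> u \<notin> V (Suc t)) (take h q))"],
    goal_cases init step exit)
  case init
  show ?case by simp
next
  case (step h s')
  note fr = frameD[OF step(3), simplified]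
  have h: "h < length q" using step(1,2) q(1) by (simp add: fr holds_length)
  have key: "length q - h = Suc (length q - Suc h)" using h by simp
  have u: "q ! h < n" using q(2) nth_mem[OF h] by blast
  have rows: "rows (n + d + 2) n s" using env unfolding env_def by blast
  have mem: "arrs s ''mem'' (arrs s ''row'' i + q ! h) = (if q ! h \<in> X i then 1 else 0)" if "i \<le> Suc d" for i
    by (rule cellD[OF rows _ _ u]) (use that env in \<open>auto simp: env_def\<close>)
  have vis: "arrs s ''vis'' (arrs s ''row'' i + q ! h) = (if q ! h \<in> V i then 1 else 0)" if "i \<le> Suc d" for i
    by (rule cellD[OF rows _ _ u]) (use that core in \<open>auto simp: core_def\<close>)
  have i: "t - 1 \<le> Suc d" "t - Suc 0 \<le> Suc d" "Suc t \<le> Suc d" using t by auto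
  show ?case
    using step(1) h
    by (simp add: key wp_Seq wp_If fr t(2) holds_nth[OF q(1)] mem[OF i(2)] vis[OF i(2)] mem[OF i(3)] vis[OF i(3)]
        take_Suc_conv_app_nth)
next
  case (exit tm h s')
  note fr = frameD(1)[OF exit(3), simplified]
  have "h = length q" using exit(1,2) q(1) by (simp add: fr holds_length)
  then show ?case using exit(1,4) by simp
qed

lemma wp_update:
  assumes ls: "holds s ''lp'' ''ls'' lst" "lst \<noteq> []" and rs: "holds s ''rp'' ''rs'' rst" "rst \<noteq> []"
    and t: "regs s ''t'' = t" and xy: "regs s ''x'' = x" "regs s ''y'' = y"
  shows "wp update (\<lambda>tm s'. tm \<le> 60 \<and> regs s' ''L'' = regs s ''L'' + x \<and> regs s' ''R'' = regs s ''R'' + y \<and>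
    holds s' ''lp'' ''ls'' (lst @ (if 0 < x \<and> last lst < t - 1 then [t - 1] else [])) \<and>
    holds s' ''rp'' ''rs'' (rst @ (if 0 < y \<and> t < last rst then [t] else []))) s"
proof -
  have top: "arrs s ''ls'' (regs s ''lp'' - 1) = last lst" "arrs s ''rs'' (regs s ''rp'' - 1) = last rst"
    using ls rs by (auto simp: holds_def last_conv_nth)
  have len: "regs s ''lp'' = length lst" "regs s ''rp'' = length rst" using ls rs by (auto simp: holds_def)
  show ?thesis
    unfolding update_def
    using ls(1) rs(1) top
    by (auto simp: wp_Seq wp_If t xy len holds_def nth_append less_Suc_eq)
qed

lemma length_filter_cut:
  "distinct q \<Longrightarrow> length (filter (\<lambda>u. u \<in> B \<and> u \<notin> C) q) = card (set q \<inter> B - C)"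
  by (subst distinct_length_filter) (auto intro!: arg_cong[where f = card])

text \<open>\<open>l\<close>, \<open>r\<close> and both stacks are the values on entry, with a
  consumed piece already removed; \<open>A\<close> is what the visit adds to bag \<open>t\<close>,
  the seeds \<open>D\<close> included.\<close>

definition visited where
  "visited t V D ord lst rst l r A nw s \<longleftrightarrow> set D \<subseteq> A \<and> A \<subseteq> X t - V t \<and>
    (\<forall>u \<in> A. \<forall>v \<in> X t. E u v \<longrightarrow> v \<in> V t \<union> A) \<and>
    core s (V(t := V t \<union> A)) (ord @ nw) \<and> set ord \<union> set nw = set ord \<union> A \<and> linked (ord @ nw) \<and>
    regs s ''L'' = l + card (A \<inter> X (t - 1) - V (t - 1)) \<and>
    regs s ''R'' = r + card (A \<inter> X (Suc t) - V (Suc t)) \<and>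
    holds s ''lp'' ''ls'' (lst @ (if 0 < card (A \<inter> X (t - 1) - V (t - 1)) \<and> last lst < t - 1 then [t - 1] else [])) \<and>
    holds s ''rp'' ''rs'' (rst @ (if 0 < card (A \<inter> X (Suc t) - V (Suc t)) \<and> t < last rst then [t] else []))"

lemma wp_visit:
  assumes env: "env s" and t: "t \<in> {1..d}" "regs s ''t'' = t" and h: "regs s ''h'' = 0"
    and core: "core s (V(t := V t \<union> set D)) ord" and q: "holds s ''g'' ''q'' D" "distinct D"
    and D: "set D \<subseteq> X t - V t" "set D \<subseteq> set ord" and linked: "linked ord"
    and ls: "holds s ''lp'' ''ls'' lst" "lst \<noteq> []" and rs: "holds s ''rp'' ''rs'' rst" "rst \<noteq> []"
  shows "wp visit (\<lambda>tm s'. \<exists>A nw. visited t V D ord lst rst (regs s ''L'') (regs s ''R'') A nw s' \<and>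
    tm \<le> 300 * (K + 1) * (card A + 1)) s" (is "wp visit ?Q s")
proof -
  have "bfs_inv V t D ord s D []"
    using core q D linked unfolding bfs_inv_def by auto
  note bfs = wp_bfs[OF env t h this D(2)]
  show ?thesis
    unfolding visit_def
  proof (rule wp_SeqI[OF bfs], elim exE conjE)
    fix tm1 :: nat and s1 Q nw
    assume 1: "frame bfs s s1" "bfs_inv V t D ord s1 Q nw"
      "\<forall>u \<in> set Q. \<forall>v \<in> X t. E u v \<longrightarrow> v \<in> V t \<union> set Q" "tm1 \<le> 120 * (K + 1) * (length Q + 1)"
    note fr1 = frameD[OF 1(1), simplified]
    have core1: "core s1 (V(t := V t \<union> set Q)) (ord @ nw)" and Q: "holds s1 ''g'' ''q'' Q" "distinct Q"
        "set D \<subseteq> set Q" "set Q \<subseteq> X t - V t" "set ord \<union> set nw = set ord \<union> set Q" "linked (ord @ nw)"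
      using 1(2) unfolding bfs_inv_def by blast+
    have env1: "env s1" using env by (subst env_cong[where s = s]) (auto simp: fr1)
    have Qn: "set Q \<subseteq> {..<n}" using Q(4) layer_less by blast
    have t1: "regs s1 ''t'' = t" using t by (simp add: fr1)
    define x y where "x = card (set Q \<inter> X (t - 1) - V (t - 1))" and "y = card (set Q \<inter> X (Suc t) - V (Suc t))"
    have cnt: "wp count (\<lambda>tm s'. tm \<le> 90 * (length Q + 1) \<and> regs s' ''x'' = x \<and> regs s' ''y'' = y) s1"
    proof (rule wp_mono[OF wp_count[OF env1 t(1) t1 core1 Q(1) Qn]])
      have "t - 1 \<noteq> t" using t(1) by auto
      then show "tm \<le> 90 * (length Q + 1) \<and> regs s' ''x'' = x \<and> regs s' ''y'' = y"
        if "tm \<le> 90 * (length Q + 1) \<and>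
          regs s' ''x'' = length (filter (\<lambda>u. u \<in> X (t - 1) \<and> u \<notin> (V(t := V t \<union> set Q)) (t - 1)) Q) \<and>
          regs s' ''y'' = length (filter (\<lambda>u. u \<in> X (Suc t) \<and> u \<notin> (V(t := V t \<union> set Q)) (Suc t)) Q)"
        for tm s'
        using that by (simp add: length_filter_cut[OF Q(2)] x_def y_def)
    qed
    show "wp (count ;; update) (\<lambda>t'. ?Q (tm1 + t')) s1"
    proof (rule wp_SeqI[OF cnt], elim conjE)
      fix tm2 :: nat and s2
      assume 2: "frame count s1 s2" "tm2 \<le> 90 * (length Q + 1)" "regs s2 ''x'' = x" "regs s2 ''y'' = y"
      have "wregs count = {''h'', ''x'', ''y'', ''u''}" "warrs count = {}" by (auto simp: count_def)
      note fr2 = frameD[OF 2(1), unfolded this, simplified]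
      have core2: "core s2 (V(t := V t \<union> set Q)) (ord @ nw)"
        using core1 by (subst core_cong[where s = s1]) (auto simp: fr2)
      have t2: "regs s2 ''t'' = t" using t1 by (simp add: fr2)
      have ls2: "holds s2 ''lp'' ''ls'' lst" and rs2: "holds s2 ''rp'' ''rs'' rst"
        using ls(1) rs(1) by (simp_all add: holds_def fr1 fr2)
      show "wp update (\<lambda>t'. ?Q (tm1 + (tm2 + t'))) s2"
      proof (rule wp_frame[OF wp_update[OF ls2 ls(2) rs2 rs(2) t2 2(3,4)]], elim conjE)
        fix tm3 :: nat and s3
        assume 3: "frame update s2 s3" "tm3 \<le> 60" "regs s3 ''L'' = regs s2 ''L'' + x" "regs s3 ''R'' = regs s2 ''R'' + y"
          "holds s3 ''lp'' ''ls'' (lst @ (if 0 < x \<and> last lst < t - 1 then [t - 1] else []))"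
          "holds s3 ''rp'' ''rs'' (rst @ (if 0 < y \<and> t < last rst then [t] else []))"
        have "wregs update = {''L'', ''R'', ''lp'', ''rp''}" "warrs update = {''ls'', ''rs''}"
          by (auto simp: update_def)
        note fr3 = frameD[OF 3(1), unfolded this, simplified]
        have core3: "core s3 (V(t := V t \<union> set Q)) (ord @ nw)"
          using core2 by (subst core_cong[where s = s2]) (auto simp: fr3)
        have len: "length Q = card (set Q)" using Q(2) by (simp add: distinct_card)
        have "90 * (card (set Q) + 1) + 60 \<le> 150 * (K + 1) * (card (set Q) + 1)" by (simp add: algebra_simps)
        moreover have "120 * (K + 1) * (card (set Q) + 1) + 150 * (K + 1) * (card (set Q) + 1) \<le>
            300 * (K + 1) * (card (set Q) + 1)" by (simp add: algebra_simps)
        ultimately have "tm1 + (tm2 + tm3) \<le> 300 * (K + 1) * (card (set Q) + 1)"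
          using 1(4) 2(2) 3(2) unfolding len by linarith
        moreover have "regs s3 ''L'' = regs s ''L'' + x" "regs s3 ''R'' = regs s ''R'' + y"
          using 3(3,4) by (simp_all add: fr1 fr2)
        ultimately show "?Q (tm1 + (tm2 + tm3)) s3"
          using Q(3-6) 1(3) core3 3(5,6) unfolding visited_def x_def y_def by blast
      qed
    qed
  qed
qed

end

section \<open>The search\<close>

definition collect :: com where
  "collect =
     ''g'' ::= Const 0 ;;
     ''p'' ::= Read ''beg'' (Reg ''t'') ;;
     While (Less (Reg ''p'') (Read ''end'' (Reg ''t'')))
       (''v'' ::= Read ''in'' (Reg ''p'') ;;
        If (And (Less (Const 0) (cell ''vis'' (Reg ''s'') (Reg ''v'')))
            (Less (cell ''vis'' (Reg ''t'') (Reg ''v'')) (Const 1)))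
          (mark ''vis'' (Reg ''t'') (Reg ''v'') ;;
           Write ''q'' (Reg ''g'') (Reg ''v'') ;;
           incr ''g'')
          Skip ;;
        incr ''p'')"

text \<open>\<open>z\<close> names the weight register of the border that advances; the vertices
  collected into the queue are the piece that leaves this border.\<close>

definition turn :: "string \<Rightarrow> com" where
  "turn z = collect ;; z ::= Sub (Reg z) (Reg ''g'') ;; ''h'' ::= Const 0 ;; visit"

text \<open>A stack entry is a gap, named after the bag on its left. Hence a move to the left enters
  the bag of that number, whereas a move to the right enters the next one.\<close>

definition go_left :: com where
  "go_left =
     ''lp'' ::= Sub (Reg ''lp'') (Const 1) ;;
     ''t'' ::= Read ''ls'' (Reg ''lp'') ;;
     ''s'' ::= Add (Reg ''t'') (Const 1) ;;
     turn ''L''"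

definition go_right :: com where
  "go_right =
     ''rp'' ::= Sub (Reg ''rp'') (Const 1) ;;
     ''s'' ::= Read ''rs'' (Reg ''rp'') ;;
     ''t'' ::= Add (Reg ''s'') (Const 1) ;;
     turn ''R''"

definition search :: com where
  "search =
     While (Less (Const 0) (Add (Reg ''L'') (Reg ''R'')))
       (If (Less (Reg ''L'') (Reg ''R'')) go_right go_left)"

text \<open>Memory that is initially zero already holds vertex \<open>0\<close> at the head of
  \<open>q\<close> and \<open>ord\<close>, its position \<open>0\<close>, and the sentinel
  \<open>0\<close> of \<open>ls\<close>; only lengths, marks and the sentinel of \<open>rs\<close>
  have to be written.\<close>

definition start :: com where
  "start =
     ''t'' ::= Reg ''c'' ;;
     mark ''vis'' (Reg ''t'') (Const 0) ;;
     Write ''seen'' (Const 0) (Const 1) ;;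
     ''w'' ::= Const 1 ;;
     ''g'' ::= Const 1 ;;
     ''lp'' ::= Const 1 ;;
     ''rp'' ::= Const 1 ;;
     Write ''rs'' (Const 0) (Add (Reg ''d'') (Const 1)) ;;
     ''h'' ::= Const 0 ;;
     visit"

text \<open>No entry lies beyond \<open>p\<close>, so a top that is not before \<open>p\<close>
  equals \<open>p\<close>; the conditional push therefore never duplicates an entry.\<close>

lemma stack_push:
  fixes y :: nat
  assumes "sorted_wrt lt xs" "set xs = insert z S" "\<forall>a \<in> set xs. a = p \<or> lt a p" "xs \<noteq> []"
    and trans: "transp lt"
  defines "ys \<equiv> xs @ (if 0 < y \<and> lt (last xs) p then [p] else [])"
  shows "sorted_wrt lt ys" "set ys = insert z (if 0 < y then insert p S else S)"
proof -
  have le_last: "a = last xs \<or> lt a (last xs)" if "a \<in> set xs" for a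
  proof -
    obtain ys x where xs: "xs = ys @ [x]" using assms(4) by (cases xs rule: rev_cases) auto
    show ?thesis using assms(1) that unfolding xs by (auto simp: sorted_wrt_append)
  qed
  show "sorted_wrt lt ys"
  proof (cases "0 < y \<and> lt (last xs) p")
    case True
    then have "lt a p" if "a \<in> set xs" for a using le_last[OF that] transpD[OF trans, of a "last xs" p] by auto
    then show ?thesis using True assms(1) by (simp add: ys_def sorted_wrt_append)
  next
    case False
    then show ?thesis unfolding ys_def if_not_P[OF False] using assms(1) by simp
  qed
  have "p \<in> set xs" if "\<not> lt (last xs) p"
  proof -
    have "last xs \<in> set xs" using assms(4) by simp
    then show ?thesis using assms(3) that by metis
  qed
  then show "set ys = insert z (if 0 < y then insert p S else S)"
    unfolding ys_def using assms(2) by (cases "lt (last xs) p") auto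
qed

context decomposed
begin

lemma wp_collect:
  assumes env: "env s" and t: "t \<in> {1..d}" "regs s ''t'' = t" and r: "r \<le> Suc d" "r \<noteq> t" "regs s ''s'' = r"
    and core: "core s V ord"
  shows "wp collect (\<lambda>tm s'. tm \<le> 80 * (K + 1) \<and> (\<exists>D. set D = cut V r t \<and> distinct D \<and>
    holds s' ''g'' ''q'' D \<and> core s' (V(t := V t \<union> set D)) ord)) s"
proof -
  let ?b = "layer bs t" and ?P = "\<lambda>v. v \<in> V r \<and> v \<notin> V t"
  have tab: "arrs s ''end'' t = arrs s ''beg'' t + length ?b"
    "j < length ?b \<Longrightarrow> arrs s ''in'' (arrs s ''beg'' t + j) = ?b ! j" for j
    using env t unfolding env_def bag_table_def by auto
  have rows: "rows (n + d + 2) n s" using env unfolding env_def by blast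
  have row: "arrs s ''row'' t = t * n" "arrs s ''row'' r = r * n" using rows t r by (auto simp: rows_def)
  show ?thesis
    unfolding collect_def
    apply (simp add: wp_Seq t)
  proof (rule wp_While[where g = 0 and \<phi> = "\<lambda>j. 70 * (length ?b - j)" and
      Inv = "\<lambda>j s'. j \<le> length ?b \<and> regs s' ''p'' = arrs s ''beg'' t + j \<and>
        holds s' ''g'' ''q'' (filter ?P (take j ?b)) \<and>
        core s' (V(t := V t \<union> set (filter ?P (take j ?b)))) ord"], goal_cases init step exit)
    case init
    have "core (s\<lparr>regs := (regs s)(''g'' := 0, ''p'' := arrs s ''beg'' t)\<rparr>) V ord"
      using core by (subst core_cong[where s = s]) auto
    then show ?case by (simp add: holds_def)
  next
    case (step j s')
    note fr = frameD[OF step(3), simplified]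
    let ?D = "filter ?P (take j ?b)"
    have I: "j \<le> length ?b" "regs s' ''p'' = arrs s ''beg'' t + j" "holds s' ''g'' ''q'' ?D"
      "core s' (V(t := V t \<union> set ?D)) ord" using step(1) by auto
    have fr': "regs s' ''t'' = t" "regs s' ''s'' = r" "arrs s' ''end'' = arrs s ''end''"
        "arrs s' ''in'' = arrs s ''in''" "arrs s' ''row'' = arrs s ''row''"
      using t r by (simp_all add: fr)
    have j: "j < length ?b" using step(2) I(2) by (simp add: fr' tab)
    have key: "length ?b - j = Suc (length ?b - Suc j)" using j by simp
    define v where "v = ?b ! j"
    have v: "v < n" "v \<in> X t" using nth_mem[OF j] layer_less unfolding v_def by blast+
    have "v \<notin> set (take j ?b)"
      using distinct_layer[of t] j unfolding v_def by (auto simp: in_set_conv_nth nth_eq_iff_index_eq)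
    then have vD: "v \<notin> set ?D" by simp
    have m: "matrix n (arrs s' ''vis'') (\<lambda>i w. w \<in> (V(t := V t \<union> set ?D)) i)"
      using I(4) unfolding core_def by blast
    have vis: "arrs s' ''vis'' (t * n + v) = (if v \<in> V t then 1 else 0)"
      "arrs s' ''vis'' (r * n + v) = (if v \<in> V r then 1 else 0)"
      using matrixD[OF m v(1), of t] matrixD[OF m v(1), of r] vD r(2) by auto
    have g: "regs s' ''g'' = length ?D" using I(3) by (rule holds_length)
    note ev = fr' I(2) tab(2)[OF j, folded v_def] row
    have takeS: "filter ?P (take (Suc j) ?b) = ?D @ (if ?P v then [v] else [])"
      using j by (simp add: take_Suc_conv_app_nth v_def)
    show ?case (is "wp ?body _ _")
    proof -
      have run: "wp ?body (\<lambda>tm s''. tm \<le> 60 \<and> regs s'' ''p'' = arrs s ''beg'' t + Suc j \<and>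
        holds s'' ''g'' ''q'' (filter ?P (take (Suc j) ?b)) \<and>
        core s'' (V(t := V t \<union> set (filter ?P (take (Suc j) ?b)))) ord) s'"
      proof (cases "?P v")
        case True
        have "arrs s' ''vis'' (t * n + v) = 0" "arrs s' ''vis'' (r * n + v) = Suc 0" using vis True by auto
        note vis' = this
        have t1: "filter ?P (take (Suc j) ?b) = ?D @ [v]" using takeS True by simp
        have m': "matrix n ((arrs s' ''vis'')(t * n + v := Suc 0)) (\<lambda>i w. w \<in> (V(t := V t \<union> set (?D @ [v]))) i)"
          by (rule matrix_mark[OF m v(1)]) auto
        show ?thesis
          unfolding t1
          apply (simp only: wp_Seq wp_If wp_Assign wp_Write wp_Skip)
          apply (simp add: ev vis' del: filter_append)
          apply (intro conjI)
           apply (rule holds_push[OF I(3)]; simp)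
          using I(4) m' unfolding core_def holds_def by simp
      next
        case False
        have t1: "filter ?P (take (Suc j) ?b) = ?D" using takeS False by simp
        consider "arrs s' ''vis'' (r * n + v) = 0" |
          "arrs s' ''vis'' (r * n + v) = Suc 0" "arrs s' ''vis'' (t * n + v) = Suc 0"
          using vis False by (cases "v \<in> V r"; cases "v \<in> V t") simp_all
        then show ?thesis
          unfolding t1 using I(3,4) by cases (simp add: wp_Seq wp_If ev, simp add: core_def holds_def)+
      qed
      show ?thesis
        by (rule wp_mono[OF run], rule exI[of _ "Suc j"]) (use j in \<open>simp add: key\<close>)
    qed
  next
    case (exit tm j s')
    note fr = frameD[OF exit(3), simplified]
    have j: "j = length ?b" using exit(1,2) t(2) by (simp add: fr tab)
    let ?D = "filter ?P ?b"
    have "set ?D = cut V r t" by (auto simp: cut_def)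
    moreover have "distinct ?D" using distinct_layer by simp
    moreover have "tm + 13 \<le> 80 * (K + 1)"
      using exit(4) length_layer[of t] j by simp
    moreover have "holds s' ''g'' ''q'' ?D" "core s' (V(t := V t \<union> set ?D)) ord"
      using exit(1) unfolding j by simp_all
    ultimately show ?case by (intro conjI exI[of _ ?D]) simp_all
  qed
qed

section \<open>Size of the boundaries of prefixes\<close>

definition narrow :: "nat list \<Rightarrow> bool" where
  "narrow ord \<longleftrightarrow> (\<forall>i < length ord. card (insert (ord ! i) (border (set (take i ord)))) \<le> 2 * K)"

text \<open>Covers the start, where the whole order still lies in a single bag.\<close>

lemma narrow_within:
  assumes "set ord \<subseteq> A" "finite A" "card A \<le> 2 * K"
  shows "narrow ord"
  unfolding narrow_def
proof (intro allI impI)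
  fix i assume "i < length ord"
  then have "insert (ord ! i) (border (set (take i ord))) \<subseteq> A"
    using assms(1) set_take_subset[of i ord] nth_mem[of i ord] unfolding border_def by blast
  then have "card (insert (ord ! i) (border (set (take i ord)))) \<le> card A"
    using assms(2) by (rule card_mono[rotated])
  then show "card (insert (ord ! i) (border (set (take i ord)))) \<le> 2 * K"
    using assms(3) by linarith
qed

text \<open>A step may append several vertices, and every intermediate prefix needs the bound. Its
  boundary consists of vertices of \<open>A\<close> and of old boundary vertices, because a
  neighbour outside the longer prefix is also outside \<open>ord\<close>.\<close>

lemma narrow_append:
  assumes "narrow ord" "distinct (ord @ nw)" "set ord \<union> set nw = set ord \<union> A" "finite A"
    and "card (border (set ord) - A) + card A \<le> 2 * K"
  shows "narrow (ord @ nw)"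
  unfolding narrow_def
proof (intro allI impI)
  fix i assume i: "i < length (ord @ nw)"
  show "card (insert ((ord @ nw) ! i) (border (set (take i (ord @ nw))))) \<le> 2 * K"
  proof (cases "i < length ord")
    case True
    then show ?thesis using assms(1) unfolding narrow_def by (simp add: nth_append)
  next
    case False
    then have "(ord @ nw) ! i \<in> set nw" using i by (auto simp: nth_append)
    then have "(ord @ nw) ! i \<in> A" using assms(2,3) by auto
    moreover have "border (set (take i (ord @ nw))) \<subseteq> (border (set ord) - A) \<union> A"
    proof
      fix v assume "v \<in> border (set (take i (ord @ nw)))"
      then obtain u where v: "v \<in> set (take i (ord @ nw))" "E v u" "u \<notin> set (take i (ord @ nw))"
        unfolding border_def by blast
      have "u \<notin> set ord" using v(3) False by simp
      moreover have "v \<in> set ord \<union> A" using v(1) set_take_subset[of i "ord @ nw"] assms(3) by auto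
      ultimately show "v \<in> (border (set ord) - A) \<union> A" using v(2) unfolding border_def by blast
    qed
    ultimately have "insert ((ord @ nw) ! i) (border (set (take i (ord @ nw)))) \<subseteq> (border (set ord) - A) \<union> A"
      by blast
    moreover have "finite (border (set ord))" unfolding border_def by simp
    ultimately have "card (insert ((ord @ nw) ! i) (border (set (take i (ord @ nw))))) \<le>
        card ((border (set ord) - A) \<union> A)"
      using assms(4) by (intro card_mono) auto
    also have "\<dots> \<le> card (border (set ord) - A) + card A" by (rule card_Un_le)
    finally show ?thesis using assms(5) by linarith
  qed
qed

lemma wp_turn:
  assumes env: "env s" and t: "t \<in> {1..d}" "regs s ''t'' = t" and r: "r \<le> Suc d" "r \<noteq> t" "regs s ''s'' = r"
    and core: "core s V ord" and linked: "linked ord" and V: "V r \<subseteq> set ord"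
    and ls: "holds s ''lp'' ''ls'' lst" "lst \<noteq> []" and rs: "holds s ''rp'' ''rs'' rst" "rst \<noteq> []"
    and z: "z = ''L'' \<or> z = ''R''"
  shows "wp (turn z) (\<lambda>tm s'. \<exists>D A nw. set D = cut V r t \<and> visited t V D ord lst rst
      (regs s ''L'' - (if z = ''L'' then card (cut V r t) else 0))
      (regs s ''R'' - (if z = ''R'' then card (cut V r t) else 0)) A nw s' \<and>
      tm \<le> 400 * (K + 1) * (card A + 1)) s" (is "wp _ ?Q s")
  unfolding turn_def
proof (rule wp_SeqI[OF wp_collect[OF env t r core]], elim exE conjE)
  fix tm1 :: nat and s1 D
  assume 1: "frame collect s s1" "tm1 \<le> 80 * (K + 1)" "set D = cut V r t" "distinct D" "holds s1 ''g'' ''q'' D"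
    "core s1 (V(t := V t \<union> set D)) ord"
  have "wregs collect = {''g'', ''p'', ''v''}" "warrs collect = {''vis'', ''q''}" by (auto simp: collect_def)
  note fr1 = frameD[OF 1(1), unfolded this, simplified]
  define s2 where "s2 = s1\<lparr>regs := (regs s1)(z := regs s1 z - regs s1 ''g'', ''h'' := 0)\<rparr>"
  have s2: "regs s2 ''h'' = 0" "regs s2 ''t'' = t"
    "\<And>a. arrs s2 a = arrs s1 a" "\<And>x. x \<noteq> z \<Longrightarrow> x \<noteq> ''h'' \<Longrightarrow> regs s2 x = regs s1 x"
    "regs s2 z = regs s1 z - regs s1 ''g''"
    using z t(2) by (auto simp: s2_def fr1)
  have g: "regs s1 ''g'' = card (cut V r t)"
    using 1(3-5) by (simp add: holds_length distinct_card[symmetric])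
  have L: "regs s2 ''L'' = regs s ''L'' - (if z = ''L'' then card (cut V r t) else 0)"
    "regs s2 ''R'' = regs s ''R'' - (if z = ''R'' then card (cut V r t) else 0)"
    using z by (auto simp: s2_def fr1 g)
  have "wp visit (\<lambda>tm s'. \<exists>A nw. visited t V D ord lst rst (regs s2 ''L'') (regs s2 ''R'') A nw s' \<and>
      tm \<le> 300 * (K + 1) * (card A + 1)) s2"
  proof (rule wp_visit)
    show "env s2" using env by (subst env_cong[where s = s]) (auto simp: s2 fr1)
    show "core s2 (V(t := V t \<union> set D)) ord" using 1(6) z by (subst core_cong[where s = s1]) (auto simp: s2)
    show "holds s2 ''g'' ''q'' D" using 1(5) z by (subst holds_cong[where s = s1]) (auto simp: s2)
    show "set D \<subseteq> X t - V t" "set D \<subseteq> set ord" using 1(3) V by (auto simp: cut_def)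
    show "holds s2 ''lp'' ''ls'' lst" using ls(1) z by (subst holds_cong[where s = s]) (auto simp: s2 fr1)
    show "holds s2 ''rp'' ''rs'' rst" using rs(1) z by (subst holds_cong[where s = s]) (auto simp: s2 fr1)
  qed (fact t(1) s2(1,2) 1(4) linked ls(2) rs(2))+
  note visit = this[unfolded L]
  show "wp (z ::= Sub (Reg z) (Reg ''g'') ;; ''h'' ::= Const 0 ;; visit) (\<lambda>t'. ?Q (tm1 + t')) s1"
  proof -
    have st: "s1\<lparr>regs := (regs s1)(z := regs s1 z - regs s1 ''g''),
        regs := (regs (s1\<lparr>regs := (regs s1)(z := regs s1 z - regs s1 ''g'')\<rparr>))(''h'' := 0)\<rparr> = s2"
      by (simp add: s2_def)
    show ?thesis
      apply (simp only: wp_Seq wp_Assign aval.simps st)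
    proof (rule wp_mono[OF visit], elim exE conjE)
      fix tm :: nat and s' A nw
      assume "visited t V D ord lst rst (regs s ''L'' - (if z = ''L'' then card (cut V r t) else 0))
          (regs s ''R'' - (if z = ''R'' then card (cut V r t) else 0)) A nw s'" "tm \<le> 300 * (K + 1) * (card A + 1)"
      moreover have "80 * (K + 1) + 20 + 300 * (K + 1) * (card A + 1) \<le> 400 * (K + 1) * (card A + 1)"
        by (simp add: algebra_simps)
      ultimately show "?Q (tm1 + (acost (Sub (Reg z) (Reg ''g'')) + 1 + (acost (Const 0) + 1 + tm))) s'"
        using 1(2,3) by (intro exI[of _ D] exI[of _ A] exI[of _ nw]) simp
    qed
  qed
qed

section \<open>The invariant of the search, its preservation and its potential\<close>

definition search_inv where
  "search_inv V ord lst rst s \<longleftrightarrow> valid V \<and> core s V ord \<and> set ord = (\<Union>t. V t) \<and> linked ord \<and> narrow ord \<and>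
    regs s ''L'' = sum (Lc V) {..d} \<and> regs s ''R'' = sum (Rc V) {..d} \<and>
    holds s ''lp'' ''ls'' lst \<and> holds s ''rp'' ''rs'' rst \<and>
    sorted_wrt (<) lst \<and> set lst = insert 0 {a. 0 < Lc V a} \<and>
    sorted_wrt (>) rst \<and> set rst = insert (Suc d) {a. 0 < Rc V a} \<and> ord \<noteq> []"

text \<open>Counts the pairs of a bag and a vertex that are still to be marked; these pay for the
  search.\<close>

definition unvisited :: "(nat \<Rightarrow> nat set) \<Rightarrow> nat" where
  "unvisited V = (\<Sum>t\<le>d. card (X t - V t))"

lemma unvisited_update:
  assumes "A \<subseteq> X t - V t" "t \<le> d"
  shows "unvisited (V(t := V t \<union> A)) + card A = unvisited V"
proof -
  have "X t - V t = (X t - (V t \<union> A)) \<union> A" "(X t - (V t \<union> A)) \<inter> A = {}" using assms(1) by auto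
  then have "card (X t - V t) = card (X t - (V t \<union> A)) + card A"
    by (metis card_Un_disjoint fin_X finite_Diff finite_UnI finite_Un finite_subset assms(1))
  moreover have "unvisited W = card (X t - W t) + (\<Sum>a \<in> {..d} - {t}. card (X a - W a))" for W
    unfolding unvisited_def using assms(2) by (intro sum.remove) auto
  moreover have "(\<Sum>a \<in> {..d} - {t}. card (X a - (V(t := V t \<union> A)) a)) = (\<Sum>a \<in> {..d} - {t}. card (X a - V a))"
    by (intro sum.cong) auto
  ultimately show ?thesis by simp
qed

text \<open>The sentinel \<open>z\<close> precedes all pieces, so in a sorted stack with at least
  one piece the top is a piece, and the innermost one.\<close>

lemma stack_top:
  assumes "sorted_wrt lt xs" "set xs = insert z S" "a \<in> S" "\<forall>a \<in> S. lt z a" and asym: "asymp lt"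
  obtains ys i where "xs = ys @ [i]" "ys \<noteq> []" "i \<in> S" "\<forall>b \<in> S. b = i \<or> lt b i"
    "sorted_wrt lt ys" "set ys = insert z (S - {i})"
proof -
  have irr: "\<not> lt b b" for b using asympD[OF asym, of b b] by blast
  obtain ys i where xs: "xs = ys @ [i]" using assms(2) by (cases xs rule: rev_cases) auto
  have s: "sorted_wrt lt ys" "\<And>b. b \<in> set ys \<Longrightarrow> lt b i" using assms(1) unfolding xs by (auto simp: sorted_wrt_append)
  have i: "i \<in> S"
  proof (rule ccontr)
    assume "i \<notin> S"
    then have "i = z" "a \<in> set ys" using assms(2,3) unfolding xs by auto
    then have "lt a z" "lt z a" using s(2) assms(3,4) by blast+
    then show False using asympD[OF asym] by blast
  qed
  have z: "z \<noteq> i" using i assms(4) irr by blast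
  have "i \<notin> set ys" using s(2) irr by blast
  then have ys: "set ys = insert z (S - {i})" using assms(2) i z unfolding xs by auto
  then have "ys \<noteq> []" by auto
  moreover have "b = i \<or> lt b i" if "b \<in> S" for b using that s(2) ys by auto
  ultimately show thesis using that[OF xs] s ys i by blast
qed

lemma cut_disjoint:
  assumes "valid V" "0 < Lc V a" "0 < Rc V b"
  shows "a < b"
  using assms unfolding valid_def balanced_def by blast

text \<open>Each stack length is bounded twice for the sake of the amortisation: the bound with
  \<open>card A\<close> says that the stacks do not grow back if nothing is marked, the bound with
  \<open>1\<close> limits their growth otherwise.\<close>

lemma search_inv_left:
  assumes inv: "search_inv V ord (lst @ [t]) rst s" and heavy: "regs s ''R'' \<le> regs s ''L''"
    and t: "0 < Lc V t" "\<And>a. 0 < Lc V a \<Longrightarrow> a = t \<or> a < t"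
    and lst: "sorted_wrt (<) lst" "set lst = insert 0 ({a. 0 < Lc V a} - {t})" "lst \<noteq> []"
    and vis: "visited t V D ord lst rst (regs s ''L'' - card (cut V (Suc t) t)) (regs s ''R'') A nw s'"
    and D: "set D = cut V (Suc t) t"
  shows "\<exists>lst' rst'. search_inv (V(t := V t \<union> A)) (ord @ nw) lst' rst' s' \<and>
    length lst' \<le> length lst + card A \<and> length lst' \<le> length lst + 1 \<and>
    length rst' \<le> length rst + card A \<and> length rst' \<le> length rst + 1"
proof -
  have val: "valid V" and ord: "set ord = (\<Union>t. V t)" "narrow ord"
    and sums: "regs s ''L'' = sum (Lc V) {..d}" "regs s ''R'' = sum (Rc V) {..d}"
    and rst: "sorted_wrt (>) rst" "set rst = insert (Suc d) {a. 0 < Rc V a}"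
    using inv unfolding search_inv_def by blast+
  have td: "t \<in> {1..d}" using cut_pos(1)[OF t(1)] .
  then obtain p where p: "t = Suc p" by (cases t) auto
  then have t1: "t - 1 = p" by simp
  define x y where "x = card (A \<inter> X p - V p)" and "y = card (A \<inter> X (Suc t) - V (Suc t))"
  have v: "set D \<subseteq> A" "A \<subseteq> X t - V t" "\<forall>u \<in> A. \<forall>v \<in> X t. E u v \<longrightarrow> v \<in> V t \<union> A"
    "core s' (V(t := V t \<union> A)) (ord @ nw)" "set ord \<union> set nw = set ord \<union> A" "linked (ord @ nw)"
    "regs s' ''L'' = regs s ''L'' - card (cut V (Suc t) t) + x" "regs s' ''R'' = regs s ''R'' + y"
    "holds s' ''lp'' ''ls'' (lst @ (if 0 < x \<and> last lst < p then [p] else []))"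
    "holds s' ''rp'' ''rs'' (rst @ (if 0 < y \<and> t < last rst then [t] else []))"
    using vis unfolding visited_def t1 x_def y_def by blast+
  have finA: "finite A" using v(2) finite_subset by blast
  have heavy': "sum (Rc V) {..d} \<le> sum (Lc V) {..d}" using heavy sums by simp
  let ?V = "V(t := V t \<union> A)"
  \<comment> \<open>The reflexivities select the left-moving alternative of \<open>dir\<close>:
    \<open>s\<close>, \<open>i\<close> and \<open>w\<close> become \<open>Suc t\<close>,
    \<open>t\<close> and \<open>p\<close>.\<close>
  note adv = advance[OF val disjI1[OF conjI[OF refl conjI[OF refl conjI[OF refl conjI[OF refl conjI[OF refl conjI[OF p refl]]]]]]]
      heavy' t v(2) v(1)[unfolded D] v(3) refl]
  have P: "Lc ?V = (Lc V)(t := 0, p := Lc V p + x)" using adv(5)[folded x_def] .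
  have Q: "Rc ?V = (Rc V)(t := Rc V t + y)" using adv(6)[folded y_def] .
  have P': "Lc ?V a = (if a = t then 0 else if a = p then Lc V p + x else Lc V a)" for a
    using fun_cong[OF P, of a] p by simp
  have Q': "Rc ?V a = (if a = t then Rc V t + y else Rc V a)" for a
    using fun_cong[OF Q, of a] by simp
  have xA: "x \<le> card A" "y \<le> card A" unfolding x_def y_def using finA by (auto intro!: card_mono)
  have le: "\<forall>a \<in> set lst. a = p \<or> a < p"
  proof -
    have "a = p \<or> a < p" if "a \<in> insert 0 ({a. 0 < Lc V a} - {t})" for a
    proof -
      have "a = 0 \<or> 0 < Lc V a \<and> a \<noteq> t" using that by blast
      then have "a < t \<or> a = 0" using t(2) by blast
      then show ?thesis using p by linarith
    qed
    then show ?thesis unfolding lst(2) by blast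
  qed
  have L: "sorted_wrt (<) (lst @ (if 0 < x \<and> last lst < p then [p] else []))"
    "set (lst @ (if 0 < x \<and> last lst < p then [p] else [])) =
      insert 0 (if 0 < x then insert p ({a. 0 < Lc V a} - {t}) else ({a. 0 < Lc V a} - {t}))"
    using stack_push[where y = x, OF lst(1,2) le lst(3) transp_on_less] .
  have ge: "\<forall>a \<in> set rst. a = t \<or> t < a"
  proof -
    have "t < a" if "a \<in> insert (Suc d) {a. 0 < Rc V a}" for a
    proof -
      have "a = Suc d \<or> 0 < Rc V a" using that by (simp only: insert_iff mem_Collect_eq)
      then show ?thesis using cut_disjoint[OF val t(1), of a] td by fastforce
    qed
    then show ?thesis unfolding rst(2) by blast
  qed
  have ne: "rst \<noteq> []" using rst(2) by auto
  note R = stack_push[where y = y, OF rst ge ne transp_on_greater]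
  have "search_inv ?V (ord @ nw) (lst @ (if 0 < x \<and> last lst < p then [p] else []))
      (rst @ (if 0 < y \<and> t < last rst then [t] else [])) s'"
    unfolding search_inv_def
  proof (intro conjI)
    show "valid ?V" by (rule adv(1))
    have "ord \<noteq> []" using inv unfolding search_inv_def by blast
    then show "ord @ nw \<noteq> []" by simp
    show "set (ord @ nw) = (\<Union>a. ?V a)"
      using v(5) ord(1) by (auto split: if_splits)
    show "narrow (ord @ nw)"
    proof (rule narrow_append[OF ord(2) _ v(5) finA])
      show "distinct (ord @ nw)" using v(4) unfolding core_def by blast
      show "card (border (set ord) - A) + card A \<le> 2 * K" using adv(4) unfolding ord(1) .
    qed
    \<comment> \<open>The register was decreased by truncated subtraction, which is exact because
      the piece is a summand of the total.\<close>
    have "card (cut V (Suc t) t) \<le> sum (Lc V) {..d}"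
      using td by (intro member_le_sum[of t "{..d}" "Lc V"]) auto
    then show "regs s' ''L'' = sum (Lc ?V) {..d}"
      using adv(2)[folded x_def] v(7) sums by linarith
    show "regs s' ''R'' = sum (Rc ?V) {..d}" using adv(3)[folded y_def] v(8) sums by linarith
    show "set (lst @ (if 0 < x \<and> last lst < p then [p] else [])) = insert 0 {a. 0 < Lc ?V a}"
      unfolding L(2) P' by (auto simp: p)
    show "set (rst @ (if 0 < y \<and> t < last rst then [t] else [])) = insert (Suc d) {a. 0 < Rc ?V a}"
      unfolding R(2) Q' by auto
  qed (fact v(4,6,9,10) L(1) R(1))+
  then show ?thesis using xA by (intro exI conjI) (assumption, auto)
qed

text \<open>Mirror image of \<open>search_inv_left\<close>; the popped gap is now \<open>p\<close>,
  named after the left neighbour of the bag that is entered.\<close>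

lemma search_inv_right:
  assumes inv: "search_inv V ord lst (rst @ [p]) s" and heavy: "regs s ''L'' \<le> regs s ''R''"
    and p: "0 < Rc V p" "\<And>a. 0 < Rc V a \<Longrightarrow> a = p \<or> p < a"
    and rst: "sorted_wrt (>) rst" "set rst = insert (Suc d) ({a. 0 < Rc V a} - {p})" "rst \<noteq> []"
    and vis: "visited t V D ord lst rst (regs s ''L'') (regs s ''R'' - card (cut V p t)) A nw s'"
    and D: "set D = cut V p t" and t: "t = Suc p"
  shows "\<exists>lst' rst'. search_inv (V(t := V t \<union> A)) (ord @ nw) lst' rst' s' \<and>
    length lst' \<le> length lst + card A \<and> length lst' \<le> length lst + 1 \<and>
    length rst' \<le> length rst + card A \<and> length rst' \<le> length rst + 1"
proof -
  have val: "valid V" and ord: "set ord = (\<Union>t. V t)" "narrow ord"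
    and sums: "regs s ''L'' = sum (Lc V) {..d}" "regs s ''R'' = sum (Rc V) {..d}"
    and lst: "sorted_wrt (<) lst" "set lst = insert 0 {a. 0 < Lc V a}"
    using inv unfolding search_inv_def by blast+
  have pd: "p \<in> {1..<d}" using cut_pos(2)[OF val p(1)] .
  have t1: "t - 1 = p" using t by simp
  define x y where "x = card (A \<inter> X p - V p)" and "y = card (A \<inter> X (Suc t) - V (Suc t))"
  have v: "set D \<subseteq> A" "A \<subseteq> X t - V t" "\<forall>u \<in> A. \<forall>v \<in> X t. E u v \<longrightarrow> v \<in> V t \<union> A"
    "core s' (V(t := V t \<union> A)) (ord @ nw)" "set ord \<union> set nw = set ord \<union> A" "linked (ord @ nw)"
    "regs s' ''L'' = regs s ''L'' + x" "regs s' ''R'' = regs s ''R'' - card (cut V p t) + y"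
    "holds s' ''lp'' ''ls'' (lst @ (if 0 < x \<and> last lst < p then [p] else []))"
    "holds s' ''rp'' ''rs'' (rst @ (if 0 < y \<and> t < last rst then [t] else []))"
    using vis unfolding visited_def t1 x_def y_def by blast+
  have finA: "finite A" using v(2) finite_subset by blast
  have heavy': "sum (Lc V) {..d} \<le> sum (Rc V) {..d}" using heavy sums by simp
  let ?V = "V(t := V t \<union> A)"
  note adv = advance[OF val disjI2[OF conjI[OF refl conjI[OF refl conjI[OF refl conjI[OF refl conjI[OF refl conjI[OF t refl]]]]]]]
      heavy' p v(2) v(1)[unfolded D] v(3) refl]
  have P: "Rc ?V = (Rc V)(p := 0, t := Rc V t + y)" using adv(5)[folded y_def] .
  have Q: "Lc ?V = (Lc V)(p := Lc V p + x)" using adv(6)[folded x_def] .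
  have P': "Rc ?V a = (if a = p then 0 else if a = t then Rc V t + y else Rc V a)" for a
    using fun_cong[OF P, of a] t by simp
  have Q': "Lc ?V a = (if a = p then Lc V p + x else Lc V a)" for a
    using fun_cong[OF Q, of a] by simp
  have xA: "x \<le> card A" "y \<le> card A" unfolding x_def y_def using finA by (auto intro!: card_mono)
  have ge: "\<forall>a \<in> set rst. a = t \<or> t < a"
  proof -
    have "a = t \<or> t < a" if "a \<in> insert (Suc d) ({a. 0 < Rc V a} - {p})" for a
    proof -
      have "a = Suc d \<or> 0 < Rc V a \<and> a \<noteq> p" using that by blast
      then have "a = Suc d \<or> p < a" using p(2) by blast
      then show ?thesis using t pd by fastforce
    qed
    then show ?thesis unfolding rst(2) by blast
  qed
  note R = stack_push[where y = y, OF rst(1,2) ge rst(3) transp_on_greater]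
  have le: "\<forall>a \<in> set lst. a = p \<or> a < p"
  proof -
    have "a < p" if "a \<in> insert 0 {a. 0 < Lc V a}" for a
    proof -
      have "a = 0 \<or> 0 < Lc V a" using that by (simp only: insert_iff mem_Collect_eq)
      then show ?thesis using cut_disjoint[OF val _ p(1), of a] pd by fastforce
    qed
    then show ?thesis unfolding lst(2) by blast
  qed
  have ne: "lst \<noteq> []" using lst(2) by auto
  note L = stack_push[where y = x, OF lst le ne transp_on_less]
  have "search_inv ?V (ord @ nw) (lst @ (if 0 < x \<and> last lst < p then [p] else []))
      (rst @ (if 0 < y \<and> t < last rst then [t] else [])) s'"
    unfolding search_inv_def
  proof (intro conjI)
    show "valid ?V" by (rule adv(1))
    have "ord \<noteq> []" using inv unfolding search_inv_def by blast
    then show "ord @ nw \<noteq> []" by simp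
    show "set (ord @ nw) = (\<Union>a. ?V a)"
      using v(5) ord(1) by (auto split: if_splits)
    show "narrow (ord @ nw)"
    proof (rule narrow_append[OF ord(2) _ v(5) finA])
      show "distinct (ord @ nw)" using v(4) unfolding core_def by blast
      show "card (border (set ord) - A) + card A \<le> 2 * K" using adv(4) unfolding ord(1) .
    qed
    have "card (cut V p t) \<le> sum (Rc V) {..d}"
      using pd member_le_sum[of p "{..d}" "Rc V"] by (simp add: t)
    then show "regs s' ''R'' = sum (Rc ?V) {..d}"
      using adv(2)[folded y_def] v(8) sums by linarith
    show "regs s' ''L'' = sum (Lc ?V) {..d}" using adv(3)[folded x_def] v(7) sums by linarith
    show "set (lst @ (if 0 < x \<and> last lst < p then [p] else [])) = insert 0 {a. 0 < Lc ?V a}"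
      unfolding L(2) Q' by auto
    show "set (rst @ (if 0 < y \<and> t < last rst then [t] else [])) = insert (Suc d) {a. 0 < Rc ?V a}"
      unfolding R(2) P' by (auto simp: t)
  qed (fact v(4,6,9,10) L(1) R(1))+
  then show ?thesis using xA by (intro exI conjI) (assumption, auto)
qed

definition step_post where
  "step_post V lst rst tm s' \<longleftrightarrow> (\<exists>V' ord' lst' rst' a. search_inv V' ord' lst' rst' s' \<and> tm \<le> 450 * (K + 1) * (a + 1) \<and>
    unvisited V' + a = unvisited V \<and> length lst' + length rst' + 1 \<le> length lst + length rst + 2 * a \<and>
    length lst' + length rst' \<le> length lst + length rst + 1)"

lemma step_post_mono: "step_post V lst rst tm s \<Longrightarrow> tm' \<le> tm \<Longrightarrow> step_post V lst rst tm' s"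
  unfolding step_post_def using le_trans by blast

text \<open>The cost accounting shared by both directions; \<open>new\<close> takes in the part that
  depends on the direction, and \<open>s1\<close> is the state after the pop, with \<open>i\<close>
  as the new stack height.\<close>

lemma wp_turn_step:
  assumes env: "env s" and inv: "search_inv V ord lst rst s" and t: "t \<in> {1..d}" "r \<le> Suc d" "r \<noteq> t"
    and z: "z = ''L'' \<and> h = ''lp'' \<or> z = ''R'' \<and> h = ''rp''"
    and s1: "s1 = s\<lparr>regs := (regs s)(h := i, ''t'' := t, ''s'' := r)\<rparr>"
    and ls: "holds s1 ''lp'' ''ls'' lst0" "lst0 \<noteq> []" and rs: "holds s1 ''rp'' ''rs'' rst0" "rst0 \<noteq> []"
    and shorter: "length lst0 + length rst0 + 1 = length lst + length rst"
    and new: "\<And>D A nw s'. set D = cut V r t \<Longrightarrow> visited t V D ord lst0 rst0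
        (regs s ''L'' - (if z = ''L'' then card (cut V r t) else 0))
        (regs s ''R'' - (if z = ''R'' then card (cut V r t) else 0)) A nw s' \<Longrightarrow>
      \<exists>lst' rst'. search_inv (V(t := V t \<union> A)) (ord @ nw) lst' rst' s' \<and>
        length lst' \<le> length lst0 + card A \<and> length lst' \<le> length lst0 + 1 \<and>
        length rst' \<le> length rst0 + card A \<and> length rst' \<le> length rst0 + 1"
  shows "wp (turn z) (\<lambda>tm s'. step_post V lst rst (tm + 30) s') s1"
proof -
  have core: "core s V ord" and ord: "set ord = (\<Union>t. V t)" and linked: "linked ord"
    using inv unfolding search_inv_def by blast+
  have regs1: "regs s1 ''t'' = t" "regs s1 ''s'' = r" "regs s1 ''L'' = regs s ''L''" "regs s1 ''R'' = regs s ''R''"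
    using z by (auto simp: s1)
  have env1: "env s1" using env by (subst env_cong[where s = s]) (auto simp: s1)
  have core1: "core s1 V ord" using core z by (subst core_cong[where s = s]) (auto simp: s1)
  have V: "V r \<subseteq> set ord" and z': "z = ''L'' \<or> z = ''R''" using ord z by blast+
  show ?thesis
  proof (rule wp_mono[OF wp_turn[OF env1 t(1) regs1(1) t(2,3) regs1(2) core1 linked V ls rs z', unfolded regs1(3,4)]],
      elim exE conjE)
    fix tm :: nat and s' D A nw
    assume D: "set D = cut V r t" and vis: "visited t V D ord lst0 rst0
        (regs s ''L'' - (if z = ''L'' then card (cut V r t) else 0))
        (regs s ''R'' - (if z = ''R'' then card (cut V r t) else 0)) A nw s'"
      and tm: "tm \<le> 400 * (K + 1) * (card A + 1)"
    obtain lst' rst' where inv': "search_inv (V(t := V t \<union> A)) (ord @ nw) lst' rst' s'"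
      "length lst' \<le> length lst0 + card A" "length lst' \<le> length lst0 + 1"
      "length rst' \<le> length rst0 + card A" "length rst' \<le> length rst0 + 1"
      using new[OF D vis] by blast
    have "A \<subseteq> X t - V t" using vis unfolding visited_def by blast
    then have "unvisited (V(t := V t \<union> A)) + card A = unvisited V" using t by (intro unvisited_update) auto
    moreover have "400 * (K + 1) * (card A + 1) + 50 \<le> 450 * (K + 1) * (card A + 1)" by (simp add: algebra_simps)
    then have "tm + 30 \<le> 450 * (K + 1) * (card A + 1)" using tm by linarith
    ultimately show "step_post V lst rst (tm + 30) s'"
      unfolding step_post_def using inv' shorter by (intro exI conjI) (assumption | linarith)+
  qed
qed

lemma wp_go_left:
  assumes env: "env s" and inv: "search_inv V ord lst rst s" and heavy: "regs s ''R'' \<le> regs s ''L''" "0 < regs s ''L''"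
  shows "wp go_left (step_post V lst rst) s"
proof -
  have L: "regs s ''L'' = sum (Lc V) {..d}" and ls: "holds s ''lp'' ''ls'' lst" and rs: "holds s ''rp'' ''rs'' rst"
    and lst: "sorted_wrt (<) lst" "set lst = insert 0 {a. 0 < Lc V a}"
    and rst: "set rst = insert (Suc d) {a. 0 < Rc V a}"
    using inv unfolding search_inv_def by blast+
  obtain a where a: "a \<in> {a. 0 < Lc V a}"
    using heavy(2) unfolding L by (metis (mono_tags, lifting) gr0I mem_Collect_eq sum.neutral)
  have z: "\<forall>b \<in> {a. 0 < Lc V a}. 0 < b"
  proof
    fix b assume "b \<in> {a. 0 < Lc V a}"
    then show "0 < b" using cut_pos(1)[of V b] by simp
  qed
  obtain lst0 t where lst0: "lst = lst0 @ [t]" "lst0 \<noteq> []" "t \<in> {a. 0 < Lc V a}"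
      "\<forall>b \<in> {a. 0 < Lc V a}. b = t \<or> b < t" "sorted_wrt (<) lst0" "set lst0 = insert 0 ({a. 0 < Lc V a} - {t})"
    by (rule stack_top[OF lst a z asymp_on_less])
  have t: "t \<in> {1..d}" using cut_pos(1)[of V t] lst0(3) by simp
  have ne: "rst \<noteq> []" using rst by auto
  have lp: "regs s ''lp'' = Suc (length lst0)" "arrs s ''ls'' (length lst0) = t"
    using ls unfolding holds_def lst0(1) by (auto simp: nth_append)
  define s1 where "s1 = s\<lparr>regs := (regs s)(''lp'' := length lst0, ''t'' := t, ''s'' := Suc t)\<rparr>"
  have ls1: "holds s1 ''lp'' ''ls'' lst0" using ls by (auto simp: holds_def s1_def lst0(1) nth_append)
  have rs1: "holds s1 ''rp'' ''rs'' rst" using rs by (auto simp: holds_def s1_def)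
  have tp: "0 < Lc V t" "\<And>a. 0 < Lc V a \<Longrightarrow> a = t \<or> a < t" using lst0(3,4) by blast+
  have turn: "wp (turn ''L'') (\<lambda>tm s'. step_post V lst rst (tm + 30) s') s1"
  proof (rule wp_turn_step[OF env inv t _ _ _ s1_def ls1 lst0(2) rs1 ne])
    fix D A nw s'
    assume D: "set D = cut V (Suc t) t" and vis: "visited t V D ord lst0 rst
      (regs s ''L'' - (if ''L'' = ''L'' then card (cut V (Suc t) t) else 0))
      (regs s ''R'' - (if ''L'' = ''R'' then card (cut V (Suc t) t) else 0)) A nw s'"
    have "visited t V D ord lst0 rst (regs s ''L'' - card (cut V (Suc t) t)) (regs s ''R'') A nw s'"
      using vis by simp
    from search_inv_left[OF inv[unfolded lst0(1)] heavy(1) tp lst0(5,6,2) this D]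
    show "\<exists>lst' rst'. search_inv (V(t := V t \<union> A)) (ord @ nw) lst' rst' s' \<and>
      length lst' \<le> length lst0 + card A \<and> length lst' \<le> length lst0 + 1 \<and>
      length rst' \<le> length rst + card A \<and> length rst' \<le> length rst + 1" .
  qed (use t lst0(1) in auto)
  show ?thesis
    unfolding go_left_def
    apply (simp add: wp_Seq lp s1_def[symmetric])
    apply (rule wp_mono[OF turn])
    apply (erule step_post_mono)
    apply simp
    done
qed

lemma wp_go_right:
  assumes env: "env s" and inv: "search_inv V ord lst rst s" and heavy: "regs s ''L'' \<le> regs s ''R''" "0 < regs s ''R''"
  shows "wp go_right (step_post V lst rst) s"
proof -
  have val: "valid V" and R: "regs s ''R'' = sum (Rc V) {..d}"
    and ls: "holds s ''lp'' ''ls'' lst" and rs: "holds s ''rp'' ''rs'' rst"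
    and rst: "sorted_wrt (>) rst" "set rst = insert (Suc d) {a. 0 < Rc V a}"
    and lst: "set lst = insert 0 {a. 0 < Lc V a}"
    using inv unfolding search_inv_def by blast+
  obtain a where a: "a \<in> {a. 0 < Rc V a}"
    using heavy(2) unfolding R by (metis (mono_tags, lifting) gr0I mem_Collect_eq sum.neutral)
  have z: "\<forall>b \<in> {a. 0 < Rc V a}. b < Suc d"
  proof
    fix b assume "b \<in> {a. 0 < Rc V a}"
    then show "b < Suc d" using cut_pos(2)[OF val, of b] by simp
  qed
  obtain rst0 p where rst0: "rst = rst0 @ [p]" "rst0 \<noteq> []" "p \<in> {a. 0 < Rc V a}"
      "\<forall>b \<in> {a. 0 < Rc V a}. b = p \<or> p < b" "sorted_wrt (>) rst0" "set rst0 = insert (Suc d) ({a. 0 < Rc V a} - {p})"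
    by (rule stack_top[OF rst a z asymp_on_greater])
  have t: "Suc p \<in> {1..d}" using cut_pos(2)[OF val, of p] rst0(3) by simp
  have ne: "lst \<noteq> []" using lst by auto
  have rp: "regs s ''rp'' = Suc (length rst0)" "arrs s ''rs'' (length rst0) = p"
    using rs unfolding holds_def rst0(1) by (auto simp: nth_append)
  define s1 where "s1 = s\<lparr>regs := (regs s)(''rp'' := length rst0, ''t'' := Suc p, ''s'' := p)\<rparr>"
  have swap: "s\<lparr>regs := (regs s)(''rp'' := length rst0, ''s'' := p, ''t'' := Suc p)\<rparr> = s1"
    by (simp add: s1_def fun_upd_twist)
  have rs1: "holds s1 ''rp'' ''rs'' rst0" using rs by (auto simp: holds_def s1_def rst0(1) nth_append)
  have ls1: "holds s1 ''lp'' ''ls'' lst" using ls by (auto simp: holds_def s1_def)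
  have pp: "0 < Rc V p" "\<And>a. 0 < Rc V a \<Longrightarrow> a = p \<or> p < a" using rst0(3,4) by blast+
  have turn: "wp (turn ''R'') (\<lambda>tm s'. step_post V lst rst (tm + 30) s') s1"
  proof (rule wp_turn_step[OF env inv t _ _ _ s1_def ls1 ne rs1 rst0(2)])
    fix D A nw s'
    assume D: "set D = cut V p (Suc p)" and vis: "visited (Suc p) V D ord lst rst0
      (regs s ''L'' - (if ''R'' = ''L'' then card (cut V p (Suc p)) else 0))
      (regs s ''R'' - (if ''R'' = ''R'' then card (cut V p (Suc p)) else 0)) A nw s'"
    have "visited (Suc p) V D ord lst rst0 (regs s ''L'') (regs s ''R'' - card (cut V p (Suc p))) A nw s'"
      using vis by simp
    from search_inv_right[OF inv[unfolded rst0(1)] heavy(1) pp rst0(5,6,2) this D refl]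
    show "\<exists>lst' rst'. search_inv (V(Suc p := V (Suc p) \<union> A)) (ord @ nw) lst' rst' s' \<and>
      length lst' \<le> length lst + card A \<and> length lst' \<le> length lst + 1 \<and>
      length rst' \<le> length rst0 + card A \<and> length rst' \<le> length rst0 + 1" .
  qed (use t rst0(1) in auto)
  show ?thesis
    unfolding go_right_def
    apply (simp add: wp_Seq rp swap)
    apply (rule wp_mono[OF turn])
    apply (erule step_post_mono)
    apply simp
    done
qed

lemma wp_search:
  assumes env: "env s" and inv: "search_inv V ord lst rst s"
  shows "wp search (\<lambda>tm s'. \<exists>V' ord'. core s' V' ord' \<and> linked ord' \<and> narrow ord' \<and> border (set ord') = {} \<and>
    ord' \<noteq> [] \<and> tm \<le> 1000 * (K + 1) * (5 * unvisited V + length lst + length rst + 1)) s"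
  unfolding search_def
proof (rule wp_While[where g = "(V, ord, lst, rst)" and
    \<phi> = "\<lambda>(V, ord, lst, rst). 1000 * (K + 1) * (5 * unvisited V + length lst + length rst)" and
    Inv = "\<lambda>(V, ord, lst, rst). search_inv V ord lst rst"], goal_cases init step exit)
  case init
  show ?case using inv by simp
next
  case (step g s')
  obtain V ord lst rst where g: "g = (V, ord, lst, rst)" by (cases g)
  have I: "search_inv V ord lst rst s'" using step(1) unfolding g by simp
  have "warrs go_left \<inter> {''row'', ''adj'', ''mem'', ''beg'', ''end'', ''in''} = {}"
    "warrs go_right \<inter> {''row'', ''adj'', ''mem'', ''beg'', ''end'', ''in''} = {}"
    by (auto simp: go_left_def go_right_def turn_def collect_def visit_def count_def update_def)
  then have env': "env s'"
    using env by (subst env_cong[where s = s]) (use frameD(2)[OF step(3)] in \<open>auto simp: disjoint_iff\<close>)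
  have pos: "0 < regs s' ''L'' + regs s' ''R''" using step(2) by simp
  have "wp (If (Less (Reg ''L'') (Reg ''R'')) go_right go_left) (\<lambda>tm s''. \<exists>tm'. tm \<le> tm' + 4 \<and> step_post V lst rst tm' s'') s'"
  proof (cases "regs s' ''L'' < regs s' ''R''")
    case True
    have "wp go_right (step_post V lst rst) s'"
      by (rule wp_go_right[OF env' I]) (use True in auto)
    then have "wp go_right (\<lambda>tm s''. \<exists>tm'. tm + 4 \<le> tm' + 4 \<and> step_post V lst rst tm' s'') s'"
      by (rule wp_mono) blast
    then show ?thesis using True by (simp add: wp_If)
  next
    case False
    have "wp go_left (step_post V lst rst) s'"
      by (rule wp_go_left[OF env' I]) (use False pos in auto)
    then have "wp go_left (\<lambda>tm s''. \<exists>tm'. tm + 4 \<le> tm' + 4 \<and> step_post V lst rst tm' s'') s'"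
      by (rule wp_mono) blast
    then show ?thesis using False by (simp add: wp_If)
  qed
  then show ?case
  proof (rule wp_mono, elim exE conjE)
    fix tm tm' :: nat and s''
    assume tm: "tm \<le> tm' + 4" and "step_post V lst rst tm' s''"
    then obtain V' ord' lst' rst' a where new: "search_inv V' ord' lst' rst' s''" "tm' \<le> 450 * (K + 1) * (a + 1)"
      "unvisited V' + a = unvisited V" "length lst' + length rst' + 1 \<le> length lst + length rst + 2 * a"
      "length lst' + length rst' \<le> length lst + length rst + 1"
      unfolding step_post_def by blast
    \<comment> \<open>\<open>w\<close> bounds from below the decrease of
      \<open>5 * unvisited\<close> plus the stack heights. If nothing is marked, the stacks together
      lose an entry; otherwise they gain at most one, and \<open>5 * a - 1\<close> is at least
      \<open>4 * a\<close>.\<close>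
    define w where "w = (if a = 0 then 1 else 4 * a)"
    have "5 * unvisited V' + length lst' + length rst' + w \<le> 5 * unvisited V + length lst + length rst"
      using new(3-5) unfolding w_def by auto
    then have "1000 * (K + 1) * (5 * unvisited V' + length lst' + length rst' + w) \<le>
        1000 * (K + 1) * (5 * unvisited V + length lst + length rst)" by (rule mult_le_mono2)
    then have le: "1000 * (K + 1) * (5 * unvisited V' + length lst' + length rst') + 1000 * (K + 1) * w \<le>
        1000 * (K + 1) * (5 * unvisited V + length lst + length rst)" by (simp only: add_mult_distrib2)
    have "450 * (K + 1) * (a + 1) + 20 \<le> 1000 * (K + 1) * w"
    proof -
      have "a + 1 \<le> 2 * w" "1 \<le> w" unfolding w_def by auto
      then have "(K + 1) * (a + 1) \<le> (K + 1) * (2 * w)" "1 \<le> (K + 1) * w"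
        by (simp_all only: mult_le_mono2) simp
      then have "450 * ((K + 1) * (a + 1)) + 20 \<le> 1000 * ((K + 1) * w)" by linarith
      then show ?thesis by (simp only: mult.assoc)
    qed
    then have "bcost (Less (Const 0) (Add (Reg ''L'') (Reg ''R''))) + 1 + tm +
        1000 * (K + 1) * (5 * unvisited V' + length lst' + length rst') \<le>
        1000 * (K + 1) * (5 * unvisited V + length lst + length rst)"
      using le tm new(2) by simp
    then show "\<exists>g'. (case g' of (V, ord, lst, rst) \<Rightarrow> search_inv V ord lst rst) s'' \<and>
        bcost (Less (Const 0) (Add (Reg ''L'') (Reg ''R''))) + 1 + tm +
          (case g' of (V, ord, lst, rst) \<Rightarrow> 1000 * (K + 1) * (5 * unvisited V + length lst + length rst))
        \<le> (case g of (V, ord, lst, rst) \<Rightarrow> 1000 * (K + 1) * (5 * unvisited V + length lst + length rst))"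
      using new(1) unfolding g by (intro exI[of _ "(V', ord', lst', rst')"]) simp
  qed
next
  case (exit tm g s')
  obtain V' ord' lst' rst' where g: "g = (V', ord', lst', rst')" by (cases g)
  have I: "search_inv V' ord' lst' rst' s'" using exit(1) unfolding g by simp
  then have val: "valid V'" and L: "regs s' ''L'' = sum (Lc V') {..d}" "regs s' ''R'' = sum (Rc V') {..d}"
    and ord: "set ord' = (\<Union>t. V' t)" and rest: "core s' V' ord'" "linked ord'" "narrow ord'" "ord' \<noteq> []"
    unfolding search_inv_def by blast+
  have "sum (Lc V') {..d} + sum (Rc V') {..d} = 0" using exit(2) unfolding L[symmetric] by simp
  then have "border (set ord') = {}" unfolding ord by (rule border_empty[OF val])
  moreover have "tm \<le> 1000 * (K + 1) * (5 * unvisited V + length lst + length rst + 1)"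
    using exit(4) unfolding g by (simp add: algebra_simps)
  ultimately show ?case using rest by blast
qed

lemma wp_start:
  assumes env: "env s" and c: "0 \<in> X (regs s ''c'')" and rd: "regs s ''d'' = d"
    and zero: "arrs s ''vis'' = (\<lambda>_. 0)" "arrs s ''seen'' = (\<lambda>_. 0)" "arrs s ''q'' = (\<lambda>_. 0)"
      "arrs s ''ord'' = (\<lambda>_. 0)" "arrs s ''pos'' = (\<lambda>_. 0)" "arrs s ''ls'' = (\<lambda>_. 0)"
      "regs s ''L'' = 0" "regs s ''R'' = 0"
  shows "wp start (\<lambda>tm s'. \<exists>V ord lst rst. search_inv V ord lst rst s' \<and> unvisited V \<le> (d + 1) * K \<and>
    length lst + length rst \<le> 4 \<and> tm \<le> 400 * (K + 1) * (K + 1)) s"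
proof -
  define t where "t = regs s ''c''"
  have t: "t \<in> {1..d}" using c X_empty[of t] unfolding t_def by fastforce
  then obtain p where p: "t = Suc p" by (cases t) auto
  have tp: "t - 1 = p" using p by simp
  have row: "arrs s ''row'' t = t * n" using env t unfolding env_def rows_def by auto
  define s1 where "s1 = s\<lparr>
    arrs := (arrs s)(''vis'' := (arrs s ''vis'')(t * n := Suc 0), ''seen'' := (arrs s ''seen'')(0 := Suc 0),
      ''rs'' := (arrs s ''rs'')(0 := Suc d)),
    regs := (regs s)(''t'' := t, ''w'' := Suc 0, ''g'' := Suc 0, ''lp'' := Suc 0, ''rp'' := Suc 0, ''h'' := 0)\<rparr>"
  have "wp visit (\<lambda>tm s'. \<exists>A nw. visited t (\<lambda>_. {}) [0] [0] [0] [Suc d] (regs s1 ''L'') (regs s1 ''R'') A nw s' \<and>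
      tm \<le> 300 * (K + 1) * (card A + 1)) s1"
  proof (rule wp_visit)
    show "env s1" using env by (subst env_cong[where s = s]) (auto simp: s1_def)
    have "matrix n ((\<lambda>_. 0)(t * n + 0 := Suc 0)) (\<lambda>i v. v \<in> ((\<lambda>_. {})(t := {} \<union> set [0])) i)"
      by (rule matrix_mark[where f = "\<lambda>_ _. False"]) (use n_pos in \<open>auto simp: matrix_def\<close>)
    then show "core s1 ((\<lambda>_. {})(t := {} \<union> set [0])) [0]"
      using n_pos zero by (auto simp: core_def s1_def holds_def)
  qed (use t c zero in \<open>auto simp: s1_def holds_def linked_def t_def\<close>)
  then have run: "wp visit (\<lambda>tm s'. \<exists>V ord lst rst. search_inv V ord lst rst s' \<and> unvisited V \<le> (d + 1) * K \<and>
    length lst + length rst \<le> 4 \<and> tm \<le> 300 * (K + 1) * (K + 1)) s1"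
  proof (rule wp_mono, elim exE conjE)
    fix tm :: nat and s' A nw
    assume tm: "tm \<le> 300 * (K + 1) * (card A + 1)"
      and vis: "visited t (\<lambda>_. {}) [0] [0] [0] [Suc d] (regs s1 ''L'') (regs s1 ''R'') A nw s'"
    define x y where "x = card (A \<inter> X p)" and "y = card (A \<inter> X (Suc t))"
    have LR: "regs s1 ''L'' = 0" "regs s1 ''R'' = 0" using zero by (simp_all add: s1_def)
    have v: "A \<subseteq> X t" "\<forall>u \<in> A. \<forall>v \<in> X t. E u v \<longrightarrow> v \<in> A"
      "core s' ((\<lambda>_. {})(t := A)) ([0] @ nw)" "set [0] \<union> set nw = set [0] \<union> A" "linked ([0] @ nw)" "set [0] \<subseteq> A"
      "regs s' ''L'' = x" "regs s' ''R'' = y"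
      "holds s' ''lp'' ''ls'' ([0] @ (if 0 < x \<and> 0 < p then [p] else []))"
      "holds s' ''rp'' ''rs'' ([Suc d] @ (if 0 < y \<and> t < Suc d then [t] else []))"
      using vis unfolding visited_def tp LR x_def y_def by simp_all
    let ?V = "(\<lambda>_. {})(t := A) :: nat \<Rightarrow> nat set"
    have "t \<le> d" using t by simp
    note st = valid_start[OF v(1,2) p this refl]
    have cA: "card A \<le> K" using card_mono[OF fin_X v(1)] card_X[of t] by linarith
    have Lc: "Lc ?V a = (if a = p then x else 0)" and Rc: "Rc ?V a = (if a = t then y else 0)" for a
      using fun_cong[OF st(4), of a] fun_cong[OF st(5), of a] by (simp_all add: x_def y_def)
    have "search_inv ?V ([0] @ nw) ([0] @ (if 0 < x \<and> 0 < p then [p] else []))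
      ([Suc d] @ (if 0 < y \<and> t < Suc d then [t] else [])) s'"
      unfolding search_inv_def
    proof (intro conjI)
      show "set ([0] @ nw) = (\<Union>t. ?V t)" using v(4,6) by (auto split: if_splits)
      show "narrow ([0] @ nw)"
        by (rule narrow_within[of _ A]) (use v(4,6) cA v(1) finite_subset in auto)
      show "regs s' ''L'' = sum (Lc ?V) {..d}" "regs s' ''R'' = sum (Rc ?V) {..d}"
        using v(7,8) st(2,3) by (simp_all add: x_def y_def)
      show "set ([0] @ (if 0 < x \<and> 0 < p then [p] else [])) = insert 0 {a. 0 < Lc ?V a}"
        unfolding Lc by auto
      show "set ([Suc d] @ (if 0 < y \<and> t < Suc d then [t] else [])) = insert (Suc d) {a. 0 < Rc ?V a}"
        unfolding Rc using t by auto
    qed (use st(1) v in auto)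
    moreover have "unvisited ?V \<le> (d + 1) * K"
    proof -
      have "unvisited ?V \<le> (\<Sum>t\<le>d. K)"
        unfolding unvisited_def
      proof (rule sum_mono)
        fix i
        have "card (X i - ?V i) \<le> card (X i)" by (intro card_mono) auto
        then show "card (X i - ?V i) \<le> K" using card_X[of i] by linarith
      qed
      then show ?thesis by simp
    qed
    moreover have "tm \<le> 300 * (K + 1) * (K + 1)"
      using tm mult_le_mono2[of "card A + 1" "K + 1" "300 * (K + 1)"] cA by linarith
    ultimately show "\<exists>V ord lst rst. search_inv V ord lst rst s' \<and> unvisited V \<le> (d + 1) * K \<and>
      length lst + length rst \<le> 4 \<and> tm \<le> 300 * (K + 1) * (K + 1)"
      by (intro exI conjI) (assumption | simp)+
  qed
  show ?thesis
    unfolding start_def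
    apply (simp add: wp_Seq t_def[symmetric] row rd s1_def[symmetric])
    apply (rule wp_mono[OF run])
    apply (elim exE conjE)
    apply (intro exI conjI, assumption)
      apply (simp_all add: algebra_simps)
    done
qed

end

section \<open>Writing the bags\<close>

text \<open>
  \<open>last\<close> maps a vertex to the largest position of a neighbour; the vertex belongs to the boundary of
  the prefix of length \<open>i\<close> iff its own position is below \<open>i\<close> and this one is not.
\<close>

definition last_positions :: com where
  "last_positions =
     ''p'' ::= Const 2 ;;
     While (Less (Reg ''p'') (Reg ''e''))
       (''u'' ::= Read ''in'' (Reg ''p'') ;;
        ''v'' ::= Read ''in'' (Add (Reg ''p'') (Const 1)) ;;
        ''x'' ::= Read ''pos'' (Reg ''u'') ;;
        ''y'' ::= Read ''pos'' (Reg ''v'') ;;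
        If (Less (Read ''last'' (Reg ''u'')) (Reg ''y'')) (Write ''last'' (Reg ''u'') (Reg ''y'')) Skip ;;
        If (Less (Read ''last'' (Reg ''v'')) (Reg ''x'')) (Write ''last'' (Reg ''v'') (Reg ''x'')) Skip ;;
        ''p'' ::= Add (Reg ''p'') (Const 2))"

text \<open>Works in place on \<open>bag\<close> and copies the survivors to the output behind the
  cell at \<open>p\<close>; that cell is reserved for the length, which is known only
  afterwards.\<close>

definition filter_bag :: com where
  "filter_bag =
     ''h'' ::= Const 0 ;;
     ''j'' ::= Const 0 ;;
     While (Less (Reg ''h'') (Reg ''g''))
       (''v'' ::= Read ''bag'' (Reg ''h'') ;;
        If (Less (Read ''last'' (Reg ''v'')) (Reg ''i'')) Skip
          (Write ''bag'' (Reg ''j'') (Reg ''v'') ;;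
           Write ''out'' (Add (Reg ''p'') (Add (Reg ''j'') (Const 1))) (Reg ''v'') ;;
           incr ''j'') ;;
        incr ''h'')"

text \<open>Bag \<open>0\<close>, the first vertex alone, only initialises \<open>bag\<close> and is
  not written out: if there is a second vertex, it is adjacent to the first one, which therefore
  reappears in bag \<open>1\<close>.\<close>

definition write_bags :: com where
  "write_bags =
     Write ''out'' (Const 0) (Sub (Reg ''w'') (Const 1)) ;;
     Write ''bag'' (Const 0) (Read ''ord'' (Const 0)) ;;
     ''g'' ::= Const 1 ;;
     ''p'' ::= Const 1 ;;
     ''i'' ::= Const 1 ;;
     While (Less (Reg ''i'') (Reg ''w''))
       (filter_bag ;;
        Write ''bag'' (Reg ''j'') (Read ''ord'' (Reg ''i'')) ;;
        Write ''out'' (Add (Reg ''p'') (Add (Reg ''j'') (Const 1))) (Read ''ord'' (Reg ''i'')) ;;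
        ''g'' ::= Add (Reg ''j'') (Const 1) ;;
        Write ''out'' (Reg ''p'') (Reg ''g'') ;;
        ''p'' ::= Add (Reg ''p'') (Add (Reg ''g'') (Const 1)) ;;
        incr ''i'')"

text \<open>Deriving each bag from its predecessor keeps the cost of a bag proportional to the size
  of that predecessor.\<close>

fun active :: "(nat \<Rightarrow> nat) \<Rightarrow> nat list \<Rightarrow> nat \<Rightarrow> nat list" where
  "active l ord 0 = [ord ! 0]"
| "active l ord (Suc i) = filter (\<lambda>v. Suc i \<le> l v) (active l ord i) @ [ord ! Suc i]"

text \<open>Restricted to \<open>i > 0\<close>, since the initial value \<open>0\<close> of
  \<open>last\<close> cannot be told from a neighbour at position \<open>0\<close>. The thresholds
  in \<open>active\<close> are all positive.\<close>

lemma wp_last_positions: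
  assumes enc: "encoded (arrs s ''in'') n es bs" and e: "regs s ''e'' = 2 + 2 * length es"
    and l: "arrs s ''last'' = (\<lambda>_. 0)"
  shows "wp last_positions (\<lambda>t s'. t \<le> 60 * (length es + 1) \<and>
    (\<forall>v. \<forall>i > 0. i \<le> arrs s' ''last'' v \<longleftrightarrow> (\<exists>u. adjacent es v u \<and> i \<le> arrs s ''pos'' u))) s"
  unfolding last_positions_def
  apply (simp add: wp_Seq)
proof (rule wp_While[where g = 0 and \<phi> = "\<lambda>j. 60 * (length es - j)" and Inv = "\<lambda>j s'. j \<le> length es \<and>
      regs s' ''p'' = 2 + 2 * j \<and>
      (\<forall>v. \<forall>i > 0. i \<le> arrs s' ''last'' v \<longleftrightarrow> (\<exists>u. adjacent (take j es) v u \<and> i \<le> arrs s ''pos'' u))"],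
    goal_cases init step exit)
  case init
  show ?case by (simp add: l adjacent_def)
next
  case (step j s')
  note fr = frameD[OF step(3)]
  have fr': "arrs s' ''in'' = arrs s ''in''" "arrs s' ''pos'' = arrs s ''pos''" "regs s' ''e'' = regs s ''e''"
    by (simp_all add: fr)
  from step(1) have j: "j \<le> length es" "regs s' ''p'' = 2 + 2 * j"
      "\<forall>v. \<forall>i > 0. i \<le> arrs s' ''last'' v \<longleftrightarrow> (\<exists>u. adjacent (take j es) v u \<and> i \<le> arrs s ''pos'' u)" by blast+
  have jl: "j < length es" using step(2) j(2) by (simp add: fr' e)
  have key: "length es - j = Suc (length es - Suc j)" using jl by simp
  obtain u v where uv: "es ! j = (u, v)" by fastforce
  have "in": "arrs s ''in'' (Suc (Suc (2 * j))) = u" "arrs s ''in'' (Suc (Suc (Suc (2 * j)))) = v"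
    using enc jl uv unfolding encoded_def by (auto simp: numeral_eq_Suc)
  define f where "f = arrs s' ''last''"
  define pu pv where "pu = arrs s ''pos'' u" and "pv = arrs s ''pos'' v"
  define f1 where "f1 = f(u := max (f u) pv)"
  define f2 where "f2 = f1(v := max (f1 v) pu)"
  have adj: "adjacent (take (Suc j) es) a b \<longleftrightarrow> adjacent (take j es) a b \<or> a = u \<and> b = v \<or> a = v \<and> b = u" for a b
    by (auto simp: take_Suc_conv_app_nth[OF jl] adjacent_def uv)
  have 1: "i \<le> f1 a \<longleftrightarrow> i \<le> f a \<or> a = u \<and> i \<le> pv" for i a unfolding f1_def by auto
  have 2: "i \<le> f2 a \<longleftrightarrow> i \<le> f1 a \<or> a = v \<and> i \<le> pu" for i a unfolding f2_def by auto
  have new: "\<forall>a. \<forall>i > 0. i \<le> f2 a \<longleftrightarrow> (\<exists>b. adjacent (take (Suc j) es) a b \<and> i \<le> arrs s ''pos'' b)"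
    unfolding 1 2 adj using j(3)[folded f_def] unfolding pu_def pv_def by blast
  show ?case (is "wp ?body _ _")
  proof -
    have "wp ?body (\<lambda>t s''. t \<le> 55 \<and> regs s'' ''p'' = 2 + 2 * Suc j \<and> arrs s'' ''last'' = f2) s'"
      apply (simp add: wp_Seq wp_If fr' j(2) "in" f_def[symmetric] pu_def[symmetric] pv_def[symmetric])
      apply (intro conjI impI)
         apply (auto simp: f2_def f1_def fun_eq_iff max_def f_def pu_def pv_def)
      done
    then show ?thesis
      by (rule wp_mono) (rule exI[of _ "Suc j"], use jl new in \<open>simp add: key\<close>)
  qed
next
  case (exit t j s')
  have "regs s' ''e'' = regs s ''e''" by (simp add: frameD(1)[OF exit(3)])
  then have "j = length es" using exit(1,2) e by simp
  then show ?case using exit(1,4) by simp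
qed

text \<open>Overwriting \<open>bag\<close> while reading it is safe because the write position never
  passes the read position; the last conjunct of the invariant preserves the unread part.\<close>

lemma wp_filter_bag:
  assumes h: "holds s ''g'' ''bag'' xs"
  defines "ys \<equiv> filter (\<lambda>v. regs s ''i'' \<le> arrs s ''last'' v) xs"
  shows "wp filter_bag (\<lambda>t s'. t \<le> 60 * (length xs + 1) \<and> holds s' ''j'' ''bag'' ys \<and>
    (\<forall>k < length ys. arrs s' ''out'' (regs s ''p'' + Suc k) = ys ! k) \<and>
    (\<forall>k \<le> regs s ''p''. arrs s' ''out'' k = arrs s ''out'' k)) s"
  unfolding filter_bag_def
  apply (simp add: wp_Seq)
proof (rule wp_While[where g = 0 and \<phi> = "\<lambda>h. 50 * (length xs - h)" and Inv = "\<lambda>h s'. h \<le> length xs \<and>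
      regs s' ''h'' = h \<and>
      holds s' ''j'' ''bag'' (filter (\<lambda>v. regs s ''i'' \<le> arrs s ''last'' v) (take h xs)) \<and>
      (\<forall>k < length (filter (\<lambda>v. regs s ''i'' \<le> arrs s ''last'' v) (take h xs)).
        arrs s' ''out'' (regs s ''p'' + Suc k) = filter (\<lambda>v. regs s ''i'' \<le> arrs s ''last'' v) (take h xs) ! k) \<and>
      (\<forall>k \<le> regs s ''p''. arrs s' ''out'' k = arrs s ''out'' k) \<and>
      (\<forall>k < length xs. h \<le> k \<longrightarrow> arrs s' ''bag'' k = xs ! k)"],
    goal_cases init step exit)
  case init
  show ?case using h by (auto simp: holds_def)
next
  case (step m s')
  note fr = frameD[OF step(3)]
  have fr': "regs s' ''g'' = regs s ''g''" "regs s' ''i'' = regs s ''i''" "regs s' ''p'' = regs s ''p''"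
    "arrs s' ''last'' = arrs s ''last''" by (simp_all add: fr)
  define P where "P = (\<lambda>v. regs s ''i'' \<le> arrs s ''last'' v)"
  define zs where "zs = filter P (take m xs)"
  from step(1) have I: "m \<le> length xs" "regs s' ''h'' = m" "holds s' ''j'' ''bag'' zs"
    "\<forall>k < length zs. arrs s' ''out'' (regs s ''p'' + Suc k) = zs ! k"
    "\<forall>k \<le> regs s ''p''. arrs s' ''out'' k = arrs s ''out'' k"
    "\<forall>k < length xs. m \<le> k \<longrightarrow> arrs s' ''bag'' k = xs ! k"
    unfolding zs_def P_def by blast+
  have m: "m < length xs" using step(2) I(2) h by (simp add: fr' holds_def)
  have key: "length xs - m = Suc (length xs - Suc m)" using m by simp
  define v where "v = xs ! m"
  have v: "arrs s' ''bag'' m = v" using I(6) m by (simp add: v_def)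
  have lz: "regs s' ''j'' = length zs" using I(3) by (rule holds_length)
  have zm: "length zs \<le> m" unfolding zs_def using length_filter_le[of P "take m xs"] I(1) by simp
  have takeS: "filter P (take (Suc m) xs) = zs @ (if P v then [v] else [])"
    using m by (simp add: take_Suc_conv_app_nth v_def zs_def)
  show ?case (is "wp ?body _ _")
  proof -
    have "wp ?body (\<lambda>t s''. t \<le> 40 \<and> regs s'' ''h'' = Suc m \<and> holds s'' ''j'' ''bag'' (filter P (take (Suc m) xs)) \<and>
      (\<forall>k < length (filter P (take (Suc m) xs)). arrs s'' ''out'' (regs s ''p'' + Suc k) = filter P (take (Suc m) xs) ! k) \<and>
      (\<forall>k \<le> regs s ''p''. arrs s'' ''out'' k = arrs s ''out'' k) \<and>
      (\<forall>k < length xs. Suc m \<le> k \<longrightarrow> arrs s'' ''bag'' k = xs ! k)) s'"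
    proof (cases "P v")
      case True
      then have lv: "\<not> arrs s ''last'' v < regs s ''i''" by (simp add: P_def)
      have t: "filter P (take (Suc m) xs) = zs @ [v]" using takeS True by simp
      show ?thesis
        unfolding t using I zm m
        by (simp add: wp_Seq wp_If fr' v lv lz) (auto simp: holds_def nth_append less_Suc_eq)
    next
      case False
      then have lv: "arrs s ''last'' v < regs s ''i''" by (simp add: P_def)
      have t: "filter P (take (Suc m) xs) = zs" using takeS False by simp
      show ?thesis
        unfolding t using I zm m
        by (simp add: wp_Seq wp_If fr' v lv lz) (auto simp: holds_def)
    qed
    then show ?thesis
      by (rule wp_mono) (rule exI[of _ "Suc m"], use m in \<open>simp add: key P_def\<close>)
  qed
next
  case (exit t m s')
  have "regs s' ''g'' = regs s ''g''" by (simp add: frameD(1)[OF exit(3)])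
  then have "m = length xs" using exit(1,2) h by (simp add: holds_def)
  then show ?case using exit(1,4) unfolding ys_def by simp
qed

lemma filter_bag_writes [simp]:
  "wregs filter_bag = {''h'', ''j'', ''v''}" "warrs filter_bag = {''bag'', ''out''}"
  unfolding filter_bag_def by auto

lemma wp_write_bags:
  assumes ord: "holds s ''w'' ''ord'' ord" "ord \<noteq> []"
    and B: "\<And>i. i < length ord \<Longrightarrow> length (active (arrs s ''last'') ord i) \<le> B"
  defines "zs \<equiv> map (active (arrs s ''last'') ord) [1..<length ord]"
  shows "wp write_bags (\<lambda>t s'. t \<le> 100 * (B + 2) * length ord \<and>
    (\<forall>k < length (encode_bags zs). arrs s' ''out'' k = encode_bags zs ! k)) s"
proof -
  let ?N = "length ord"
  define act where "act = active (arrs s ''last'') ord"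
  define enc where "enc i = concat (map (\<lambda>b. length b # b) (map act [1..<i]))" for i
  have encS: "enc (Suc i) = enc i @ length (act i) # act i" if "1 \<le> i" for i
    using that unfolding enc_def by simp
  have N: "regs s ''w'' = ?N" "arrs s ''ord'' 0 = ord ! 0" using ord by (auto simp: holds_def)
  show ?thesis
    unfolding write_bags_def
    apply (simp add: wp_Seq N)
  proof (rule wp_While[where g = 1 and \<phi> = "\<lambda>i. 100 * (B + 2) * (?N - i)" and Inv = "\<lambda>i s'. 1 \<le> i \<and> i \<le> ?N \<and>
      regs s' ''i'' = i \<and> holds s' ''g'' ''bag'' (act (i - 1)) \<and> regs s' ''p'' = Suc (length (enc i)) \<and>
      arrs s' ''out'' 0 = ?N - 1 \<and> (\<forall>k < length (enc i). arrs s' ''out'' (Suc k) = enc i ! k)"],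
      goal_cases init step exit)
    case init
    have "1 \<le> ?N" using ord(2) by (cases ord) auto
    then show ?case by (simp add: holds_def act_def enc_def)
  next
    case (step i s')
    note fr = frameD[OF step(3)]
    have fr': "regs s' ''w'' = ?N" "arrs s' ''last'' = arrs s ''last''" "arrs s' ''ord'' = arrs s ''ord''"
      using N by (simp_all add: fr)
    from step(1) have I: "1 \<le> i" "i \<le> ?N" "regs s' ''i'' = i" "holds s' ''g'' ''bag'' (act (i - 1))"
      "regs s' ''p'' = Suc (length (enc i))" "arrs s' ''out'' 0 = ?N - 1"
      "\<forall>k < length (enc i). arrs s' ''out'' (Suc k) = enc i ! k" by blast+
    have i: "i < ?N" using step(2) I(3) by (simp add: fr')
    have key: "?N - i = Suc (?N - Suc i)" using i by simp
    define ys where "ys = filter (\<lambda>v. i \<le> arrs s ''last'' v) (act (i - 1))"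
    obtain i' where i': "i = Suc i'" using I(1) by (cases i) auto
    have act: "act i = ys @ [ord ! i]" unfolding ys_def act_def i' by simp
    have oi: "arrs s ''ord'' i = ord ! i" using ord(1) i by (simp add: holds_def)
    have lenB: "length (act (i - 1)) \<le> B" using B[of "i - 1"] i unfolding act_def by simp
    have run: "wp filter_bag (\<lambda>t s'. t \<le> 60 * (B + 1) \<and> holds s' ''j'' ''bag'' ys \<and>
      (\<forall>k < length ys. arrs s' ''out'' (Suc (length (enc i)) + Suc k) = ys ! k) \<and>
      (\<forall>k \<le> Suc (length (enc i)). arrs s' ''out'' k = arrs s'' ''out'' k)) s''" if "s'' = s'" for s''
      using wp_filter_bag[OF I(4)] unfolding that
      by (rule wp_mono) (use lenB in \<open>simp add: I(3,5) fr' ys_def\<close>)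
    show ?case
    proof (rule wp_SeqI[OF run[OF refl]], elim conjE)
      fix tm :: nat and s1
      assume 1: "frame filter_bag s' s1" "tm \<le> 60 * (B + 1)" "holds s1 ''j'' ''bag'' ys"
        "\<forall>k < length ys. arrs s1 ''out'' (Suc (length (enc i)) + Suc k) = ys ! k"
        "\<forall>k \<le> Suc (length (enc i)). arrs s1 ''out'' k = arrs s' ''out'' k"
      note fr1 = frameD[OF 1(1), simplified]
      have e: "regs s1 ''i'' = i" "regs s1 ''p'' = Suc (length (enc i))" "arrs s1 ''ord'' i = ord ! i"
        "regs s1 ''j'' = length ys"
        using I oi 1(3) by (simp_all add: fr1 fr' holds_def)
      show "wp (Write ''bag'' (Reg ''j'') (Read ''ord'' (Reg ''i'')) ;;
        Write ''out'' (Add (Reg ''p'') (Add (Reg ''j'') (Const (Suc 0)))) (Read ''ord'' (Reg ''i'')) ;;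
        ''g'' ::= Add (Reg ''j'') (Const (Suc 0)) ;;
        Write ''out'' (Reg ''p'') (Reg ''g'') ;;
        ''p'' ::= Add (Reg ''p'') (Add (Reg ''g'') (Const (Suc 0))) ;;
        ''i'' ::= Add (Reg ''i'') (Const (Suc 0)))
        (\<lambda>t'. (\<lambda>t s''. \<exists>i'. (1 \<le> i' \<and> i' \<le> ?N \<and>
          regs s'' ''i'' = i' \<and> holds s'' ''g'' ''bag'' (act (i' - 1)) \<and> regs s'' ''p'' = Suc (length (enc i')) \<and>
          arrs s'' ''out'' 0 = ?N - 1 \<and> (\<forall>k < length (enc i'). arrs s'' ''out'' (Suc k) = enc i' ! k)) \<and>
          bcost (Less (Reg ''i'') (Reg ''w'')) + 1 + t + 100 * (B + 2) * (?N - i') \<le> 100 * (B + 2) * (?N - i)) (tm + t')) s1"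
        apply (simp add: wp_Seq e)
        apply (intro conjI)
             using i apply simp
            using 1(3) apply (simp add: act holds_def nth_append less_Suc_eq)
           apply (simp add: encS[OF I(1)] act)
          using 1(5) I(6) apply simp
         using 1(4,5) I(7) apply (auto simp: encS[OF I(1)] act nth_append nth_Cons split: nat.splits)[1]
         subgoal for k x2
           by (subgoal_tac "k = length (enc i) + Suc x2", simp, linarith)
        using 1(2) apply (simp add: key)
        done
    qed
  next
    case (exit t i s')
    have "regs s' ''w'' = ?N" using N by (simp add: frameD(1)[OF exit(3)])
    then have i: "i = ?N" using exit(1,2) by simp
    have enc: "encode_bags zs = (?N - 1) # enc ?N"
      unfolding encode_bags_def zs_def enc_def act_def by simp
    have "arrs s' ''out'' k = encode_bags zs ! k" if "k < length (encode_bags zs)" for k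
      using that exit(1) unfolding enc i by (cases k) auto
    moreover obtain N' where N': "?N = Suc N'" using ord(2) by (cases ord) auto
    have "100 * (B + 2) * ?N = 100 * (B + 2) * (?N - 1) + 100 * (B + 2)" unfolding N' by simp
    ultimately show ?case using exit(4) i by simp
  qed
qed

section \<open>Correctness\<close>

definition connect_path :: com where
  "connect_path = read_header ;; read_edges ;; read_bags ;; start ;; search ;; last_positions ;; write_bags"

context decomposed
begin

section \<open>The prefix bags as a path decomposition\<close>

definition prefix_bag :: "nat list \<Rightarrow> nat \<Rightarrow> nat set" where
  "prefix_bag ord i = insert (ord ! i) (border (set (take i ord)))"

lemma border_take:
  assumes "distinct ord" "set ord = {..<n}" "i < n"
  shows "border (set (take i ord)) = {ord ! j |j. j < i \<and> (\<exists>m. i \<le> m \<and> m < n \<and> E (ord ! j) (ord ! m))}"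
proof -
  have len: "length ord = n" using assms(1,2) by (metis card_lessThan distinct_card)
  have nth: "ord ! m \<in> set (take i ord) \<longleftrightarrow> m < i" if "m < n" for m
  proof
    assume "ord ! m \<in> set (take i ord)"
    then obtain j where "j < i" "j < n" "ord ! m = ord ! j" using len by (auto simp: in_set_conv_nth)
    then show "m < i" using assms(1) that len nth_eq_iff_index_eq by fastforce
  next
    assume "m < i"
    then show "ord ! m \<in> set (take i ord)" using that len by (auto simp: in_set_conv_nth)
  qed
  show ?thesis
  proof (intro equalityI subsetI)
    fix v assume "v \<in> border (set (take i ord))"
    then obtain u where v: "v \<in> set (take i ord)" "E v u" "u \<notin> set (take i ord)" unfolding border_def by blast
    obtain j where j: "j < i" "v = ord ! j" using v(1) by (auto simp: in_set_conv_nth)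
    have "u \<in> set ord" using E_less[OF v(2)] assms(2) by simp
    then obtain m where m: "m < n" "u = ord ! m" using len by (auto simp: in_set_conv_nth)
    then have "i \<le> m" using nth[OF m(1)] v(3) by auto
    then show "v \<in> {ord ! j |j. j < i \<and> (\<exists>m. i \<le> m \<and> m < n \<and> E (ord ! j) (ord ! m))}"
      using j m v(2) by blast
  next
    fix v assume "v \<in> {ord ! j |j. j < i \<and> (\<exists>m. i \<le> m \<and> m < n \<and> E (ord ! j) (ord ! m))}"
    then obtain j m where "v = ord ! j" "j < i" "i \<le> m" "m < n" "E v (ord ! m)" by blast
    moreover have "ord ! j \<in> set (take i ord)" "ord ! m \<notin> set (take i ord)"
      using nth[of j] nth[of m] calculation by auto
    ultimately show "v \<in> border (set (take i ord))" unfolding border_def by blast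
  qed
qed

text \<open>The thresholds increase, so a vertex that fails once would fail all later tests.
  Filtering step by step thus agrees with testing every earlier vertex against the current
  threshold, and this test detects a neighbour at position \<open>i\<close> or later.\<close>

lemma active_prefix_bag:
  assumes ord: "distinct ord" "set ord = {..<n}" and i: "i < n"
    and pos: "\<And>i. i < n \<Longrightarrow> pos (ord ! i) = i"
    and l: "\<And>v i. 0 < i \<Longrightarrow> i \<le> l v \<longleftrightarrow> (\<exists>u. E v u \<and> i \<le> pos u)"
  shows "set (active l ord i) = prefix_bag ord i" "distinct (active l ord i)"
proof -
  have len: "length ord = n" using ord by (metis card_lessThan distinct_card)
  have le: "i \<le> l v \<longleftrightarrow> (\<exists>m. i \<le> m \<and> m < n \<and> E v (ord ! m))" if "0 < i" for v i
  proof -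
    have "E v u \<and> i \<le> pos u \<longleftrightarrow> (\<exists>m. i \<le> m \<and> m < n \<and> u = ord ! m \<and> E v (ord ! m))" for u
    proof
      assume u: "E v u \<and> i \<le> pos u"
      then have "u \<in> set ord" using E_less ord(2) by auto
      then obtain m where "m < n" "u = ord ! m" using len by (auto simp: in_set_conv_nth)
      then show "\<exists>m. i \<le> m \<and> m < n \<and> u = ord ! m \<and> E v (ord ! m)" using u pos[of m] by auto
    qed (use pos in auto)
    then show ?thesis unfolding l[OF that] by blast
  qed
  have "set (active l ord i) = insert (ord ! i) {ord ! j |j. j < i \<and> i \<le> l (ord ! j)} \<and> distinct (active l ord i)"
    using i
  proof (induction i)
    case (Suc i)
    then have IH: "set (active l ord i) = insert (ord ! i) {ord ! j |j. j < i \<and> i \<le> l (ord ! j)}"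
      "distinct (active l ord i)" by auto
    have "{v \<in> set (active l ord i). Suc i \<le> l v} = {ord ! j |j. j < Suc i \<and> Suc i \<le> l (ord ! j)}"
      unfolding IH(1) by (auto simp: less_Suc_eq)
    moreover have "ord ! Suc i \<notin> {ord ! j |j. j < Suc i \<and> Suc i \<le> l (ord ! j)}"
      using Suc.prems ord(1) len nth_eq_iff_index_eq by fastforce
    ultimately show ?case using IH(2) by auto
  qed auto
  moreover have "{ord ! j |j. j < i \<and> i \<le> l (ord ! j)} = border (set (take i ord))"
  proof (cases "i = 0")
    case True
    then show ?thesis by (simp add: border_def)
  next
    case False
    then show ?thesis unfolding border_take[OF ord i] using le[of i] by simp
  qed
  ultimately show "set (active l ord i) = prefix_bag ord i" "distinct (active l ord i)"
    unfolding prefix_bag_def by simp_all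
qed

text \<open>Vertex \<open>ord ! a\<close> belongs to the bags from \<open>a\<close> up to the
  largest position of a neighbour, or to bag \<open>a\<close> alone if it has no later neighbour;
  this is an interval either way. An edge lies in the bag of its later endpoint.\<close>

lemma prefix_bags:
  assumes ord: "distinct ord" "set ord = {..<n}" and linked: "linked ord" and n2: "2 \<le> n"
    and loopfree: "\<And>u. \<not> E u u"
  defines "Zs \<equiv> map (prefix_bag ord) [1..<n]"
  shows "\<And>i. 1 \<le> i \<Longrightarrow> i < n \<Longrightarrow> (\<Union>(set (take i Zs))) = set (take (Suc i) ord)"
    and "\<And>u v. E u v \<Longrightarrow> \<exists>Z \<in> set Zs. u \<in> Z \<and> v \<in> Z"
    and "\<And>i j k. i \<le> j \<Longrightarrow> j \<le> k \<Longrightarrow> k < length Zs \<Longrightarrow> Zs ! i \<inter> Zs ! k \<subseteq> Zs ! j"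
proof -
  have len: "length ord = n" using ord by (metis card_lessThan distinct_card)
  have bag: "v \<in> prefix_bag ord i \<longleftrightarrow> v = ord ! i \<or>
      (\<exists>j. v = ord ! j \<and> j < i \<and> (\<exists>m. i \<le> m \<and> m < n \<and> E (ord ! j) (ord ! m)))" if "i < n" for v i
    unfolding prefix_bag_def border_take[OF ord that] by (simp only: insert_iff mem_Collect_eq)
  have inj: "ord ! a = ord ! b \<longleftrightarrow> a = b" if "a < n" "b < n" for a b
    using that ord(1) len nth_eq_iff_index_eq by blast
  have mem: "ord ! a \<in> prefix_bag ord i \<longleftrightarrow> a = i \<or> a < i \<and> (\<exists>m. i \<le> m \<and> m < n \<and> E (ord ! a) (ord ! m))"
    if ai: "a < n" "i < n" for a i
  proof
    assume "ord ! a \<in> prefix_bag ord i"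
    then consider "ord ! a = ord ! i" |
      j where "ord ! a = ord ! j" "j < i" "\<exists>m. i \<le> m \<and> m < n \<and> E (ord ! j) (ord ! m)"
      unfolding bag[OF ai(2)] by blast
    then show "a = i \<or> a < i \<and> (\<exists>m. i \<le> m \<and> m < n \<and> E (ord ! a) (ord ! m))"
    proof cases
      case 1
      then show ?thesis using inj[OF ai] by simp
    next
      case 2
      then have "a = j" using inj[of a j] ai by simp
      then show ?thesis using 2 by simp
    qed
  next
    assume "a = i \<or> a < i \<and> (\<exists>m. i \<le> m \<and> m < n \<and> E (ord ! a) (ord ! m))"
    then show "ord ! a \<in> prefix_bag ord i" unfolding bag[OF ai(2)] by metis
  qed
  have le: "\<exists>a \<le> i. v = ord ! a" if vi: "v \<in> prefix_bag ord i" "i < n" for v i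
  proof -
    have "v \<in> set (take (Suc i) ord)"
      using vi(1) unfolding prefix_bag_def border_def by (auto simp: take_Suc_conv_app_nth len vi(2))
    then show ?thesis by (auto simp: in_set_conv_nth less_Suc_eq_le)
  qed
  \<comment> \<open>Only \<open>ord ! 0\<close> comes before \<open>ord ! 1\<close>, so
    \<open>linked\<close> makes the two adjacent. This puts \<open>ord ! 0\<close> into bag
    \<open>1\<close> and permits the omission of bag \<open>0\<close>.\<close>
  have E01: "E (ord ! 0) (ord ! 1)"
  proof -
    have "1 < length ord" using n2 len by simp
    then obtain j where "j < 1" "E (ord ! j) (ord ! 1)" using linked unfolding linked_def by (metis less_one)
    then show ?thesis by simp
  qed
  show "(\<Union>(set (take i Zs))) = set (take (Suc i) ord)" if i: "1 \<le> i" "i < n" for i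
  proof -
    have "take i Zs = map (prefix_bag ord) (take i [1..<n])" unfolding Zs_def by (rule take_map)
    also have "take i [1..<n] = [1..<Suc i]" using i by (simp add: take_upt del: upt_Suc)
    finally have eq: "(\<Union>(set (take i Zs))) = (\<Union>l \<in> {1..<Suc i}. prefix_bag ord l)"
      by (simp del: upt_Suc)
    show ?thesis
    proof (intro equalityI subsetI)
      fix v assume "v \<in> \<Union>(set (take i Zs))"
      then obtain l where l: "1 \<le> l" "l < Suc i" "v \<in> prefix_bag ord l" unfolding eq by auto
      then obtain a where "a \<le> l" "v = ord ! a" using le[of v l] i by auto
      then show "v \<in> set (take (Suc i) ord)" using l i len by (auto simp: in_set_conv_nth intro!: exI[of _ a])
    next
      fix v assume "v \<in> set (take (Suc i) ord)"
      then obtain j where j: "v = ord ! j" "j \<le> i" by (auto simp: in_set_conv_nth)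
      show "v \<in> \<Union>(set (take i Zs))"
      proof (cases "j = 0")
        case True
        have "ord ! 0 \<in> prefix_bag ord 1" using mem[of 0 1] E01 n2 by auto
        then show ?thesis unfolding eq j(1) True using i(1) by (intro UN_I[of 1]) auto
      next
        case False
        have "v \<in> prefix_bag ord j" unfolding prefix_bag_def j(1) by simp
        then show ?thesis unfolding eq using j(2) False by (intro UN_I[of j]) auto
      qed
    qed
  qed
  have edge: "\<exists>Z \<in> set Zs. ord ! a \<in> Z \<and> ord ! b \<in> Z" if "a < b" "b < n" "E (ord ! a) (ord ! b)" for a b
  proof (rule bexI[of _ "prefix_bag ord b"])
    show "ord ! a \<in> prefix_bag ord b \<and> ord ! b \<in> prefix_bag ord b"
      using mem[of a b] mem[of b b] that by auto
    show "prefix_bag ord b \<in> set Zs" unfolding Zs_def using that by auto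
  qed
  show "\<exists>Z \<in> set Zs. u \<in> Z \<and> v \<in> Z" if uv: "E u v" for u v
  proof -
    have "u \<in> set ord" "v \<in> set ord" using E_less[OF uv] ord(2) by auto
    then obtain a b where ab: "a < n" "u = ord ! a" "b < n" "v = ord ! b" using len by (auto simp: in_set_conv_nth)
    have "a \<noteq> b" using uv loopfree ab by auto
    then consider "a < b" | "b < a" by linarith
    then show ?thesis using edge[of a b] edge[of b a] uv E_sym[OF uv] ab by cases auto
  qed
  show "Zs ! i \<inter> Zs ! k \<subseteq> Zs ! j" if ijk: "i \<le> j" "j \<le> k" "k < length Zs" for i j k
  proof
    fix v assume v: "v \<in> Zs ! i \<inter> Zs ! k"
    have k: "Suc k < n" using ijk(3) by (simp add: Zs_def)
    have Z: "Zs ! l = prefix_bag ord (Suc l)" if "l \<le> k" for l using that k by (simp add: Zs_def)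
    have "v \<in> prefix_bag ord (Suc i)" "Suc i < n" using v Z[of i] ijk k by simp_all
    then obtain a where a: "v = ord ! a" "a \<le> Suc i" using le[of v "Suc i"] by blast
    have an: "a < n" using a(2) ijk k by simp
    have "v \<in> prefix_bag ord (Suc k)" using v Z[of k] by simp
    then have "a = Suc k \<or> (\<exists>m. Suc k \<le> m \<and> m < n \<and> E (ord ! a) (ord ! m))"
      using mem[OF an k] a(1) by blast
    \<comment> \<open>A vertex at position \<open>Suc k\<close> occurs in no earlier bag, which
      forces \<open>i = j = k\<close>.\<close>
    moreover have "a = Suc k \<Longrightarrow> a = Suc j" using a(2) ijk by simp
    moreover have "a = Suc j \<or> a < Suc j" using a(2) ijk by auto
    ultimately have "ord ! a \<in> prefix_bag ord (Suc j)"
      using mem[OF an, of "Suc j"] ijk k by (meson Suc_le_mono le_less_trans le_trans)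
    then show "v \<in> Zs ! j" using Z[of j] ijk a(1) by simp
  qed
qed

section \<open>Bounds on the numbers of vertices, edges and input cells\<close>

lemma n_le: "n \<le> (K - 1) * d + 1"
proof -
  have "card (\<Union>t\<le>i. X t) \<le> (K - 1) * i + 1" for i
  proof (induction i)
    case 0
    have "X 0 = {}" by (rule X_empty) simp
    then show ?case by simp
  next
    case (Suc i)
    let ?U = "\<Union>t\<le>i. X t"
    have U: "(\<Union>t\<le>Suc i. X t) = ?U \<union> X (Suc i)" by (auto simp: le_Suc_eq)
    have le: "card (?U \<union> X (Suc i)) \<le> card ?U + card (X (Suc i) - ?U)"
      by (metis Un_Diff_cancel card_Un_le)
    show ?case
    proof (cases "?U = {} \<or> X (Suc i) \<subseteq> ?U")
      case True
      then show ?thesis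
      proof
        \<comment> \<open>The first nonempty bag may add \<open>K\<close> vertices; the summand
          \<open>1\<close> of the bound pays for the excess over \<open>K - 1\<close>.\<close>
        assume "?U = {}"
        then have "card (\<Union>t\<le>Suc i. X t) \<le> K" unfolding U using card_X[of "Suc i"] by simp
        then show ?thesis by (cases K) auto
      next
        assume "X (Suc i) \<subseteq> ?U"
        then have "card (\<Union>t\<le>Suc i. X t) = card ?U" unfolding U by (simp add: Un_absorb2)
        then show ?thesis using Suc by simp
      qed
    next
      case False
      have "?U \<noteq> {..<n}" using False layer_less by blast
      moreover have "?U \<subseteq> {..<n}" using layer_less by auto
      ultimately obtain u v where uv: "u \<in> ?U" "E u v" "v \<notin> ?U"
      proof -
        have "\<exists>u v. u \<in> ?U \<and> E u v \<and> v \<notin> ?U"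
        proof (rule ccontr)
          assume "\<not> (\<exists>u v. u \<in> ?U \<and> E u v \<and> v \<notin> ?U)"
          then have "?U = {..<n}" using False by (intro connected \<open>?U \<subseteq> {..<n}\<close>) metis+
          then show False using \<open>?U \<noteq> {..<n}\<close> by simp
        qed
        then show ?thesis using that by blast
      qed
      obtain a where a: "a \<le> i" "u \<in> X a" using uv(1) by blast
      obtain t where t: "u \<in> X t" "v \<in> X t" using E_X[OF uv(2)] by blast
      \<comment> \<open>The edge leaves the union of the earlier bags, so a bag \<open>t\<close>
        that contains it comes later. Convexity between \<open>a\<close> and \<open>t\<close> then
        places \<open>u\<close> in bag \<open>Suc i\<close>, which therefore adds fewer than
        \<open>card (X (Suc i))\<close> vertices.\<close>
      have "i < t" using t(2) uv(3) by (meson UN_I atMost_iff not_less)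
      then have "u \<in> X (Suc i)" using X_convex[of a "Suc i" t u] a t by simp
      then have "card (X (Suc i) - ?U) < card (X (Suc i))" using uv(1) by (intro psubset_card_mono) auto
      then show ?thesis unfolding U using le Suc card_X[of "Suc i"] by simp
    qed
  qed
  moreover have "(\<Union>t\<le>d. X t) = {..<n}"
  proof (intro equalityI subsetI)
    fix v assume "v \<in> {..<n}"
    then obtain t where "v \<in> X t" using layer_cover by blast
    then show "v \<in> (\<Union>t\<le>d. X t)" using X_empty[of t] by fastforce
  qed (use layer_less in auto)
  ultimately show ?thesis by (metis card_lessThan)
qed

lemma edges_le:
  assumes "distinct es"
  shows "length es \<le> d * (K * K)"
proof -
  have "set es \<subseteq> (\<Union>t \<in> {1..d}. X t \<times> X t)"
  proof
    fix e assume "e \<in> set es"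
    then obtain u v where e: "e = (u, v)" "E u v" unfolding adjacent_def by (metis surj_pair)
    then obtain t where "u \<in> X t" "v \<in> X t" using E_X by blast
    then show "e \<in> (\<Union>t \<in> {1..d}. X t \<times> X t)" using X_empty[of t] e(1) by fastforce
  qed
  then have "card (set es) \<le> card (\<Union>t \<in> {1..d}. X t \<times> X t)" by (intro card_mono) auto
  also have "\<dots> \<le> (\<Sum>t \<in> {1..d}. card (X t \<times> X t))" by (rule card_UN_le) simp
  also have "\<dots> \<le> (\<Sum>t \<in> {1..d}. K * K)"
    by (intro sum_mono) (simp add: card_cartesian_product card_X mult_le_mono)
  finally show ?thesis using assms by (simp add: distinct_card)
qed

lemma bag_offset_le: "bag_offset bs d \<le> d * (K + 1)"
proof -
  have "bag_offset bs i \<le> i * (K + 1)" if "i \<le> d" for i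
    using that
  proof (induction i)
    case (Suc i)
    have "length (bs ! i) \<le> K" using length_layer[of "Suc i"] Suc.prems by (simp add: layer_def)
    then show ?case using Suc bag_offset_Suc[of i bs] by simp
  qed (simp add: bag_offset_def)
  then show ?thesis by simp
qed

text \<open>\<open>l\<close> and \<open>pos\<close> stand for the final contents of the arrays
  \<open>last\<close> and \<open>pos\<close>, so the output bags can afterwards be studied without
  any machine state.\<close>

lemma wp_connect_path:
  assumes enc: "encoded (arrs s ''in'') n es bs"
    and zero: "\<And>a. a \<noteq> ''in'' \<Longrightarrow> arrs s a = (\<lambda>_. 0)" "\<And>x. regs s x = 0"
  shows "wp connect_path (\<lambda>t s'. \<exists>ord l pos. distinct ord \<and> set ord = {..<n} \<and> linked ord \<and> narrow ord \<and>
    (\<forall>i < n. pos (ord ! i) = i) \<and> (\<forall>v. \<forall>i > 0. i \<le> l v \<longleftrightarrow> (\<exists>u. E v u \<and> i \<le> pos u)) \<and>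
    (\<forall>k < length (encode_bags (map (active l ord) [1..<n])). arrs s' ''out'' k = encode_bags (map (active l ord) [1..<n]) ! k) \<and>
    t \<le> 40 * (n + d + 3) + (40 * (length es + 1) + (80 * (bag_offset bs d + 1) + (400 * (K + 1) * (K + 1) +
      (1000 * (K + 1) * (5 * ((d + 1) * K) + 5) + (60 * (length es + 1) + 100 * (2 * K + 2) * n)))))) s"
    (is "wp connect_path ?Q s")
  unfolding connect_path_def
proof (rule wp_SeqI[OF wp_read_header[OF enc]], elim conjE)
  fix t1 :: nat and s1
  assume 1: "frame read_header s s1" "t1 \<le> 40 * (n + d + 3)" "regs s1 ''n'' = n" "regs s1 ''e'' = 2 + 2 * length es"
    "regs s1 ''d'' = d" "rows (n + d + 2) n s1"
  note f1 = frameD[OF 1(1), unfolded read_header_def, simplified]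
  have enc1: "encoded (arrs s1 ''in'') n es bs" using enc by (simp add: f1)
  have es: "\<And>u v. (u, v) \<in> set es \<Longrightarrow> u < n \<and> v < n" using E_less unfolding adjacent_def by blast
  have adj0: "arrs s1 ''adj'' = (\<lambda>_. 0)" using zero by (simp add: f1)
  have edges: "wp read_edges (\<lambda>t s'. t \<le> 40 * (length es + 1) \<and> matrix n (arrs s' ''adj'') E) s1"
    by (rule wp_read_edges[OF enc1 1(6) _ es 1(4) adj0]) simp_all
  show "wp (read_edges ;; read_bags ;; start ;; search ;; last_positions ;; write_bags) (\<lambda>t'. ?Q (t1 + t')) s1"
  proof (rule wp_SeqI[OF edges], elim conjE)
    fix t2 :: nat and s2
    assume 2: "frame read_edges s1 s2" "t2 \<le> 40 * (length es + 1)" "matrix n (arrs s2 ''adj'') E"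
    note f2 = frameD[OF 2(1), unfolded read_edges_def, simplified]
    have enc2: "encoded (arrs s2 ''in'') n es bs" using enc1 by (simp add: f2)
    have rows2: "rows (n + d + 2) n s2" using 1(6) by (simp add: f2 rows_def)
    have e2: "regs s2 ''e'' = 2 + 2 * length es" "regs s2 ''d'' = d" using 1(4,5) by (simp_all add: f2)
    have mem0: "arrs s2 ''mem'' = (\<lambda>_. 0)" using zero by (simp add: f1 f2)
    have bags: "wp read_bags (\<lambda>t s'. t \<le> 80 * (bag_offset bs d + 1) \<and> matrix n (arrs s' ''mem'') (\<lambda>i v. v \<in> X i) \<and>
      ((\<exists>i. 0 \<in> X i) \<longrightarrow> 0 \<in> X (regs s' ''c'')) \<and> bag_table bs d s') s2"
      by (rule wp_read_bags[OF enc2 rows2 _ e2 mem0]) (rule layer_less)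
    show "wp (read_bags ;; start ;; search ;; last_positions ;; write_bags) (\<lambda>t'. ?Q (t1 + (t2 + t'))) s2"
    proof (rule wp_SeqI[OF bags], elim conjE)
      fix t3 :: nat and s3
      assume 3: "frame read_bags s2 s3" "t3 \<le> 80 * (bag_offset bs d + 1)" "matrix n (arrs s3 ''mem'') (\<lambda>i v. v \<in> X i)"
        "(\<exists>i. 0 \<in> X i) \<longrightarrow> 0 \<in> X (regs s3 ''c'')" "bag_table bs d s3"
      have "wregs read_bags = {''p'', ''i'', ''v'', ''c''}" "warrs read_bags = {''end'', ''beg'', ''mem''}"
        by (auto simp: read_bags_def read_bag_def)
      note f3 = frameD[OF 3(1), unfolded this, simplified]
      have env3: "env s3"
        unfolding env_def using rows2 2(3) 3(3,5) by (simp add: f3 rows_def)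
      have c3: "0 \<in> X (regs s3 ''c'')" using 3(4) layer_cover n_pos by blast
      have d3: "regs s3 ''d'' = d" using e2(2) by (simp add: f3)
      have z3: "arrs s3 ''vis'' = (\<lambda>_. 0)" "arrs s3 ''seen'' = (\<lambda>_. 0)" "arrs s3 ''q'' = (\<lambda>_. 0)"
        "arrs s3 ''ord'' = (\<lambda>_. 0)" "arrs s3 ''pos'' = (\<lambda>_. 0)" "arrs s3 ''ls'' = (\<lambda>_. 0)"
        "regs s3 ''L'' = 0" "regs s3 ''R'' = 0" "arrs s3 ''last'' = (\<lambda>_. 0)"
        using zero by (simp_all add: f1 f2 f3)
      have e3: "regs s3 ''e'' = 2 + 2 * length es" "encoded (arrs s3 ''in'') n es bs"
        using e2(1) enc2 by (simp_all add: f3)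
      note start = wp_start[OF env3 c3 d3 z3(1-8)]
      show "wp (start ;; search ;; last_positions ;; write_bags) (\<lambda>t'. ?Q (t1 + (t2 + (t3 + t')))) s3"
      proof (rule wp_SeqI[OF start], elim exE conjE)
        fix t4 :: nat and s4 V0 ord0 lst rst
        assume 4: "frame start s3 s4" "search_inv V0 ord0 lst rst s4" "unvisited V0 \<le> (d + 1) * K"
          "length lst + length rst \<le> 4" "t4 \<le> 400 * (K + 1) * (K + 1)"
        have w: "warrs start = {''vis'', ''seen'', ''rs'', ''q'', ''ord'', ''pos'', ''ls''}" "''e'' \<notin> wregs start"
          by (auto simp: start_def visit_def count_def update_def)
        note f4 = frameD(2)[OF 4(1), unfolded w(1), simplified]
        have env4: "env s4" using env3 by (subst env_cong[where s = s3]) (auto simp: f4)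
        have e4: "regs s4 ''e'' = 2 + 2 * length es" "encoded (arrs s4 ''in'') n es bs" "arrs s4 ''last'' = (\<lambda>_. 0)"
          using e3 z3(9) by (simp_all add: f4 frameD(1)[OF 4(1) w(2)])
        show "wp (search ;; last_positions ;; write_bags) (\<lambda>t'. ?Q (t1 + (t2 + (t3 + (t4 + t'))))) s4"
        proof (rule wp_SeqI[OF wp_search[OF env4 4(2)]], elim exE conjE)
          fix t5 :: nat and s5 V ord
          assume 5: "frame search s4 s5" "core s5 V ord" "linked ord" "narrow ord" "border (set ord) = {}" "ord \<noteq> []"
            "t5 \<le> 1000 * (K + 1) * (5 * unvisited V0 + length lst + length rst + 1)"
          have w5: "''in'' \<notin> warrs search" "''last'' \<notin> warrs search" "''e'' \<notin> wregs search"
            by (auto simp: search_def go_left_def go_right_def turn_def collect_def visit_def count_def update_def)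
          have e5: "regs s5 ''e'' = 2 + 2 * length es" "encoded (arrs s5 ''in'') n es bs" "arrs s5 ''last'' = (\<lambda>_. 0)"
            using e4 by (simp_all add: frameD(2)[OF 5(1) w5(1)] frameD(2)[OF 5(1) w5(2)] frameD(1)[OF 5(1) w5(3)])
          have ord: "distinct ord" "set ord \<subseteq> {..<n}" "holds s5 ''w'' ''ord'' ord" "\<forall>i < length ord. arrs s5 ''pos'' (ord ! i) = i"
            using 5(2) unfolding core_def by blast+
          \<comment> \<open>An empty boundary means that the visited set is closed under adjacency,
            so by connectedness it contains every vertex.\<close>
          have "v \<in> set ord" if "u \<in> set ord" "E u v" for u v
            using 5(5) that unfolding border_def by blast
          then have all: "set ord = {..<n}" using 5(6) by (intro connected ord(2)) auto
          have len: "length ord = n" using ord(1) all by (metis card_lessThan distinct_card)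
          show "wp (last_positions ;; write_bags) (\<lambda>t'. ?Q (t1 + (t2 + (t3 + (t4 + (t5 + t')))))) s5"
          proof (rule wp_SeqI[OF wp_last_positions[OF e5(2,1,3)]], elim conjE)
            fix t6 :: nat and s6
            assume 6: "frame last_positions s5 s6" "t6 \<le> 60 * (length es + 1)"
              "\<forall>v. \<forall>i > 0. i \<le> arrs s6 ''last'' v \<longleftrightarrow> (\<exists>u. E v u \<and> i \<le> arrs s5 ''pos'' u)"
            note f6 = frameD[OF 6(1), unfolded last_positions_def, simplified]
            define l where "l = arrs s6 ''last''"
            have pos: "\<And>i. i < n \<Longrightarrow> arrs s5 ''pos'' (ord ! i) = i" using ord(4) len by simp
            have l: "\<And>v i. 0 < i \<Longrightarrow> i \<le> l v \<longleftrightarrow> (\<exists>u. E v u \<and> i \<le> arrs s5 ''pos'' u)"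
              using 6(3) unfolding l_def by blast
            have ord6: "holds s6 ''w'' ''ord'' ord" using ord(3) by (simp add: holds_def f6)
            have B: "length (active l ord i) \<le> 2 * K" if i: "i < length ord" for i
            proof -
              have "length (active l ord i) = card (prefix_bag ord i)"
                using active_prefix_bag[OF ord(1) all i[unfolded len] pos l] by (metis distinct_card)
              also have "\<dots> \<le> 2 * K" using 5(4) i unfolding narrow_def prefix_bag_def by blast
              finally show ?thesis .
            qed
            show "wp write_bags (\<lambda>t'. ?Q (t1 + (t2 + (t3 + (t4 + (t5 + (t6 + t'))))))) s6"
            proof (rule wp_mono[OF wp_write_bags[OF ord6 5(6) B[unfolded l_def]]], assumption, elim conjE)
              fix t7 :: nat and s7 :: state
              assume 7: "t7 \<le> 100 * (2 * K + 2) * length ord"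
                "\<forall>k < length (encode_bags (map (active (arrs s6 ''last'') ord) [1..<length ord])).
                  arrs s7 ''out'' k = encode_bags (map (active (arrs s6 ''last'') ord) [1..<length ord]) ! k"
              have "t5 \<le> 1000 * (K + 1) * (5 * ((d + 1) * K) + 5)"
                using 5(7) mult_le_mono2[of "5 * unvisited V0 + length lst + length rst + 1" "5 * ((d + 1) * K) + 5" "1000 * (K + 1)"] 4(3,4)
                by linarith
              then have t: "t1 + (t2 + (t3 + (t4 + (t5 + (t6 + t7))))) \<le> 40 * (n + d + 3) + (40 * (length es + 1) +
                (80 * (bag_offset bs d + 1) + (400 * (K + 1) * (K + 1) +
                (1000 * (K + 1) * (5 * ((d + 1) * K) + 5) + (60 * (length es + 1) + 100 * (2 * K + 2) * n)))))"
                using 1(2) 2(2) 3(2) 4(5) 6(2) 7(1) unfolding len by (intro add_mono)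
              show "?Q (t1 + (t2 + (t3 + (t4 + (t5 + (t6 + t7)))))) s7"
                by (rule exI[of _ ord], rule exI[of _ l], rule exI[of _ "arrs s5 ''pos''"])
                  (intro conjI; (fact ord(1) all 5(3,4) t | use pos l 7(2) in \<open>simp add: l_def len\<close>))
            qed
          qed
        qed
      qed
    qed
  qed
qed

end

section \<open>Transfer from and to the graph, and the final time bound\<close>

lemma decomposed_instance:
  fixes G :: "nat pair_pre_digraph"
  assumes G: "pair_graph G" "pverts G = {..<n}" "connected (with_proj G)"
    and Xs: "path_decomposition G Xs" "width Xs = int k" and enc: "lists_edges es G" "lists_bags bs Xs"
  shows "decomposed n (Suc k) es bs"
proof -
  interpret pair_graph G by (rule G(1))
  have adj: "adjacent es u v \<longleftrightarrow> (u, v) \<in> parcs G" for u v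
    using enc(1) unfolding lists_edges_def adjacent_def by auto
  have Xbs: "Xs = map set bs" and dist: "\<forall>b \<in> set bs. distinct b" using enc(2) unfolding lists_bags_def by auto
  have cover: "(\<Union>(set Xs)) = {..<n}" and edge: "\<And>u v. (u, v) \<in> parcs G \<Longrightarrow> \<exists>X \<in> set Xs. u \<in> X \<and> v \<in> X"
    and conv: "\<And>i j k. i \<le> j \<Longrightarrow> j \<le> k \<Longrightarrow> k < length Xs \<Longrightarrow> Xs ! i \<inter> Xs ! k \<subseteq> Xs ! j"
    using Xs(1) G(2) unfolding path_decomposition_def by auto
  have lay: "\<exists>t. set (layer bs t) = X" if X: "X \<in> set Xs" for X
  proof -
    obtain i where "i < length bs" "X = set (bs ! i)" using X unfolding Xbs by (auto simp: in_set_conv_nth)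
    then show ?thesis by (intro exI[of _ "Suc i"]) (simp add: layer_def)
  qed
  have lay': "layer bs t = [] \<or> (t \<in> {1..length bs} \<and> layer bs t = bs ! (t - 1))" for t by (simp add: layer_def)
  have nV: "0 < n"
    using G(3) unfolding connected_def strongly_connected_def by (auto simp: G(2))
  show ?thesis
  proof
    show "distinct (layer bs t)" for t using dist lay'[of t] by auto
    show "v < n" if "v \<in> set (layer bs t)" for v t
      using that cover lay'[of t] unfolding Xbs by force
    show "length (layer bs t) \<le> Suc k" for t
    proof (cases "layer bs t = []")
      case False
      then have t: "layer bs t \<in> set bs" using lay'[of t] by auto
      then have "card (set (layer bs t)) \<le> Max (card ` set Xs)"
        unfolding Xbs by (intro Max_ge) auto
      moreover have "Max (card ` set Xs) = Suc k" using Xs(2) unfolding width_def by linarith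
      ultimately show ?thesis using dist t by (simp add: distinct_card)
    qed simp
    show "v \<in> set (layer bs b)" if "a \<le> b" "b \<le> c" "v \<in> set (layer bs a)" "v \<in> set (layer bs c)" for a b c v
    proof -
      have "a \<in> {1..length bs}" "c \<in> {1..length bs}" using that lay'[of a] lay'[of c] by auto
      then have b: "b \<in> {1..length bs}" using that by auto
      have "v \<in> Xs ! (a - 1) \<inter> Xs ! (c - 1)"
        using that lay'[of a] lay'[of c] unfolding Xbs by auto
      moreover have "Xs ! (a - 1) \<inter> Xs ! (c - 1) \<subseteq> Xs ! (b - 1)"
        using that \<open>c \<in> _\<close> by (intro conv) (auto simp: Xbs)
      ultimately show ?thesis using b unfolding Xbs layer_def by auto
    qed
    show "\<exists>t. u \<in> set (layer bs t) \<and> v \<in> set (layer bs t)" if "adjacent es u v" for u v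
      using edge[of u v] that lay unfolding adj by blast
    show "\<exists>t. v \<in> set (layer bs t)" if "v < n" for v
    proof -
      have "v \<in> \<Union>(set Xs)" using that cover by simp
      then show ?thesis using lay by blast
    qed
    show "0 < n" by (rule nV)
    show "S = {..<n}" if S: "S \<subseteq> {..<n}" "S \<noteq> {}" "\<And>u v. u \<in> S \<Longrightarrow> adjacent es u v \<Longrightarrow> v \<in> S" for S
    proof -
      obtain u where u: "u \<in> S" using S(2) by blast
      have "v \<in> S" if "v < n" for v
      proof -
        \<comment> \<open>Connectedness is reachability in the symmetric closure; as
          \<open>adjacent\<close> is symmetric, arcs of either orientation stay inside
          \<open>S\<close>.\<close>
        have "(u, v) \<in> rtrancl_on {..<n} (parcs (mk_symmetric (with_proj G)))"
          using G(3) u S(1) that unfolding connected_def strongly_connected_def reachable_def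
          by (auto simp: G(2))
        then show ?thesis
        proof (induction rule: rtrancl_on_induct)
          case base
          show ?case by (rule u)
        next
          case (step x y)
          then have "(x, y) \<in> parcs G \<or> (y, x) \<in> parcs G"
            unfolding parcs_mk_symmetric by auto
          then have "adjacent es x y" using adj unfolding adjacent_def by blast
          then show ?case using S(3) step by blast
        qed
      qed
      then show ?thesis using S(1) by auto
    qed
  qed
qed

text \<open>Following earlier neighbours leads from any vertex of the prefix back to
  \<open>ord ! 0\<close> without leaving the prefix; symmetry of the arcs then joins arbitrary
  pairs.\<close>

lemma connected_induced:
  fixes G :: "nat pair_pre_digraph"
  assumes "pair_graph G" "P = set (take (Suc i) ord)" "i < length ord"
    and linked: "\<And>i. i < length ord \<Longrightarrow> 0 < i \<Longrightarrow> \<exists>j < i. (ord ! j, ord ! i) \<in> parcs G"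
  shows "connected (with_proj G \<restriction> P)"
proof -
  let ?H = "with_proj (mk_symmetric (with_proj G \<restriction> P))" and ?A = "parcs (mk_symmetric (with_proj G \<restriction> P))"
  have arcs: "(u, v) \<in> ?A \<longleftrightarrow> u \<in> P \<and> v \<in> P \<and> ((u, v) \<in> parcs G \<or> (v, u) \<in> parcs G)" for u v
    by (auto simp: parcs_mk_symmetric)
  have P: "P = {ord ! j |j. j \<le> i}"
  proof (intro equalityI subsetI)
    fix v assume "v \<in> P"
    then obtain j where "j \<le> i" "v = ord ! j" unfolding assms(2) by (auto simp: in_set_conv_nth less_Suc_eq_le)
    then show "v \<in> {ord ! j |j. j \<le> i}" by blast
  next
    fix v assume "v \<in> {ord ! j |j. j \<le> i}"
    then obtain j where "j \<le> i" "v = ord ! j" by blast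
    then show "v \<in> P" unfolding assms(2) using assms(3) by (auto simp: in_set_conv_nth intro!: exI[of _ j])
  qed
  have "(ord ! 0, ord ! j) \<in> rtrancl_on P (?A)" if "j \<le> i" for j
    using that
  proof (induction j rule: less_induct)
    case (less j)
    have jP: "ord ! j \<in> P" using less.prems P by blast
    show ?case
    proof (cases "j = 0")
      case True
      then show ?thesis using jP by (auto intro: rtrancl_on_refl)
    next
      case False
      then obtain l where l: "l < j" "(ord ! l, ord ! j) \<in> parcs G" using linked[of j] less.prems assms(3) by auto
      then have lP: "ord ! l \<in> P" using less.prems P by auto
      have "(ord ! 0, ord ! l) \<in> rtrancl_on P (?A)"
        using less l by simp
      then show ?thesis
        by (rule rtrancl_on_into_rtrancl_on) (use arcs l lP jP in auto)
    qed
  qed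
  then have from0: "(ord ! 0, v) \<in> rtrancl_on P (?A)" if "v \<in> P" for v
    using that unfolding P by blast
  have sym: "sym (?A)" using arcs by (auto intro: symI)
  show ?thesis
    unfolding connected_def strongly_connected_def
  proof (intro conjI ballI)
    show "verts ?H \<noteq> {}" using P by auto
    fix u v assume "u \<in> verts ?H" "v \<in> verts ?H"
    then have "u \<in> P" "v \<in> P" by auto
    then have "(u, v) \<in> rtrancl_on P (?A)"
      using from0 rtrancl_on_trans symD[OF rtrancl_on_sym[OF sym]] by metis
    then show "u \<rightarrow>\<^sup>*\<^bsub>?H\<^esub> v" unfolding reachable_def by simp
  qed
qed

text \<open>As \<open>1 \<le> k\<close> and \<open>1 \<le> d\<close>, every monomial is absorbed by
  \<open>D = d * k\<^sup>2\<close>. The estimates add up to \<open>80860 * D\<close>, of which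
  \<open>75000 * D\<close> stem from the search; \<open>100000\<close> rounds this up.\<close>

lemma time_bound:
  fixes n d k m t :: nat
  assumes "1 \<le> k" "1 \<le> d" "n \<le> k * d + 1" "m \<le> d * (Suc k * Suc k)" "b \<le> d * (Suc k + 1)"
    and t: "t \<le> 40 * (n + d + 3) + (40 * (m + 1) + (80 * (b + 1) + (400 * (Suc k + 1) * (Suc k + 1) +
      (1000 * (Suc k + 1) * (5 * ((d + 1) * Suc k) + 5) + (60 * (m + 1) + 100 * (2 * Suc k + 2) * n)))))"
  shows "t \<le> 100000 * (d * k\<^sup>2)"
proof -
  define D where "D = d * k\<^sup>2"
  have k2: "k \<le> k\<^sup>2" "1 \<le> k\<^sup>2" using assms(1) by (simp_all add: power2_eq_square)
  have dk: "d * k \<le> D" "d \<le> D" "k\<^sup>2 \<le> D" "k \<le> D" "1 \<le> D"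
  proof -
    show "d * k \<le> D" "d \<le> D" "k\<^sup>2 \<le> D" unfolding D_def using k2 assms(2) by auto
    then show "k \<le> D" "1 \<le> D" using k2 by linarith+
  qed
  have ksq: "Suc k * Suc k = k\<^sup>2 + 2 * k + 1" "(Suc k + 1) * (Suc k + 1) = k\<^sup>2 + 4 * k + 4"
    by (simp_all add: power2_eq_square algebra_simps)
  have n: "n \<le> 2 * D" using assms(3) dk by (simp add: mult.commute)
  have m: "m \<le> 4 * D"
  proof -
    have "d * (Suc k * Suc k) = D + 2 * (d * k) + d" unfolding ksq D_def by (simp add: algebra_simps)
    then show ?thesis using assms(4) dk by linarith
  qed
  have b: "b \<le> 3 * D" using assms(5) dk by (simp add: algebra_simps)
  have s: "(Suc k + 1) * (Suc k + 1) \<le> 9 * D" unfolding ksq using dk by linarith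
  have se: "(Suc k + 1) * (5 * ((d + 1) * Suc k) + 5) \<le> 75 * D"
  proof -
    have "(Suc k + 1) * (5 * ((d + 1) * Suc k) + 5) = 5 * D + 15 * (d * k) + 10 * d + 5 * k\<^sup>2 + 20 * k + 20"
      unfolding D_def by (simp add: power2_eq_square algebra_simps)
    then show ?thesis using dk by linarith
  qed
  have w: "(2 * Suc k + 2) * n \<le> 12 * D"
  proof -
    have "(2 * Suc k + 2) * n \<le> (2 * Suc k + 2) * (k * d + 1)" using assms(3) by (rule mult_le_mono2)
    also have "\<dots> = 2 * D + 4 * (d * k) + 2 * k + 4" unfolding D_def by (simp add: power2_eq_square algebra_simps)
    finally show ?thesis using dk by linarith
  qed
  define p q r where "p = (Suc k + 1) * (Suc k + 1)" and "q = (Suc k + 1) * (5 * ((d + 1) * Suc k) + 5)"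
    and "r = (2 * Suc k + 2) * n"
  have "t \<le> 40 * (n + d + 3) + (40 * (m + 1) + (80 * (b + 1) + (400 * p + (1000 * q + (60 * (m + 1) + 100 * r)))))"
    using t unfolding p_def q_def r_def by (simp only: mult.assoc)
  then show ?thesis
    unfolding D_def[symmetric] using n m b s[folded p_def] se[folded q_def] w[folded r_def] dk(2,5) by simp
qed

text \<open>The premise \<open>1 \<le> k\<close> excludes the graph with a single vertex: for width
  \<open>0\<close> the bound \<open>k * length Xs\<close> would allow no bag at all, although the
  vertex has to be covered.\<close>

theorem theorem1:
  shows "\<exists>(prog :: com) (c :: nat).
    \<forall>(G :: nat pair_pre_digraph) (Xs :: nat set list) (k :: nat)
     (n :: nat) (es :: (nat \<times> nat) list) (bs :: nat list list).
      pair_graph G \<longrightarrow> pverts G = {..<n} \<longrightarrow> connected (with_proj G) \<longrightarrow>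
      path_decomposition G Xs \<longrightarrow> width Xs = int k \<longrightarrow> 1 \<le> k \<longrightarrow>
      lists_edges es G \<longrightarrow> lists_bags bs Xs \<longrightarrow>
      (\<exists>(Zs :: nat set list) (zs :: nat list list) (t :: nat).
         computes_in prog (encode_graph n es @ encode_bags bs) (encode_bags zs) t \<and>
         lists_bags zs Zs \<and>
         connected_path_decomposition G Zs \<and>
         width Zs \<le> 2 * int k + 1 \<and>
         length Zs \<le> k * length Xs \<and>
         t \<le> c * (length Xs * k\<^sup>2))"
proof (rule exI[of _ connect_path], rule exI[of _ 100000], intro allI impI)
  fix G :: "nat pair_pre_digraph" and Xs :: "nat set list" and k n :: nat
    and es :: "(nat \<times> nat) list" and bs :: "nat list list"
  assume G: "pair_graph G" "pverts G = {..<n}" "connected (with_proj G)"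
    and Xs: "path_decomposition G Xs" "width Xs = int k" and k: "1 \<le> k"
    and enc: "lists_edges es G" "lists_bags bs Xs"
  interpret decomposed n "Suc k" es bs by (rule decomposed_instance[OF G Xs enc])
  have E: "E u v \<longleftrightarrow> (u, v) \<in> parcs G" for u v
    using enc(1) unfolding lists_edges_def adjacent_def by auto
  have loopfree: "\<not> E u u" for u
    unfolding E using pair_loopfree_digraph.pair_no_loops[of G "(u, u)"] G(1)
    by (auto simp: pair_graph_def pair_digraph_def)
  have Xbs: "Xs = map set bs" using enc(2) unfolding lists_bags_def by simp
  have len_Xs: "length Xs = d" unfolding Xbs by simp
  have cover: "\<Union>(set Xs) = {..<n}" using Xs(1) G(2) unfolding path_decomposition_def by simp
  have ne: "Xs \<noteq> []" using cover n_pos by auto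
  then have d: "1 \<le> d" using len_Xs by (cases bs) (auto simp: Xbs)
  have "Max (card ` set Xs) = Suc k" using Xs(2) unfolding width_def by linarith
  moreover have "Max (card ` set Xs) \<in> card ` set Xs" using ne by (intro Max_in) auto
  ultimately obtain Y where Y: "Y \<in> set Xs" "card Y = Suc k" by auto
  \<comment> \<open>A bag that attains the width has \<open>k + 1 \<ge> 2\<close> vertices, so the
    graph has at least two and the \<open>n - 1\<close> output bags form a nonempty
    sequence.\<close>
  have "card Y \<le> card {..<n}" using Y(1) cover by (intro card_mono) auto
  then have n2: "2 \<le> n" using Y(2) k by simp
  let ?xs = "encode_graph n es @ encode_bags bs"
  have "encoded (arrs (initial_state ?xs) ''in'') n es bs"
    using encoded_input[OF refl, of n es bs] by (simp add: initial_state_def)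
  from wp_connect_path[OF this] obtain t s' ord l pos where run: "exec connect_path (initial_state ?xs) t s'"
    and ord: "distinct ord" "set ord = {..<n}" "linked ord" "narrow ord"
    and pos: "\<forall>i < n. pos (ord ! i) = i" and l: "\<forall>v. \<forall>i > 0. i \<le> l v \<longleftrightarrow> (\<exists>u. E v u \<and> i \<le> pos u)"
    and out: "\<forall>j < length (encode_bags (map (active l ord) [1..<n])).
      arrs s' ''out'' j = encode_bags (map (active l ord) [1..<n]) ! j"
    and t: "t \<le> 40 * (n + d + 3) + (40 * (length es + 1) + (80 * (bag_offset bs d + 1) + (400 * (Suc k + 1) * (Suc k + 1) +
      (1000 * (Suc k + 1) * (5 * ((d + 1) * Suc k) + 5) + (60 * (length es + 1) + 100 * (2 * Suc k + 2) * n)))))"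
    unfolding wp_def by (auto simp: initial_state_def)
  define zs where "zs = map (active l ord) [1..<n]"
  define Zs where "Zs = map (prefix_bag ord) [1..<n]"
  have len: "length ord = n" using ord(1,2) by (metis card_lessThan distinct_card)
  have act: "set (active l ord i) = prefix_bag ord i" "distinct (active l ord i)" if "i < n" for i
    using active_prefix_bag[OF ord(1,2) that] pos l by blast+
  have bags: "lists_bags zs Zs" unfolding lists_bags_def zs_def Zs_def using act by auto
  note prefix = prefix_bags[OF ord(1-3) n2 loopfree, folded Zs_def]
  have len_Zs: "length Zs = n - 1" by (simp add: Zs_def)
  have union: "\<Union>(set (take i Zs)) = set (take (Suc i) ord)" if "i \<in> {1..length Zs}" for i
  proof -
    from that len_Zs have "1 \<le> i" "i < n" by auto
    then show ?thesis by (rule prefix(1))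
  qed
  have "path_decomposition G Zs"
    unfolding path_decomposition_def
  proof (intro conjI)
    show "\<Union>(set Zs) = pverts G" using union[of "length Zs"] len_Zs n2 len ord(2) G(2) by simp
    show "\<forall>(u, v) \<in> parcs G. \<exists>X \<in> set Zs. u \<in> X \<and> v \<in> X" using prefix(2) unfolding E by blast
    show "\<forall>i j k. i \<le> j \<and> j \<le> k \<and> k < length Zs \<longrightarrow> Zs ! i \<inter> Zs ! k \<subseteq> Zs ! j" using prefix(3) by blast
  qed
  moreover have "connected (with_proj G \<restriction> \<Union>(set (take i Zs)))" if "i \<in> {1..length Zs}" for i
  proof (rule connected_induced[OF G(1) union[OF that]])
    show "i < length ord" using that len_Zs len by auto
    show "\<exists>j < i. (ord ! j, ord ! i) \<in> parcs G" if "i < length ord" "0 < i" for i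
      using ord(3) that unfolding linked_def E by blast
  qed
  ultimately have decomposition: "connected_path_decomposition G Zs"
    unfolding connected_path_decomposition_def by blast
  have width: "width Zs \<le> 2 * int k + 1"
  proof -
    have "card Z \<le> 2 * Suc k" if "Z \<in> set Zs" for Z
      using that ord(4) len unfolding Zs_def narrow_def prefix_bag_def by auto
    moreover have "Zs \<noteq> []" using len_Zs n2 by auto
    ultimately have "Max (card ` set Zs) \<le> 2 * Suc k" by (subst Max_le_iff) auto
    then have "int (Max (card ` set Zs)) \<le> int (2 * Suc k)" by (simp only: of_nat_le_iff)
    then show ?thesis unfolding width_def by simp
  qed
  have nd: "n \<le> k * d + 1" using n_le by simp
  have "computes_in connect_path ?xs (encode_bags zs) t"
    unfolding computes_in_def zs_def using run out by blast
  moreover have "length Zs \<le> k * length Xs" using nd unfolding len_Zs len_Xs by simp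
  moreover have "distinct es" using enc(1) unfolding lists_edges_def by blast
  then have "t \<le> 100000 * (length Xs * k\<^sup>2)"
    unfolding len_Xs using time_bound[OF k d nd edges_le bag_offset_le t] by blast
  ultimately show "\<exists>Zs zs t. computes_in connect_path ?xs (encode_bags zs) t \<and> lists_bags zs Zs \<and>
      connected_path_decomposition G Zs \<and> width Zs \<le> 2 * int k + 1 \<and> length Zs \<le> k * length Xs \<and>
      t \<le> 100000 * (length Xs * k\<^sup>2)"
    using bags decomposition width by blast
qed

end
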